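(* Let $\mathcal F$ be a d-minimal expansion of an ordered field. Let $G$ be a definable group and let $X$ be a definable $G$-set which is locally closed. Assume that the $G$-action on $X$ is definably proper. Then there exists a definable quotient $X \to X/G$, that is, a definable quotient of $X$ by the equivalence relation $\{(x,gx)\mid g\in G,\ x\in X\}$.
   Context: Let $\mathcal F=(F,<,\ldots)$ be an expansion of a dense linear order without endpoints. "Definable" means definable in $\mathcal F$ with parameters; a definable map is a map between definable sets whose graph is definable. $F$ carries the order topology, $F^n$ the product topology, and subsets of $F^n$ the relative topology. A definable subset of $F^n$ is called open/closed/locally closed if it is so in $F^n$, unless another ambient space is named. $\mathcal F$ is definably complete if every definable subset of $F$ has both a supremum and an infimum in $F\cup\{\pm\infty\}$. $\mathcal F$ is d-minimal if it is definably complete and every definable subset of $F$ is the union of an open set and finitely many discrete sets, where the number of discrete sets does not depend on the parameters of definition (i.e. for every definable $A\subseteq F^{m+1}$ there is $N\in\mathbb N$ such that for every $x\in F^m$ the fiber $\{y\in F\mid (x,y)\in A\}$ is the union of an open set and at most $N$ discrete sets). A definable subset of $F^n$ is definably compact if it is closed and bounded in $F^n$. A definable continuous map $f:X\to Y$ is definably proper if $f^{-1}(K)$ is definably compact for every definably compact subset $K$ of $Y$. A definable continuous map $f:X\to Y$ is definably identifying if it is surjective and, for every definable subset $K$ of $Y$, $K$ is closed in $Y$ whenever $f^{-1}(K)$ is closed in $X$. For a definable equivalence relation $E\subseteq X\times X$ on a definable set $X$, a definable quotient of $X$ by $E$ is a definably identifying map $f:X\to Y$ (to some definable set $Y$) such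 that $f(x)=f(x')$ if and only if $(x,x')\in E$. A definable group is a definable set $G$ with a group structure whose multiplication $G\times G\to G$ and inversion $G\to G$ are definable continuous maps. A definable $G$-set is a definable set $X$ with a group action $G\times X\to X$, $(g,x)\mapsto gx$, which is a definable continuous map. The $G$-action on $X$ is definably proper if the map $G\times X\ni(g,x)\mapsto(x,gx)\in X\times X$ is definably proper. *)

theory Defs
  imports
    "HOL-Analysis.Analysis"
    "HOL-Algebra.Group_Action"
    "HOL-Library.Extended"
    "HOL-Library.Lub_Glb"
begin

section \<open>Expansions of an ordered field and definable sets\<close>

text \<open>
  The ordered field is the type \<open>'a\<close> itself; an expansion interprets additional function symbols
  \<open>'f\<close> and relation symbols \<open>'r\<close>. Symbols are applied to argument lists of arbitrary length, so
  a symbol \<open>s\<close> stands for the family of symbols \<open>(s, k)\<close>, one for each arity \<open>k\<close>. A symbol of a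
  single arity is obtained by a trivial interpretation (\<open>0\<close>, respectively \<open>False\<close>) in the other
  arities, which does not change the definable sets.
\<close>

record ('f, 'r, 'a) expansion =
  fun_of :: "'f \<Rightarrow> 'a list \<Rightarrow> 'a"
  rel_of :: "'r \<Rightarrow> 'a list \<Rightarrow> bool"

datatype 'f trm =
    TVar nat
  | TAdd "'f trm" "'f trm"
  | TMul "'f trm" "'f trm"
  | TFun 'f "'f trm list"

datatype ('f, 'r) fm =
    FEq "'f trm" "'f trm"
  | FLess "'f trm" "'f trm"
  | FRel 'r "'f trm list"
  | FNeg "('f, 'r) fm"
  | FConj "('f, 'r) fm" "('f, 'r) fm"
  | FEx nat "('f, 'r) fm"

primrec tval :: "('f, 'r, 'a::linordered_field) expansion \<Rightarrow> (nat \<Rightarrow> 'a) \<Rightarrow> 'f trm \<Rightarrow> 'a" where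
  "tval M e (TVar i) = e i"
| "tval M e (TAdd s t) = tval M e s + tval M e t"
| "tval M e (TMul s t) = tval M e s * tval M e t"
| "tval M e (TFun f ts) = fun_of M f (map (tval M e) ts)"

primrec sat :: "('f, 'r, 'a::linordered_field) expansion \<Rightarrow> (nat \<Rightarrow> 'a) \<Rightarrow> ('f, 'r) fm \<Rightarrow> bool" where
  "sat M e (FEq s t) \<longleftrightarrow> tval M e s = tval M e t"
| "sat M e (FLess s t) \<longleftrightarrow> tval M e s < tval M e t"
| "sat M e (FRel r ts) \<longleftrightarrow> rel_of M r (map (tval M e) ts)"
| "sat M e (FNeg \<phi>) \<longleftrightarrow> \<not> sat M e \<phi>"
| "sat M e (FConj \<phi> \<psi>) \<longleftrightarrow> sat M e \<phi> \<and> sat M e \<psi>"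
| "sat M e (FEx i \<phi>) \<longleftrightarrow> (\<exists>a. sat M (e(i := a)) \<phi>)"

text \<open>
  Points of \<open>F\<^sup>n\<close> are functions on \<open>{..<n}\<close>, extended by \<open>undefined\<close>.
\<close>

abbreviation Fpow :: "nat \<Rightarrow> (nat \<Rightarrow> 'a) set" where
  "Fpow n \<equiv> {..<n} \<rightarrow>\<^sub>E UNIV"

abbreviation Fpow_top :: "nat \<Rightarrow> (nat \<Rightarrow> 'a::topological_space) topology" where
  "Fpow_top n \<equiv> product_topology (\<lambda>_. euclidean) {..<n}"

text \<open>
  Definability with parameters: the variables below \<open>n\<close> take the coordinates of the point, all
  other free variables of the formula take the values given by the parameters \<open>p\<close>.
\<close>

definition definable ::
    "('f, 'r, 'a::linordered_field) expansion \<Rightarrow> nat \<Rightarrow> (nat \<Rightarrow> 'a) set \<Rightarrow> bool" where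
  "definable M n A \<longleftrightarrow>
     (\<exists>\<phi> p. A = {x \<in> Fpow n. sat M (\<lambda>i. if i < n then x i else p i) \<phi>})"

text \<open>
  The identification \<open>F\<^sup>n \<times> F\<^sup>m = F\<^sup>n\<^sup>+\<^sup>m\<close>.
\<close>

definition join :: "nat \<Rightarrow> nat \<Rightarrow> (nat \<Rightarrow> 'a) \<Rightarrow> (nat \<Rightarrow> 'a) \<Rightarrow> nat \<Rightarrow> 'a" where
  "join n m x y = (\<lambda>i\<in>{..<n + m}. if i < n then x i else y (i - n))"

definition lpart :: "nat \<Rightarrow> (nat \<Rightarrow> 'a) \<Rightarrow> nat \<Rightarrow> 'a" where
  "lpart n z = restrict z {..<n}"

definition rpart :: "nat \<Rightarrow> nat \<Rightarrow> (nat \<Rightarrow> 'a) \<Rightarrow> nat \<Rightarrow> 'a" where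
  "rpart n m z = (\<lambda>i\<in>{..<m}. z (n + i))"

definition set_join :: "nat \<Rightarrow> nat \<Rightarrow> (nat \<Rightarrow> 'a) set \<Rightarrow> (nat \<Rightarrow> 'a) set \<Rightarrow> (nat \<Rightarrow> 'a) set" where
  "set_join n m A B = {join n m x y | x y. x \<in> A \<and> y \<in> B}"

lemma lpart_join: "x \<in> Fpow n \<Longrightarrow> lpart n (join n m x y) = x"
  by (auto simp: lpart_def join_def fun_eq_iff PiE_def extensional_def)

lemma rpart_join: "y \<in> Fpow m \<Longrightarrow> rpart n m (join n m x y) = y"
  by (auto simp: rpart_def join_def fun_eq_iff PiE_def extensional_def)

lemma join_parts: "z \<in> Fpow (n + m) \<Longrightarrow> join n m (lpart n z) (rpart n m z) = z"
  by (auto simp: rpart_def lpart_def join_def fun_eq_iff PiE_def extensional_def)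

lemma set_join_Fpow: "set_join n m (Fpow n) (Fpow m) = Fpow (n + m)"
proof
  show "set_join n m (Fpow n) (Fpow m) \<subseteq> Fpow (n + m)"
    by (auto simp: set_join_def join_def)
  show "Fpow (n + m) \<subseteq> set_join n m (Fpow n) (Fpow m)"
  proof
    fix z assume "z \<in> Fpow (n + m)"
    then have "z = join n m (lpart n z) (rpart n m z)" by (simp add: join_parts)
    moreover have "lpart n z \<in> Fpow n" "rpart n m z \<in> Fpow m"
      by (auto simp: lpart_def rpart_def)
    ultimately show "z \<in> set_join n m (Fpow n) (Fpow m)" unfolding set_join_def by blast
  qed
qed

section \<open>d-minimality\<close>

definition definably_complete ::
    "('f, 'r, 'a::linordered_field) expansion \<Rightarrow> bool" where
  "definably_complete M \<longleftrightarrow>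
     (\<forall>A. definable M 1 A \<longrightarrow>
       (\<exists>s. isLub UNIV (Fin ` {y. (\<lambda>i\<in>{..<1}. y) \<in> A}) s) \<and>
       (\<exists>s. isGlb UNIV (Fin ` {y. (\<lambda>i\<in>{..<1}. y) \<in> A}) s))"

definition d_minimal ::
    "('f, 'r, 'a::{linordered_field, linorder_topology}) expansion \<Rightarrow> bool" where
  "d_minimal M \<longleftrightarrow> definably_complete M \<and>
     (\<forall>m A. definable M (m + 1) A \<longrightarrow>
       (\<exists>N. \<forall>x \<in> Fpow m. \<exists>U \<D>. open U \<and> finite \<D> \<and> card \<D> \<le> N \<and> (\<forall>D\<in>\<D>. discrete D) \<and>
          {y. x(m := y) \<in> A} = U \<union> \<Union>\<D>))"

section \<open>Definable maps and definable quotients\<close>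

definition definable_map ::
    "('f, 'r, 'a::linordered_field) expansion \<Rightarrow> nat \<Rightarrow> nat \<Rightarrow>
      (nat \<Rightarrow> 'a) set \<Rightarrow> (nat \<Rightarrow> 'a) set \<Rightarrow> ((nat \<Rightarrow> 'a) \<Rightarrow> nat \<Rightarrow> 'a) \<Rightarrow> bool" where
  "definable_map M n m X Y f \<longleftrightarrow>
     definable M n X \<and> definable M m Y \<and> f \<in> X \<rightarrow> Y \<and>
     definable M (n + m) {join n m x (f x) | x. x \<in> X}"

definition definable_continuous_map ::
    "('f, 'r, 'a::{linordered_field, linorder_topology}) expansion \<Rightarrow> nat \<Rightarrow> nat \<Rightarrow>
      (nat \<Rightarrow> 'a) set \<Rightarrow> (nat \<Rightarrow> 'a) set \<Rightarrow> ((nat \<Rightarrow> 'a) \<Rightarrow> nat \<Rightarrow> 'a) \<Rightarrow> bool" where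
  "definable_continuous_map M n m X Y f \<longleftrightarrow>
     definable_map M n m X Y f \<and>
     continuous_map (subtopology (Fpow_top n) X) (subtopology (Fpow_top m) Y) f"

definition locally_closed :: "nat \<Rightarrow> (nat \<Rightarrow> 'a::topological_space) set \<Rightarrow> bool" where
  "locally_closed n X \<longleftrightarrow>
     (\<exists>U C. openin (Fpow_top n) U \<and> closedin (Fpow_top n) C \<and> X = U \<inter> C)"

definition bounded_in_Fpow :: "nat \<Rightarrow> (nat \<Rightarrow> 'a::linorder) set \<Rightarrow> bool" where
  "bounded_in_Fpow n K \<longleftrightarrow> (\<exists>a b. \<forall>x\<in>K. \<forall>i<n. a \<le> x i \<and> x i \<le> b)"

definition definably_compact ::
    "('f, 'r, 'a::{linordered_field, linorder_topology}) expansion \<Rightarrow> nat \<Rightarrow>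
      (nat \<Rightarrow> 'a) set \<Rightarrow> bool" where
  "definably_compact M n K \<longleftrightarrow>
     definable M n K \<and> closedin (Fpow_top n) K \<and> bounded_in_Fpow n K"

definition definably_proper ::
    "('f, 'r, 'a::{linordered_field, linorder_topology}) expansion \<Rightarrow> nat \<Rightarrow> nat \<Rightarrow>
      (nat \<Rightarrow> 'a) set \<Rightarrow> (nat \<Rightarrow> 'a) set \<Rightarrow> ((nat \<Rightarrow> 'a) \<Rightarrow> nat \<Rightarrow> 'a) \<Rightarrow> bool" where
  "definably_proper M n m X Y f \<longleftrightarrow>
     definable_continuous_map M n m X Y f \<and>
     (\<forall>K. K \<subseteq> Y \<and> definably_compact M m K \<longrightarrow> definably_compact M n {x \<in> X. f x \<in> K})"

definition definably_identifying ::
    "('f, 'r, 'a::{linordered_field, linorder_topology}) expansion \<Rightarrow> nat \<Rightarrow> nat \<Rightarrow>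
      (nat \<Rightarrow> 'a) set \<Rightarrow> (nat \<Rightarrow> 'a) set \<Rightarrow> ((nat \<Rightarrow> 'a) \<Rightarrow> nat \<Rightarrow> 'a) \<Rightarrow> bool" where
  "definably_identifying M n m X Y f \<longleftrightarrow>
     definable_continuous_map M n m X Y f \<and> f ` X = Y \<and>
     (\<forall>K. K \<subseteq> Y \<and> definable M m K \<and>
          closedin (subtopology (Fpow_top n) X) {x \<in> X. f x \<in> K} \<longrightarrow>
          closedin (subtopology (Fpow_top m) Y) K)"

definition definable_equivalence ::
    "('f, 'r, 'a::linordered_field) expansion \<Rightarrow> nat \<Rightarrow>
      (nat \<Rightarrow> 'a) set \<Rightarrow> ((nat \<Rightarrow> 'a) \<times> (nat \<Rightarrow> 'a)) set \<Rightarrow> bool" where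
  "definable_equivalence M n X E \<longleftrightarrow>
     definable M n X \<and> equiv X E \<and> definable M (n + n) {join n n x y | x y. (x, y) \<in> E}"

definition definable_quotient ::
    "('f, 'r, 'a::{linordered_field, linorder_topology}) expansion \<Rightarrow> nat \<Rightarrow>
      (nat \<Rightarrow> 'a) set \<Rightarrow> ((nat \<Rightarrow> 'a) \<times> (nat \<Rightarrow> 'a)) set \<Rightarrow>
      nat \<Rightarrow> (nat \<Rightarrow> 'a) set \<Rightarrow> ((nat \<Rightarrow> 'a) \<Rightarrow> nat \<Rightarrow> 'a) \<Rightarrow> bool" where
  "definable_quotient M n X E m Y f \<longleftrightarrow>
     definable_equivalence M n X E \<and> definably_identifying M n m X Y f \<and>
     (\<forall>x\<in>X. \<forall>x'\<in>X. f x = f x' \<longleftrightarrow> (x, x') \<in> E)"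

section \<open>Definable groups and definable \<open>G\<close>-sets\<close>

definition definable_group ::
    "('f, 'r, 'a::{linordered_field, linorder_topology}) expansion \<Rightarrow> nat \<Rightarrow>
      (nat \<Rightarrow> 'a) monoid \<Rightarrow> bool" where
  "definable_group M k G \<longleftrightarrow>
     group G \<and> definable M k (carrier G) \<and>
     definable_continuous_map M (k + k) k (set_join k k (carrier G) (carrier G)) (carrier G)
       (\<lambda>z. lpart k z \<otimes>\<^bsub>G\<^esub> rpart k k z) \<and>
     definable_continuous_map M k k (carrier G) (carrier G) (\<lambda>g. inv\<^bsub>G\<^esub> g)"

definition definable_G_set ::
    "('f, 'r, 'a::{linordered_field, linorder_topology}) expansion \<Rightarrow> nat \<Rightarrow>
      (nat \<Rightarrow> 'a) monoid \<Rightarrow> nat \<Rightarrow> (nat \<Rightarrow> 'a) set \<Rightarrow>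
      ((nat \<Rightarrow> 'a) \<Rightarrow> (nat \<Rightarrow> 'a) \<Rightarrow> nat \<Rightarrow> 'a) \<Rightarrow> bool" where
  "definable_G_set M k G n X act \<longleftrightarrow>
     definable M n X \<and> group_action G X act \<and>
     definable_continuous_map M (k + n) n (set_join k n (carrier G) X) X
       (\<lambda>z. act (lpart k z) (rpart k n z))"

definition definably_proper_action ::
    "('f, 'r, 'a::{linordered_field, linorder_topology}) expansion \<Rightarrow> nat \<Rightarrow>
      (nat \<Rightarrow> 'a) monoid \<Rightarrow> nat \<Rightarrow> (nat \<Rightarrow> 'a) set \<Rightarrow>
      ((nat \<Rightarrow> 'a) \<Rightarrow> (nat \<Rightarrow> 'a) \<Rightarrow> nat \<Rightarrow> 'a) \<Rightarrow> bool" where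
  "definably_proper_action M k G n X act \<longleftrightarrow>
     definably_proper M (k + n) (n + n) (set_join k n (carrier G) X) (set_join n n X X)
       (\<lambda>z. join n n (rpart k n z) (act (lpart k z) (rpart k n z)))"

end

theory Submission
  imports Defs
begin

text \<open>
  Write \<open>d(a, Gx)\<close> for the Euclidean distance from a point \<open>a\<close> to an orbit, computed in a closed embedding
  of \<open>X\<close>. Since the action is proper, the orbit relation is closed; since it is continuous, orbits vary
  lower semicontinuously. Hence \<open>x \<mapsto> d(a, Gx)\<close> is continuous and invariant, and it is proper modulo \<open>G\<close>.
  For distinct orbits the set of all \<open>a\<close> with \<open>d(a, Gx) = d(a, Gx')\<close> has empty interior, by strict convexity of
  balls. It therefore suffices to find finitely many points \<open>a\<close> such that no such set contains all of
  them: the corresponding distance functions are the components of a quotient map.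

  The finite set exists for every definable family of subsets of \<open>F\<^sup>q\<close> with empty interior, by
  induction on the number of parameters. This needs Kuratowski--Ulam theorems,
  which follow from the Baire property of definable increasing unions. The latter is where d-minimality
  enters: uniformly bounded Cantor--Bendixson ranks reduce it to unions of discrete sets.
\<close>

section \<open>Definable predicates on environments\<close>

text \<open>Their substitutes are definable families that are monotone in a scale: cluster points of
  such families as the scale tends to \<open>0\<close> replace convergent subsequences, and unions
  over all scales \<open>s > 0\<close> replace countable unions in the category argument. A single
  point \<open>a\<close> cannot be expected to separate all pairs of orbits: each bad set has empty
  interior, but the pairs vary, and the bad sets of the whole family may cover the space. What
  survives is that finitely many points can be chosen so that no single bad set contains all of
  them. Square roots need not exist, so distances are squared throughout; their continuity, the
  compactness of sublevel sets and an identity for segments are all that is required.\<close>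

text \<open>
  Environments interpret de Bruijn indices, so that \<open>case_nat y e\<close> is \<open>e\<close> below one more binder. In the
  underlying formula the even variables take the values of the environment and the odd ones are parameters.
\<close>

definition dpred :: "('f, 'r, 'a::linordered_field) expansion \<Rightarrow> ((nat \<Rightarrow> 'a) \<Rightarrow> bool) \<Rightarrow> bool" where
  "dpred M P \<longleftrightarrow>
     (\<exists>\<phi> p. \<forall>e. P e \<longleftrightarrow> sat M (\<lambda>i. if even i then e (i div 2) else p (i div 2)) \<phi>)"

definition dfun :: "('f, 'r, 'a::linordered_field) expansion \<Rightarrow> ((nat \<Rightarrow> 'a) \<Rightarrow> 'a) \<Rightarrow> bool" where
  "dfun M f \<longleftrightarrow> dpred M (\<lambda>e. e 0 = f (\<lambda>i. e (Suc i)))"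

section \<open>Renaming the variables of terms and formulas\<close>

primrec trename :: "(nat \<Rightarrow> nat) \<Rightarrow> 'f trm \<Rightarrow> 'f trm" where
  "trename \<sigma> (TVar i) = TVar (\<sigma> i)"
| "trename \<sigma> (TAdd s t) = TAdd (trename \<sigma> s) (trename \<sigma> t)"
| "trename \<sigma> (TMul s t) = TMul (trename \<sigma> s) (trename \<sigma> t)"
| "trename \<sigma> (TFun f ts) = TFun f (map (trename \<sigma>) ts)"

primrec frename :: "(nat \<Rightarrow> nat) \<Rightarrow> ('f, 'r) fm \<Rightarrow> ('f, 'r) fm" where
  "frename \<sigma> (FEq s t) = FEq (trename \<sigma> s) (trename \<sigma> t)"
| "frename \<sigma> (FLess s t) = FLess (trename \<sigma> s) (trename \<sigma> t)"
| "frename \<sigma> (FRel r ts) = FRel r (map (trename \<sigma>) ts)"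
| "frename \<sigma> (FNeg \<phi>) = FNeg (frename \<sigma> \<phi>)"
| "frename \<sigma> (FConj \<phi> \<psi>) = FConj (frename \<sigma> \<phi>) (frename \<sigma> \<psi>)"
| "frename \<sigma> (FEx i \<phi>) = FEx (\<sigma> i) (frename \<sigma> \<phi>)"

lemma tval_trename: "tval M e (trename \<sigma> t) = tval M (e \<circ> \<sigma>) t"
  by (induction t) (auto cong: map_cong simp: comp_def)

text \<open>Bound variables are renamed along with the free ones, so injectivity is what prevents
  capture: changing the value at \<open>\<sigma> i\<close> must not affect the image of another
  variable.\<close>

lemma sat_frename: "inj \<sigma> \<Longrightarrow> sat M e (frename \<sigma> \<phi>) \<longleftrightarrow> sat M (e \<circ> \<sigma>) \<phi>"
proof (induction \<phi> arbitrary: e)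
  case (FEx i \<phi>)
  then have "e(\<sigma> i := a) \<circ> \<sigma> = (e \<circ> \<sigma>)(i := a)" for a
    by (auto simp: fun_eq_iff inj_eq)
  then show ?case using FEx by (simp del: comp_apply fun_upd_apply)
qed (auto simp: tval_trename comp_def)

lemma dpredI:
  assumes "inj \<sigma>"
    and "\<And>e i. (if even (\<sigma> i) then e (\<sigma> i div 2) else p (\<sigma> i div 2)) = E e i"
    and "\<And>e. P e \<longleftrightarrow> sat M (E e) \<phi>"
  shows "dpred M P"
proof -
  have "P e \<longleftrightarrow> sat M (\<lambda>i. if even i then e (i div 2) else p (i div 2)) (frename \<sigma> \<phi>)" for e
    using assms(2)[of _ e] by (simp add: sat_frename[OF assms(1)] assms(3) comp_def)
  then show ?thesis unfolding dpred_def by blast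
qed

text \<open>The renamings below treat environment variables (even) and parameters (odd) by separate
  maps, so their injectivity reduces to that of the two maps and disjointness of the ranges.\<close>

lemma inj_mix:
  fixes f g :: "nat \<Rightarrow> nat"
  assumes "inj f" "inj g" "\<And>i j. f i \<noteq> g j"
  shows "inj (\<lambda>i. if even i then f (i div 2) else g (i div 2))"
proof (rule injI)
  fix i j :: nat
  assume eq: "(if even i then f (i div 2) else g (i div 2)) = (if even j then f (j div 2) else g (j div 2))"
  then have par: "even i = even j" using assms(3) assms(3)[symmetric] by (auto split: if_splits)
  then have "i div 2 = j div 2" using eq assms(1,2) by (auto split: if_splits dest: injD)
  then show "i = j" using par by (metis bit_eq_rec)
qed

lemma odd_pred_div_2: "odd n \<Longrightarrow> (n - Suc 0) div 2 = n div 2" for n :: nat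
  by presburger

section \<open>Closure under renaming, connectives and quantifiers\<close>

lemma dpred_rename:
  assumes "dpred M P" "inj \<sigma>"
  shows "dpred M (\<lambda>e. P (\<lambda>i. e (\<sigma> i)))"
proof -
  obtain \<phi> p where *: "\<And>e. P e \<longleftrightarrow> sat M (\<lambda>i. if even i then e (i div 2) else p (i div 2)) \<phi>"
    using assms(1) unfolding dpred_def by blast
  let ?s = "\<lambda>i. if even i then 2 * \<sigma> (i div 2) else 2 * (i div 2) + 1"
  have "inj ?s"
    using assms(2) by (intro inj_mix) (auto simp: inj_def, presburger)
  then show ?thesis
    by (rule dpredI[where p = p and E = "\<lambda>e i. if even i then e (\<sigma> (i div 2)) else p (i div 2)" and \<phi> = \<phi>])
      (auto simp: *)
qed

lemma dpred_not: "dpred M P \<Longrightarrow> dpred M (\<lambda>e. \<not> P e)"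
  unfolding dpred_def by (metis sat.simps(4))

lemma dpred_conj:
  assumes "dpred M P" "dpred M Q"
  shows "dpred M (\<lambda>e. P e \<and> Q e)"
proof -
  obtain \<phi> p where 1: "\<And>e. P e \<longleftrightarrow> sat M (\<lambda>i. if even i then e (i div 2) else p (i div 2)) \<phi>"
    using assms(1) unfolding dpred_def by blast
  obtain \<psi> q where 2: "\<And>e. Q e \<longleftrightarrow> sat M (\<lambda>i. if even i then e (i div 2) else q (i div 2)) \<psi>"
    using assms(2) unfolding dpred_def by blast
  \<comment> \<open>The two formulas carry unrelated parameters. These are interleaved, those of
    \<open>\<phi>\<close> at even and those of \<open>\<psi>\<close> at odd positions;
    \<open>s\<close> and \<open>t\<close> leave the environment variables fixed.\<close>
  define r where "r j = (if even j then p (j div 2) else q (j div 2))" for j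
  define s where "s i = (if even i then 2 * (i div 2) else 2 * (2 * (i div 2)) + 1)" for i :: nat
  define t where "t i = (if even i then 2 * (i div 2) else 2 * (2 * (i div 2) + 1) + 1)" for i :: nat
  have inj: "inj s" "inj t"
    unfolding s_def t_def by (intro inj_mix; simp add: inj_def; presburger)+
  let ?mix = "\<lambda>e r i. if even i then e (i div 2) else r (i div 2)"
  have "?mix e r \<circ> s = ?mix e p" "?mix e r \<circ> t = ?mix e q" for e
    by (auto simp: fun_eq_iff s_def t_def r_def odd_pred_div_2)
  then have "P e \<and> Q e \<longleftrightarrow> sat M (?mix e r) (FConj (frename s \<phi>) (frename t \<psi>))" for e
    using 1[of e] 2[of e] by (simp add: sat_frename inj)
  then show ?thesis unfolding dpred_def by blast
qed

lemma dpred_push_ex: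
  assumes "dpred M P"
  shows "dpred M (\<lambda>e. \<exists>y. P (case_nat y e))"
proof -
  obtain \<phi> p where *: "\<And>e. P e \<longleftrightarrow> sat M (\<lambda>i. if even i then e (i div 2) else p (i div 2)) \<phi>"
    using assms(1) unfolding dpred_def by blast
  \<comment> \<open>Index \<open>0\<close> of the environment, which is to be bound, takes over
    parameter slot \<open>0\<close>, that is, variable \<open>1\<close>. The other indices drop by
    one and the parameters move up by one; the \<open>undefined\<close> in \<open>q\<close> fills
    the freed slot and is always overwritten.\<close>
  define s where "s i = (if even i then case_nat 1 (\<lambda>i. 2 * i) (i div 2) else 2 * (i div 2) + 3)" for i :: nat
  define q where "q = case_nat undefined p"
  have inj: "inj s"
    unfolding s_def by (intro inj_mix) (auto simp: inj_def split: nat.splits, presburger+)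
  let ?mix = "\<lambda>e r i. if even i then e (i div 2) else r (i div 2)"
  have "(?mix e q)(1 := y) \<circ> s = ?mix (case_nat y e) p" for e y
  proof
    fix i
    consider "i = 0" | j where "i = 2 * Suc j" | j where "i = 2 * j + 1"
      by (metis evenE oddE not0_implies_Suc mult_0_right)
    then show "((?mix e q)(1 := y) \<circ> s) i = ?mix (case_nat y e) p i"
      by cases (auto simp: s_def q_def)
  qed
  then have "(\<exists>y. P (case_nat y e)) \<longleftrightarrow> sat M (?mix e q) (FEx 1 (frename s \<phi>))" for e
    by (simp add: * sat_frename inj)
  then show ?thesis unfolding dpred_def by blast
qed

lemma case_nat_shift [simp]: "case_nat (e 0) (\<lambda>i. e (Suc i)) = e"
  by (auto simp: fun_eq_iff split: nat.split)

named_theorems dintros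

text \<open>The premise is the body below one more binder: bound value at index \<open>0\<close>,
  old environment shifted. Since \<open>Q\<close> takes both parts separately, the rule matches
  quantifiers in ordinary notation by higher-order unification.\<close>

lemma dpred_ex [dintros]:
  "dpred M (\<lambda>e. Q (\<lambda>i. e (Suc i)) (e 0)) \<Longrightarrow> dpred M (\<lambda>e. \<exists>y. Q e y)"
  by (drule dpred_push_ex) simp

declare dpred_not [dintros] dpred_conj [dintros]

lemma dpred_disj [dintros]: "dpred M P \<Longrightarrow> dpred M Q \<Longrightarrow> dpred M (\<lambda>e. P e \<or> Q e)"
  using dpred_not[OF dpred_conj[OF dpred_not dpred_not], of M P Q] by simp

lemma dpred_imp [dintros]: "dpred M P \<Longrightarrow> dpred M Q \<Longrightarrow> dpred M (\<lambda>e. P e \<longrightarrow> Q e)"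
  unfolding imp_conv_disj by (intro dpred_disj dpred_not)

lemma dpred_all [dintros]:
  "dpred M (\<lambda>e. Q (\<lambda>i. e (Suc i)) (e 0)) \<Longrightarrow> dpred M (\<lambda>e. \<forall>y. Q e y)"
  using dpred_not[OF dpred_ex[OF dpred_not], of M Q] by simp

lemma dpred_var_eq: "dpred M (\<lambda>e. e i = e j)"
  unfolding dpred_def by (rule exI[of _ "FEq (TVar (2 * i)) (TVar (2 * j))"]) simp

lemma dpred_var_less: "dpred M (\<lambda>e. e i < e j)"
  unfolding dpred_def by (rule exI[of _ "FLess (TVar (2 * i)) (TVar (2 * j))"]) simp

lemma dpred_const [dintros]: "dpred M (\<lambda>e. B)"
  using dpred_var_less[of M 0 0] dpred_not[OF dpred_var_less[of M 0 0]] by (cases B) auto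

lemma dfun_shift: "dfun M f \<Longrightarrow> dfun M (\<lambda>e. f (\<lambda>i. e (Suc i)))"
  unfolding dfun_def
  by (drule dpred_rename[of M _ "\<lambda>i. if i = 0 then 0 else Suc i"]) (auto simp: inj_def)

lemma dpred_push:
  assumes "dpred M P" "dfun M f"
  shows "dpred M (\<lambda>e. P (case_nat (f e) e))"
proof -
  have "dpred M (\<lambda>e. \<exists>y. y = f e \<and> P (case_nat y e))"
    using assms by (intro dintros) (auto simp: dfun_def)
  then show ?thesis by simp
qed

section \<open>Dependence on finitely many indices\<close>

definition finite_support :: "((nat \<Rightarrow> 'a) \<Rightarrow> 'b) \<Rightarrow> bool" where
  "finite_support f \<longleftrightarrow> (\<exists>N. \<forall>e e'. (\<forall>i<N. e i = e' i) \<longrightarrow> f e = f e')"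

lemma finite_supportI:
  "(\<And>e e'. \<forall>i<N. e i = e' i \<Longrightarrow> f e = f e') \<Longrightarrow> finite_support f" for N :: nat
  unfolding finite_support_def by blast

lemma finite_support_comp2:
  assumes "finite_support f" "finite_support g"
  shows "finite_support (\<lambda>e. h (f e) (g e))"
proof -
  obtain A B where A: "\<And>e e'. \<forall>i<A. e i = e' i \<Longrightarrow> f e = f e'"
    and B: "\<And>e e'. \<forall>i<B. e i = e' i \<Longrightarrow> g e = g e'"
    using assms unfolding finite_support_def by blast
  show ?thesis
  proof (rule finite_supportI[of "max A B"])
    fix e e' :: "nat \<Rightarrow> 'a" assume "\<forall>i<max A B. e i = e' i"
    then have "f e = f e'" "g e = g e'" by (auto intro!: A B)
    then show "h (f e) (g e) = h (f e') (g e')" by simp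
  qed
qed

lemma finite_support_const: "finite_support (\<lambda>e. c)"
  by (rule finite_supportI[of 0]) simp

lemma finite_support_comp: "finite_support f \<Longrightarrow> finite_support (\<lambda>e. h (f e))"
  by (rule finite_support_comp2[where h = "\<lambda>x _. h x", OF _ finite_support_const])

lemma finite_support_map:
  "(\<And>t. t \<in> set ts \<Longrightarrow> finite_support (\<lambda>e. f e t)) \<Longrightarrow> finite_support (\<lambda>e. map (f e) ts)"
proof (induction ts)
  case (Cons t ts)
  have "finite_support (\<lambda>e. map (f e) ts)" by (rule Cons.IH) (simp add: Cons.prems)
  from finite_support_comp2[OF Cons.prems[of t] this, of "(#)"] show ?case by simp
qed (simp add: finite_support_const)

lemma finite_support_tval: "finite_support (\<lambda>e. tval M e t)"
proof (induction t)
  case (TVar i)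
  show ?case by (rule finite_supportI[of "Suc i"]) simp
next
  case (TAdd s t)
  from finite_support_comp2[OF this, of "(+)"] show ?case by simp
next
  case (TMul s t)
  from finite_support_comp2[OF this, of "(*)"] show ?case by simp
next
  case (TFun f ts)
  then have "finite_support (\<lambda>e. map (tval M e) ts)" by (rule finite_support_map)
  from finite_support_comp[OF this, of "fun_of M f"] show ?case by simp
qed

lemma finite_support_sat: "finite_support (\<lambda>e. sat M e \<phi>)"
  for M :: "('f, 'r, 'a::linordered_field) expansion"
proof (induction \<phi>)
  case (FEx i \<phi>)
  then obtain N where N: "\<And>e e'. \<forall>i<N. e i = e' i \<Longrightarrow> sat M e \<phi> = sat M e' \<phi>"
    unfolding finite_support_def by blast
  show ?case
  proof (rule finite_supportI[of N])
    fix e e' :: "nat \<Rightarrow> 'a" assume *: "\<forall>i<N. e i = e' i"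
    have "sat M (e(i := a)) \<phi> = sat M (e'(i := a)) \<phi>" for a
      by (rule N) (use * in auto)
    then show "sat M e (FEx i \<phi>) = sat M e' (FEx i \<phi>)" by simp
  qed
next
  case (FEq s t)
  from finite_support_comp2[OF finite_support_tval finite_support_tval, of "(=)" M s M t] show ?case by simp
next
  case (FLess s t)
  from finite_support_comp2[OF finite_support_tval finite_support_tval, of "(<)" M s M t] show ?case by simp
next
  case (FRel r ts)
  have "finite_support (\<lambda>e. map (tval M e) ts)" by (rule finite_support_map) (rule finite_support_tval)
  from finite_support_comp[OF this, of "rel_of M r"] show ?case by simp
next
  case (FNeg \<phi>)
  from finite_support_comp[OF this, of Not] show ?case by simp
next
  case (FConj \<phi> \<psi>)
  from finite_support_comp2[OF this, of "(\<and>)"] show ?case by simp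
qed

text \<open>Leads from infinite environments back to finite powers: d-minimality is stated for the
  latter, and a substitution for all indices becomes a finite one.\<close>

lemma dpred_finite_support:
  assumes "dpred M P"
  obtains N where "\<And>e e'. (\<And>i. i < N \<Longrightarrow> e i = e' i) \<Longrightarrow> P e = P e'"
proof -
  obtain \<phi> p where *: "\<And>e. P e \<longleftrightarrow> sat M (\<lambda>i. if even i then e (i div 2) else p (i div 2)) \<phi>"
    using assms(1) unfolding dpred_def by blast
  obtain N where N: "\<And>e e'. \<forall>i<N. e i = e' i \<Longrightarrow> sat M e \<phi> = sat M e' \<phi>"
    using finite_support_sat[of M \<phi>] unfolding finite_support_def by blast
  show ?thesis
    by (rule that[of N], unfold *, rule N) auto
qed

lemma dpred_subst:
  assumes P: "dpred M P" and f: "\<And>i. dfun M (\<lambda>e. f e i)"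
  shows "dpred M (\<lambda>e. P (f e))"
proof -
  \<comment> \<open>Indices are substituted one at a time. The induction hypothesis is used with
    \<open>f\<close> shifted below one binder, so that pushing \<open>f e k\<close> supplies exactly
    the next index.\<close>
  have *: "dpred M (\<lambda>e. P (\<lambda>i. if i < k then f e i else e (i - k)))"
    if "\<And>i. dfun M (\<lambda>e. f e i)" for f k
    using that
  proof (induction k arbitrary: f)
    case 0
    then show ?case using P by simp
  next
    case (Suc k)
    have "dpred M (\<lambda>e. P (\<lambda>i. if i < k then f (\<lambda>i. e (Suc i)) i else e (i - k)))"
      by (rule Suc.IH) (rule dfun_shift[OF Suc.prems])
    from dpred_push[OF this Suc.prems[of k]]
    have "dpred M (\<lambda>e. P (\<lambda>i. if i < k then f e i else case_nat (f e k) e (i - k)))"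
      by (simp cong: if_cong)
    moreover have "(\<lambda>i. if i < k then f e i else case_nat (f e k) e (i - k))
        = (\<lambda>i. if i < Suc k then f e i else e (i - Suc k))" for e
    proof
      fix i
      consider "i < k" | "i = k" | j where "i = k + Suc j"
        by (metis add_Suc_right less_iff_Suc_add nat_neq_iff)
      then show "(if i < k then f e i else case_nat (f e k) e (i - k))
          = (if i < Suc k then f e i else e (i - Suc k))"
        by cases auto
    qed
    ultimately show ?case by simp
  qed
  obtain N where N: "\<And>e e'. (\<And>i. i < N \<Longrightarrow> e i = e' i) \<Longrightarrow> P e = P e'"
    using dpred_finite_support[OF P] by blast
  have "P (\<lambda>i. if i < N then f e i else e (i - N)) = P (f e)" for e
    by (rule N) simp
  then show ?thesis using *[of f N, OF f] by simp
qed

section \<open>Definable functions and the field operations\<close>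

lemma dfun_var [dintros]: "dfun M (\<lambda>e. e i)"
  unfolding dfun_def by (rule dpred_var_eq)

lemma dfun_const [dintros]: "dfun M (\<lambda>e. c)"
proof -
  have "dpred M (\<lambda>e. e 0 = c)"
    unfolding dpred_def by (rule exI[of _ "FEq (TVar 0) (TVar 1)"], rule exI[of _ "\<lambda>_. c"]) simp
  then show ?thesis by (simp add: dfun_def)
qed

lemma dpred_subst1:
  assumes "dpred M (\<lambda>e. P (e 0))" "dfun M f"
  shows "dpred M (\<lambda>e. P (f e))"
  using dpred_subst[OF assms(1), of "\<lambda>e i. f e"] assms(2) by simp

lemma dpred_subst2:
  assumes "dpred M (\<lambda>e. P (e 0) (e (Suc 0)))" "dfun M f" "dfun M g"
  shows "dpred M (\<lambda>e. P (f e) (g e))"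
proof -
  have "dfun M (\<lambda>e. if i = 0 then f e else g e)" for i :: nat
    by (cases "i = 0") (simp_all add: assms(2,3))
  from dpred_subst[OF assms(1), of "\<lambda>e i. if i = 0 then f e else g e", OF this]
  show ?thesis by simp
qed

lemma dpred_eq [dintros]: "dfun M f \<Longrightarrow> dfun M g \<Longrightarrow> dpred M (\<lambda>e. f e = g e)"
  by (rule dpred_subst2[where P = "(=)"]) (rule dpred_var_eq)

lemma dpred_less [dintros]: "dfun M f \<Longrightarrow> dfun M g \<Longrightarrow> dpred M (\<lambda>e. f e < g e)"
  by (rule dpred_subst2[where P = "(<)"]) (rule dpred_var_less)

lemma dpred_le [dintros]: "dfun M f \<Longrightarrow> dfun M g \<Longrightarrow> dpred M (\<lambda>e. f e \<le> g e)"
  using dpred_not[OF dpred_less[of M g f]] by (simp add: not_less)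

lemma dfunI: "dpred M (\<lambda>e. e 0 = f (\<lambda>i. e (Suc i))) \<Longrightarrow> dfun M f"
  by (simp add: dfun_def)

lemma dfun_subst:
  assumes "dfun M h" "\<And>i. dfun M (\<lambda>e. f e i)"
  shows "dfun M (\<lambda>e. h (f e))"
proof (rule dfunI)
  have "dfun M (\<lambda>e. (case_nat (e 0) (f (\<lambda>i. e (Suc i)))) i)" for i
    by (cases i) (auto intro: dintros dfun_shift assms(2))
  from dpred_subst[OF assms(1)[unfolded dfun_def], of "\<lambda>e. case_nat (e 0) (f (\<lambda>i. e (Suc i)))", OF this]
  show "dpred M (\<lambda>e. e 0 = h (f (\<lambda>i. e (Suc i))))" by simp
qed

lemma dfun_subst1:
  assumes "dfun M (\<lambda>e. h (e 0))" "dfun M f"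
  shows "dfun M (\<lambda>e. h (f e))"
  using dfun_subst[OF assms(1), of "\<lambda>e i. f e"] assms(2) by simp

lemma dfun_subst2:
  assumes "dfun M (\<lambda>e. h (e 0) (e (Suc 0)))" "dfun M f" "dfun M g"
  shows "dfun M (\<lambda>e. h (f e) (g e))"
proof -
  have "dfun M (\<lambda>e. if i = 0 then f e else g e)" for i :: nat
    by (cases "i = 0") (simp_all add: assms(2,3))
  from dfun_subst[OF assms(1), of "\<lambda>e i. if i = 0 then f e else g e", OF this]
  show ?thesis by simp
qed

lemma dfun_add [dintros]: "dfun M f \<Longrightarrow> dfun M g \<Longrightarrow> dfun M (\<lambda>e. f e + g e)"
proof (rule dfun_subst2[where h = "(+)"])
  have "dpred M (\<lambda>e. e i = e j + e k)" for i j k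
    unfolding dpred_def by (rule exI[of _ "FEq (TVar (2 * i)) (TAdd (TVar (2 * j)) (TVar (2 * k)))"]) simp
  then show "dfun M (\<lambda>e. e 0 + e (Suc 0))" unfolding dfun_def .
qed

lemma dfun_mult [dintros]: "dfun M f \<Longrightarrow> dfun M g \<Longrightarrow> dfun M (\<lambda>e. f e * g e)"
proof (rule dfun_subst2[where h = "(*)"])
  have "dpred M (\<lambda>e. e i = e j * e k)" for i j k
    unfolding dpred_def by (rule exI[of _ "FEq (TVar (2 * i)) (TMul (TVar (2 * j)) (TVar (2 * k)))"]) simp
  then show "dfun M (\<lambda>e. e 0 * e (Suc 0))" unfolding dfun_def .
qed

lemma dfun_uminus [dintros]: "dfun M f \<Longrightarrow> dfun M (\<lambda>e. - f e)"
  using dfun_mult[OF dfun_const[of M "-1"], of f] by simp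

lemma dfun_diff [dintros]: "dfun M f \<Longrightarrow> dfun M g \<Longrightarrow> dfun M (\<lambda>e. f e - g e)"
  using dfun_add[OF _ dfun_uminus, of M f g] by simp

lemma dfun_power [dintros]: "dfun M f \<Longrightarrow> dfun M (\<lambda>e. f e ^ k)"
  by (induction k) (auto intro: dintros)

lemma dfun_inverse [dintros]: "dfun M f \<Longrightarrow> dfun M (\<lambda>e. inverse (f e))"
  for M :: "('f, 'r, 'a::linordered_field) expansion"
proof (rule dfun_subst1[where h = inverse])
  \<comment> \<open>The first disjunct is the convention \<open>inverse 0 = 0\<close>.\<close>
  have "dpred M (\<lambda>e. (e (Suc 0) = 0 \<and> e 0 = 0) \<or> e 0 * e (Suc 0) = 1)"
    by (intro dintros)
  moreover have "(e (Suc 0) = 0 \<and> e 0 = 0) \<or> e 0 * e (Suc 0) = 1 \<longleftrightarrow> e 0 = inverse (e (Suc 0))"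
    for e :: "nat \<Rightarrow> 'a"
    by (metis inverse_inverse_eq inverse_unique inverse_zero left_inverse mult_zero_right zero_neq_one)
  ultimately show "dfun M (\<lambda>e. inverse (e 0))" by (simp add: dfun_def)
qed

lemma dfun_divide [dintros]: "dfun M f \<Longrightarrow> dfun M g \<Longrightarrow> dfun M (\<lambda>e. f e / g e)"
  by (simp add: divide_inverse dfun_mult dfun_inverse)

lemma dfun_abs [dintros]: "dfun M f \<Longrightarrow> dfun M (\<lambda>e. \<bar>f e\<bar>)"
  for M :: "('f, 'r, 'a::linordered_field) expansion"
proof (rule dfun_subst1[where h = abs])
  have "dpred M (\<lambda>e. (e (Suc 0) < 0 \<and> e 0 = - e (Suc 0)) \<or> (0 \<le> e (Suc 0) \<and> e 0 = e (Suc 0)))"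
    by (intro dintros)
  moreover have "(e (Suc 0) < 0 \<and> e 0 = - e (Suc 0)) \<or> (0 \<le> e (Suc 0) \<and> e 0 = e (Suc 0))
      \<longleftrightarrow> e 0 = \<bar>e (Suc 0)\<bar>" for e :: "nat \<Rightarrow> 'a"
    by auto
  ultimately show "dfun M (\<lambda>e. \<bar>e 0\<bar>)" by (simp add: dfun_def)
qed

lemma dfun_sum [dintros]:
  "finite A \<Longrightarrow> (\<And>i. i \<in> A \<Longrightarrow> dfun M (\<lambda>e. f i e)) \<Longrightarrow> dfun M (\<lambda>e. \<Sum>i\<in>A. f i e)"
  by (induction A rule: finite_induct) (auto intro: dintros)

lemma dpred_ball_finite:
  "finite A \<Longrightarrow> (\<And>i. i \<in> A \<Longrightarrow> dpred M (\<lambda>e. P i e)) \<Longrightarrow> dpred M (\<lambda>e. \<forall>i\<in>A. P i e)"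
  by (induction A rule: finite_induct) (auto intro: dintros)

lemma dpred_all_less [dintros]:
  "(\<And>i. i < n \<Longrightarrow> dpred M (\<lambda>e. P i e)) \<Longrightarrow> dpred M (\<lambda>e. \<forall>i<n. P i e)" for n :: nat
  using dpred_ball_finite[of "{..<n}" M P] by (simp add: Ball_def)

section \<open>Definable sets and definable predicates\<close>

text \<open>Puts a point of the \<open>n\<close>-th power under \<open>n\<close> binders. By
  \<open>app_Suc\<close> the last coordinate is the outermost one, and the inductions on dimension
  split off that one.\<close>

definition app :: "nat \<Rightarrow> (nat \<Rightarrow> 'a) \<Rightarrow> (nat \<Rightarrow> 'a) \<Rightarrow> nat \<Rightarrow> 'a" where
  "app n a e = (\<lambda>i. if i < n then a i else e (i - n))"

lemma app_0 [simp]: "app 0 a e = e"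
  by (simp add: app_def)

lemma app_Suc: "app (Suc n) a e = app n a (case_nat (a n) e)"
proof
  fix i
  consider "i < n" | "i = n" | j where "i = n + Suc j"
    by (metis add_Suc_right less_iff_Suc_add nat_neq_iff)
  then show "app (Suc n) a e i = app n a (case_nat (a n) e) i"
    by cases (auto simp: app_def)
qed

lemma app_less [simp]: "i < n \<Longrightarrow> app n a e i = a i"
  by (simp add: app_def)

lemma app_ge [simp]: "app n a e (n + i) = e i" "app n a e (i + n) = e i"
  by (simp_all add: app_def)

lemma app_cong: "(\<And>i. i < n \<Longrightarrow> a i = b i) \<Longrightarrow> app n a e = app n b e"
  by (auto simp: app_def)

lemma dpred_app_ex: "dpred M P \<Longrightarrow> dpred M (\<lambda>e. \<exists>a. P (app n a e))"
proof (induction n arbitrary: P)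
  case (Suc n)
  have "dpred M (\<lambda>e. \<exists>y a. P (app n a (case_nat y e)))"
    using dpred_push_ex[OF Suc.IH[OF Suc.prems]] by simp
  moreover have "(\<exists>a. P (app (Suc n) a e)) \<longleftrightarrow> (\<exists>y a. P (app n a (case_nat y e)))" for e
  proof
    assume "\<exists>y a. P (app n a (case_nat y e))"
    then obtain y a where "P (app n a (case_nat y e))" by blast
    moreover have "app (Suc n) (a(n := y)) e = app n a (case_nat y e)"
      unfolding app_Suc by (auto intro: app_cong)
    ultimately show "\<exists>a. P (app (Suc n) a e)" by metis
  qed (auto simp: app_Suc)
  ultimately show ?case by simp
qed simp

text \<open>An environment is itself a function on indices. As \<open>Q\<close> reads only the first
  \<open>n\<close> values of \<open>a\<close>, the environment \<open>app n a e\<close> can stand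
  for \<open>a\<close>.\<close>

lemma dpred_ex_fun:
  assumes "dpred M (\<lambda>e. Q (\<lambda>i. e (i + n)) e)"
    and "\<And>a b e. (\<And>i. i < n \<Longrightarrow> a i = b i) \<Longrightarrow> Q e a = Q e b"
  shows "dpred M (\<lambda>e. \<exists>a. Q e a)"
proof -
  have "Q e (app n a e) = Q e a" for e a
    by (rule assms(2)) simp
  then show ?thesis using dpred_app_ex[OF assms(1), of n] by simp
qed

lemma dpred_bex_Fpow [dintros]:
  assumes "dpred M (\<lambda>e. Q (\<lambda>i. e (i + n)) (restrict e {..<n}))"
  shows "dpred M (\<lambda>e. \<exists>x\<in>Fpow n. Q e x)"
proof -
  have "dpred M (\<lambda>e. \<exists>x. Q e (restrict x {..<n}))"
    by (rule dpred_ex_fun[of _ _ n]) (use assms in \<open>auto cong: restrict_cong\<close>)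
  moreover have "(\<exists>x\<in>Fpow n. Q e x) \<longleftrightarrow> (\<exists>x. Q e (restrict x {..<n}))" for e
  proof
    assume "\<exists>x\<in>Fpow n. Q e x"
    then obtain x where "x \<in> Fpow n" "Q e x" by blast
    then have "Q e (restrict x {..<n})" by (metis PiE_restrict)
    then show "\<exists>x. Q e (restrict x {..<n})" by blast
  next
    assume "\<exists>x. Q e (restrict x {..<n})"
    then obtain x where "Q e (restrict x {..<n})" by blast
    moreover have "restrict x {..<n} \<in> Fpow n" by simp
    ultimately show "\<exists>x\<in>Fpow n. Q e x" by blast
  qed
  ultimately show ?thesis by simp
qed

lemma dpred_ball_Fpow [dintros]:
  assumes "dpred M (\<lambda>e. Q (\<lambda>i. e (i + n)) (restrict e {..<n}))"
  shows "dpred M (\<lambda>e. \<forall>x\<in>Fpow n. Q e x)"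
proof -
  have "dpred M (\<lambda>e. \<not> (\<exists>x\<in>Fpow n. \<not> Q e x))"
    by (intro dpred_not dpred_bex_Fpow assms)
  then show ?thesis by simp
qed

lemma definable_subset: "definable M n A \<Longrightarrow> A \<subseteq> Fpow n"
  by (auto simp: definable_def)

lemma definable_iff_dpred:
  "definable M n A \<longleftrightarrow> A \<subseteq> Fpow n \<and> dpred M (\<lambda>e. restrict e {..<n} \<in> A)"
proof
  assume *: "definable M n A"
  obtain \<phi> p where A: "A = {x \<in> Fpow n. sat M (\<lambda>i. if i < n then x i else p i) \<phi>}"
    using * unfolding definable_def by blast
  have "inj (\<lambda>i. if i < n then 2 * i else 2 * i + 1)"
    by (auto simp: inj_def split: if_splits)
  then have "dpred M (\<lambda>e. restrict e {..<n} \<in> A)"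
    by (rule dpredI[where p = p and E = "\<lambda>e i. if i < n then e i else p i" and \<phi> = \<phi>])
      (simp_all add: A cong: if_cong)
  then show "A \<subseteq> Fpow n \<and> dpred M (\<lambda>e. restrict e {..<n} \<in> A)"
    using definable_subset[OF *] by blast
next
  assume *: "A \<subseteq> Fpow n \<and> dpred M (\<lambda>e. restrict e {..<n} \<in> A)"
  then obtain \<phi> p where \<phi>: "\<And>e. restrict e {..<n} \<in> A \<longleftrightarrow>
      sat M (\<lambda>i. if even i then e (i div 2) else p (i div 2)) \<phi>"
    unfolding dpred_def by blast
  \<comment> \<open>Points of \<open>Fpow n\<close> are \<open>undefined\<close> from index
    \<open>n\<close> on, so environment variables beyond \<open>n\<close> become parameters with
    that value, interleaved with the original parameters.\<close>
  define s where "s i = (if even i then (if i div 2 < n then i div 2 else n + 2 * (i div 2))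
    else n + 2 * (i div 2) + 1)" for i
  define q where "q i = (if even (i - n) then undefined else p ((i - n) div 2))" for i
  have inj: "inj s"
    unfolding s_def by (intro inj_mix) (auto simp: inj_def split: if_splits, presburger)
  have "A = {x \<in> Fpow n. sat M (\<lambda>i. if i < n then x i else q i) (frename s \<phi>)}"
  proof -
    have "x \<in> A \<longleftrightarrow> sat M (\<lambda>i. if i < n then x i else q i) (frename s \<phi>)" if x: "x \<in> Fpow n" for x
    proof -
      have "(\<lambda>i. if i < n then x i else q i) \<circ> s
          = (\<lambda>i. if even i then x (i div 2) else p (i div 2))"
        using x by (auto simp: fun_eq_iff s_def q_def PiE_def extensional_def)
      moreover have "restrict x {..<n} = x" using x by (rule PiE_restrict)
      ultimately show ?thesis using \<phi>[of x] by (simp add: sat_frename[OF inj])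
    qed
    then show ?thesis using * by auto
  qed
  then show "definable M n A" unfolding definable_def by blast
qed

lemma dpred_mem:
  assumes "definable M n A" "\<And>i. i < n \<Longrightarrow> dfun M (\<lambda>e. f e i)" "\<And>e. f e \<in> Fpow n"
  shows "dpred M (\<lambda>e. f e \<in> A)"
proof -
  have "dfun M (\<lambda>e. restrict (f e) {..<n} i)" for i
    by (cases "i < n") (auto intro: assms(2) dintros)
  from dpred_subst[OF conjunct2[OF assms(1)[unfolded definable_iff_dpred]], of "\<lambda>e. restrict (f e) {..<n}", OF this]
  have "dpred M (\<lambda>e. restrict (f e) {..<n} \<in> A)" by simp
  moreover have "restrict (f e) {..<n} = f e" for e
    using assms(3) by (rule PiE_restrict)
  ultimately show ?thesis by simp
qed

lemma dpred_bex_definable: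
  assumes "definable M n A" "dpred M (\<lambda>e. restrict e {..<n} \<in> A \<and> Q (\<lambda>i. e (i + n)) (restrict e {..<n}))"
  shows "dpred M (\<lambda>e. \<exists>x\<in>A. Q e x)"
proof -
  have "(\<exists>x\<in>A. Q e x) \<longleftrightarrow> (\<exists>x\<in>Fpow n. x \<in> A \<and> Q e x)" for e
    using definable_subset[OF assms(1)] by blast
  then show ?thesis using dpred_bex_Fpow[of M "\<lambda>e x. x \<in> A \<and> Q e x" n] assms(2) by simp
qed

lemma dpred_ball_definable:
  assumes "definable M n A" "dpred M (\<lambda>e. restrict e {..<n} \<in> A \<longrightarrow> Q (\<lambda>i. e (i + n)) (restrict e {..<n}))"
  shows "dpred M (\<lambda>e. \<forall>x\<in>A. Q e x)"
proof -
  have "(\<forall>x\<in>A. Q e x) \<longleftrightarrow> (\<forall>x\<in>Fpow n. x \<in> A \<longrightarrow> Q e x)" for e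
    using definable_subset[OF assms(1)] by blast
  then show ?thesis using dpred_ball_Fpow[of M "\<lambda>e x. x \<in> A \<longrightarrow> Q e x" n] assms(2) by simp
qed

lemma dpred_all_fun:
  assumes "dpred M (\<lambda>e. Q (\<lambda>i. e (i + n)) e)"
    and "\<And>a b e. (\<And>i. i < n \<Longrightarrow> a i = b i) \<Longrightarrow> Q e a = Q e b"
  shows "dpred M (\<lambda>e. \<forall>a. Q e a)"
proof -
  have "dpred M (\<lambda>e. \<not> (\<exists>a. \<not> Q e a))"
    by (intro dpred_not dpred_ex_fun[of _ _ n] assms(1)) (use assms(2) in blast)
  then show ?thesis by simp
qed

lemma dfun_app [dintros]:
  "(\<And>i. i < n \<Longrightarrow> dfun M (\<lambda>e. a e i)) \<Longrightarrow> (\<And>i. dfun M (\<lambda>e. f e i)) \<Longrightarrow> dfun M (\<lambda>e. app n (a e) (f e) j)"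
  by (cases "j < n") (simp_all add: app_def)

lemma dfun_case_nat [dintros]:
  "dfun M t \<Longrightarrow> (\<And>i. dfun M (\<lambda>e. f e i)) \<Longrightarrow> dfun M (\<lambda>e. case_nat (t e) (f e) j)"
  by (cases j) simp_all

lemma dfun_restrict [dintros]:
  "(\<And>i. i < n \<Longrightarrow> dfun M (\<lambda>e. f e i)) \<Longrightarrow> dfun M (\<lambda>e. restrict (f e) {..<n} j)"
  by (cases "j < n") (auto intro: dintros)

lemma dfun_join:
  "(\<And>i. i < n \<Longrightarrow> dfun M (\<lambda>e. f e i)) \<Longrightarrow> (\<And>i. i < m \<Longrightarrow> dfun M (\<lambda>e. g e i)) \<Longrightarrow>
    dfun M (\<lambda>e. join n m (f e) (g e) j)"
  by (cases "j < n"; cases "j < n + m") (auto simp: join_def intro: dintros)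

lemma join_in_Fpow [simp]: "join n m x y \<in> Fpow (n + m)"
  by (auto simp: join_def)

lemma join_eq_iff:
  assumes "x \<in> Fpow n" "x' \<in> Fpow n" "y \<in> Fpow m" "y' \<in> Fpow m"
  shows "join n m x y = join n m x' y' \<longleftrightarrow> x = x' \<and> y = y'"
  using assms lpart_join rpart_join by metis

lemma dpred_subst_point:
  assumes P: "dpred M P" and cong: "\<And>e e'. (\<And>i. i < n \<Longrightarrow> e i = e' i) \<Longrightarrow> P e = P e'"
    and f: "\<And>i. i < n \<Longrightarrow> dfun M (\<lambda>e. f e i)"
  shows "dpred M (\<lambda>e. P (f e))"
proof -
  have "dfun M (\<lambda>e. if i < n then f e i else 0)" for i
    by (cases "i < n") (simp_all add: f dfun_const)
  from dpred_subst[OF P, of "\<lambda>e i. if i < n then f e i else 0", OF this]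
  have "dpred M (\<lambda>e. P (\<lambda>i. if i < n then f e i else 0))" .
  moreover have "P (\<lambda>i. if i < n then f e i else 0) = P (f e)" for e
    by (rule cong) simp
  ultimately show ?thesis by simp
qed

lemma dfun_subst_point:
  assumes h: "dfun M h" and cong: "\<And>e e'. (\<And>i. i < n \<Longrightarrow> e i = e' i) \<Longrightarrow> h e = h e'"
    and f: "\<And>i. i < n \<Longrightarrow> dfun M (\<lambda>e. f e i)"
  shows "dfun M (\<lambda>e. h (f e))"
proof -
  have "dfun M (\<lambda>e. if i < n then f e i else 0)" for i
    by (cases "i < n") (simp_all add: f dfun_const)
  from dfun_subst[OF h, of "\<lambda>e i. if i < n then f e i else 0", OF this]
  have "dfun M (\<lambda>e. h (\<lambda>i. if i < n then f e i else 0))" .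
  moreover have "h (\<lambda>i. if i < n then f e i else 0) = h (f e)" for e
    by (rule cong) simp
  ultimately show ?thesis by simp
qed

section \<open>Subsets of the line\<close>

text \<open>Nonempty interior in the line. For definable sets the negation is the notion of
  smallness used throughout: by \<open>uniform_discrete\<close> such a set is a finite union of
  discrete sets.\<close>

definition thick :: "('a::linorder \<Rightarrow> bool) \<Rightarrow> bool" where
  "thick P \<longleftrightarrow> (\<exists>a b. a < b \<and> (\<forall>y. a < y \<and> y < b \<longrightarrow> P y))"

text \<open>One Cantor--Bendixson step, taken inside \<open>P\<close> itself: its isolated points
  are removed. The iterates \<open>accum ^^ k\<close> measure the rank.\<close>

definition accum :: "('a::linordered_field \<Rightarrow> bool) \<Rightarrow> 'a \<Rightarrow> bool" where
  "accum P y \<longleftrightarrow> P y \<and> (\<forall>\<epsilon>>0. \<exists>z. P z \<and> z \<noteq> y \<and> \<bar>z - y\<bar> < \<epsilon>)"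

lemma thickI: "a < b \<Longrightarrow> (\<And>y. a < y \<Longrightarrow> y < b \<Longrightarrow> P y) \<Longrightarrow> thick P"
  by (auto simp: thick_def)

lemma thick_mono: "thick P \<Longrightarrow> (\<And>y. P y \<Longrightarrow> Q y) \<Longrightarrow> thick Q"
  unfolding thick_def by blast

lemma thick_nonempty: "thick P \<Longrightarrow> \<exists>y. P y" for P :: "'a::linordered_field \<Rightarrow> bool"
  unfolding thick_def using dense by blast

lemma dpred_thick [dintros]:
  "dpred M (\<lambda>e. P (\<lambda>i. e (Suc i)) (e 0)) \<Longrightarrow> dpred M (\<lambda>e. thick (P e))"
proof -
  assume P: "dpred M (\<lambda>e. P (\<lambda>i. e (Suc i)) (e 0))"
  have "dpred M (\<lambda>e. P (\<lambda>i. e (Suc (Suc (Suc i)))) (e 0))"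
    using dpred_rename[OF P, of "\<lambda>i. if i = 0 then 0 else i + 2"] by (simp add: inj_def)
  then show ?thesis
    unfolding thick_def by (intro dintros)
qed

lemma dpred_accum [dintros]:
  assumes P: "dpred M (\<lambda>e. P (\<lambda>i. e (Suc i)) (e 0))" and f: "dfun M f"
  shows "dpred M (\<lambda>e. accum (P e) (f e))"
proof -
  have 1: "dpred M (\<lambda>e. P (\<lambda>i. e (Suc (Suc i))) (e 0))"
    using dpred_rename[OF P, of "\<lambda>i. if i = 0 then 0 else i + 1"] by (simp add: inj_def)
  have 2: "dpred M (\<lambda>e. P (\<lambda>i. e (Suc (Suc (Suc i)))) (e 0))"
    using dpred_rename[OF P, of "\<lambda>i. if i = 0 then 0 else i + 2"] by (simp add: inj_def)
  have "dpred M (\<lambda>e. \<exists>y. y = f e \<and> accum (P e) y)"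
    unfolding accum_def by (intro dintros dfun_shift[OF f] P 1 2)
  then show ?thesis by simp
qed

lemma accum_imp: "(accum ^^ k) P y \<Longrightarrow> P y"
  by (induction k arbitrary: y) (auto simp: accum_def)

lemma accum_cong_local:
  assumes "accum P y" "\<delta> > 0" "\<And>z. \<bar>z - y\<bar> < \<delta> \<Longrightarrow> P z \<Longrightarrow> Q z"
  shows "accum Q y"
  unfolding accum_def
proof (intro conjI allI impI)
  show "Q y" using assms(1,2) assms(3)[of y] by (simp add: accum_def)
  fix \<epsilon> :: 'a assume "0 < \<epsilon>"
  then have "0 < min \<delta> \<epsilon>" using assms(2) by simp
  then obtain z where "P z" "z \<noteq> y" "\<bar>z - y\<bar> < min \<delta> \<epsilon>"
    using assms(1) unfolding accum_def by blast
  then show "\<exists>z. Q z \<and> z \<noteq> y \<and> \<bar>z - y\<bar> < \<epsilon>"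
    using assms(3)[of z] by auto
qed

text \<open>Being a limit point concerns only small neighbourhoods, so iterated derived sets may be
  computed inside an open \<open>U\<close>; the first assumption expresses this openness.\<close>

lemma accum_local:
  assumes "\<And>y. y \<in> U \<Longrightarrow> \<exists>\<delta>>0. \<forall>z. \<bar>z - y\<bar> < \<delta> \<longrightarrow> z \<in> U"
    and "\<And>y. y \<in> U \<Longrightarrow> P y = Q y" and "y \<in> U"
  shows "(accum ^^ k) P y = (accum ^^ k) Q y"
  using assms(3)
proof (induction k arbitrary: y)
  case 0
  then show ?case using assms(2) by simp
next
  case (Suc k)
  obtain \<delta> where \<delta>: "\<delta> > 0" "\<And>z. \<bar>z - y\<bar> < \<delta> \<Longrightarrow> z \<in> U"
    using assms(1)[OF Suc.prems] by blast
  have eq: "(accum ^^ k) P z = (accum ^^ k) Q z" if "\<bar>z - y\<bar> < \<delta>" for z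
    using Suc.IH[OF \<delta>(2)[OF that]] .
  have "accum ((accum ^^ k) P) y = accum ((accum ^^ k) Q) y"
  proof
    show "accum ((accum ^^ k) Q) y" if "accum ((accum ^^ k) P) y"
      by (rule accum_cong_local[OF that \<delta>(1)]) (use eq in blast)
    show "accum ((accum ^^ k) P) y" if "accum ((accum ^^ k) Q) y"
      by (rule accum_cong_local[OF that \<delta>(1)]) (use eq in blast)
  qed
  then show ?case by simp
qed

lemma open_abs_ball:
  fixes x :: "'a::{linordered_field, linorder_topology}"
  assumes "open U" "x \<in> U"
  shows "\<exists>\<delta>>0. \<forall>y. \<bar>y - x\<bar> < \<delta> \<longrightarrow> y \<in> U"
proof -
  obtain b where b: "x < b" "{x..<b} \<subseteq> U"
    using open_right[OF assms, of "x + 1"] by auto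
  obtain a where a: "a < x" "{a<..x} \<subseteq> U"
    using open_left[OF assms, of "x - 1"] by auto
  have "y \<in> U" if "\<bar>y - x\<bar> < min (b - x) (x - a)" for y
  proof (cases "x \<le> y")
    case True
    then show ?thesis using that b(2) by (auto simp: subset_eq abs_less_iff)
  next
    case False
    then show ?thesis using that a(2) by (auto simp: subset_eq abs_less_iff)
  qed
  then show ?thesis using a b by (intro exI[of _ "min (b - x) (x - a)"]) auto
qed

lemma discrete_abs_ball:
  fixes x :: "'a::{linordered_field, linorder_topology}"
  assumes "discrete D" "x \<in> D"
  obtains \<delta> where "\<delta> > 0" "\<And>y. y \<in> D \<Longrightarrow> \<bar>y - x\<bar> < \<delta> \<Longrightarrow> y = x"
proof -
  obtain T where T: "open T" "T \<inter> D = {x}"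
    using assms unfolding discrete_def isolated_in_def by auto
  then obtain \<delta> where "\<delta> > 0" "\<forall>y. \<bar>y - x\<bar> < \<delta> \<longrightarrow> y \<in> T"
    using open_abs_ball[of T x] by auto
  then show ?thesis using T that by blast
qed

text \<open>A point \<open>x\<close> of \<open>P\<close> lies in some \<open>D\<close>, which has no
  other point close to \<open>x\<close>. If \<open>x\<close> survived \<open>k + 1\<close> steps,
  survivors of \<open>k\<close> steps would exist in a punctured neighbourhood of \<open>x\<close>,
  where the remaining \<open>k\<close> sets already cover \<open>P\<close>.\<close>

lemma accum_finite_discrete:
  fixes P :: "'a::{linordered_field, linorder_topology} \<Rightarrow> bool"
  assumes "finite \<D>" "card \<D> \<le> k" "\<And>D. D \<in> \<D> \<Longrightarrow> discrete D" "\<And>y. P y \<Longrightarrow> y \<in> \<Union>\<D>"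
  shows "\<not> (accum ^^ k) P x"
  using assms
proof (induction k arbitrary: \<D> P x)
  case 0
  then have "\<D> = {}" by simp
  then show ?case using "0.prems"(4)[of x] by auto
next
  case (Suc k)
  show ?case
  proof
    assume *: "(accum ^^ Suc k) P x"
    then have "P x" by (rule accum_imp)
    then obtain D where D: "D \<in> \<D>" "x \<in> D" using Suc.prems(4) by blast
    obtain \<delta> where \<delta>: "\<delta> > 0" "\<And>y. y \<in> D \<Longrightarrow> \<bar>y - x\<bar> < \<delta> \<Longrightarrow> y = x"
      using discrete_abs_ball[OF Suc.prems(3)[OF D(1)] D(2)] by blast
    let ?O = "{y. y \<noteq> x \<and> \<bar>y - x\<bar> < \<delta>}"
    let ?Q = "\<lambda>y. P y \<and> y \<in> ?O"
    obtain z where z: "(accum ^^ k) P z" "z \<noteq> x" "\<bar>z - x\<bar> < \<delta>"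
      using * \<delta>(1) by (auto simp: accum_def)
    have "(accum ^^ k) P z = (accum ^^ k) ?Q z"
    proof (rule accum_local[where U = ?O])
      fix y assume y: "y \<in> ?O"
      have "w \<in> ?O" if "\<bar>w - y\<bar> < min \<bar>y - x\<bar> (\<delta> - \<bar>y - x\<bar>)" for w
        using that y by (auto simp: abs_if split: if_splits)
      moreover have "0 < min \<bar>y - x\<bar> (\<delta> - \<bar>y - x\<bar>)" using y by simp
      ultimately show "\<exists>\<delta>>0. \<forall>w. \<bar>w - y\<bar> < \<delta> \<longrightarrow> w \<in> ?O" by blast
    qed (use z in auto)
    moreover have "\<not> (accum ^^ k) ?Q z"
    proof (rule Suc.IH[of "\<D> - {D}"])
      show "finite (\<D> - {D})" "card (\<D> - {D}) \<le> k" using Suc.prems(1,2) D by auto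
      show "\<And>D'. D' \<in> \<D> - {D} \<Longrightarrow> discrete D'" using Suc.prems(3) by blast
      fix y assume "?Q y"
      then show "y \<in> \<Union>(\<D> - {D})" using \<delta>(2)[of y] Suc.prems(4)[of y] by blast
    qed
    ultimately show False using z by simp
  qed
qed

text \<open>If the interval meets \<open>D\<close>, then just to the right of such a point there is
  a subinterval free of \<open>D\<close>, by isolation.\<close>

lemma thick_minus_discrete:
  fixes D :: "'a::{linordered_field, linorder_topology} set"
  assumes "discrete D" "thick T"
  shows "thick (\<lambda>t. T t \<and> t \<notin> D)"
proof -
  obtain a b where ab: "a < b" "\<And>y. a < y \<Longrightarrow> y < b \<Longrightarrow> T y"
    using assms(2) unfolding thick_def by blast
  show ?thesis
  proof (cases "\<exists>x\<in>D. a < x \<and> x < b")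
    case True
    then obtain x where x: "x \<in> D" "a < x" "x < b" by blast
    obtain \<delta> where \<delta>: "\<delta> > 0" "\<And>y. y \<in> D \<Longrightarrow> \<bar>y - x\<bar> < \<delta> \<Longrightarrow> y = x"
      using discrete_abs_ball[OF assms(1) x(1)] by blast
    show ?thesis
    proof (rule thickI)
      show "x < min b (x + \<delta>)" using x \<delta> by simp
      fix y assume y: "x < y" "y < min b (x + \<delta>)"
      then have "y \<notin> D" using \<delta>(2)[of y] by (auto simp: abs_if)
      then show "T y \<and> y \<notin> D" using y x ab(2) by auto
    qed
  next
    case False
    then show ?thesis using ab by (intro thickI[of a b]) auto
  qed
qed

section \<open>Definable completeness and uniform Cantor--Bendixson rank\<close>

locale d_minimal_expansion =
  fixes M :: "('f, 'r, 'a::{linordered_field, linorder_topology}) expansion"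
  assumes d_minimal: "d_minimal M"
begin

lemma definable_sup:
  assumes "dpred M (\<lambda>e. P (e 0))" "P y" "\<And>y. P y \<Longrightarrow> y \<le> B"
  shows "\<exists>s. (\<forall>y. P y \<longrightarrow> y \<le> s) \<and> (\<forall>b. (\<forall>y. P y \<longrightarrow> y \<le> b) \<longrightarrow> s \<le> b)"
proof -
  let ?A = "{x \<in> Fpow 1. P (x 0)}"
  have "definable M 1 ?A"
    using assms(1) by (auto simp: definable_iff_dpred)
  then have "\<exists>s. isLub UNIV (Fin ` {y. (\<lambda>i\<in>{..<1}. y) \<in> ?A}) s"
    using d_minimal unfolding d_minimal_def definably_complete_def by blast
  moreover have "{y. (\<lambda>i\<in>{..<1}. y) \<in> ?A} = {y. P y}" by auto
  ultimately obtain s where s: "isLub UNIV (Fin ` {y. P y}) s" by auto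
  have ub: "Fin y \<le> s" if "P y" for y
    using s that unfolding isLub_def leastP_def isUb_def setle_def by auto
  have le: "s \<le> Fin b" if "\<And>y. P y \<Longrightarrow> y \<le> b" for b
    using s that unfolding isLub_def leastP_def isUb_def setle_def setge_def by auto
  obtain t where "s = Fin t"
    using ub[OF assms(2)] le[OF assms(3)] by (cases s) auto
  then show ?thesis using ub le by auto
qed

lemma definable_inf:
  assumes "dpred M (\<lambda>e. P (e 0))" "P y" "\<And>y. P y \<Longrightarrow> B \<le> y"
  shows "\<exists>s. (\<forall>y. P y \<longrightarrow> s \<le> y) \<and> (\<forall>b. (\<forall>y. P y \<longrightarrow> b \<le> y) \<longrightarrow> b \<le> s)"
proof -
  have 1: "dpred M (\<lambda>e. P (- e 0))"
    by (rule dpred_subst1[where P = P and f = "\<lambda>e. - e 0", OF assms(1)]) (intro dintros)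
  have 2: "P (- (- y))" using assms(2) by simp
  have 3: "z \<le> - B" if "P (- z)" for z using assms(3)[OF that] by simp
  obtain s where s: "\<forall>y. P (- y) \<longrightarrow> y \<le> s" "\<forall>b. (\<forall>y. P (- y) \<longrightarrow> y \<le> b) \<longrightarrow> s \<le> b"
    using definable_sup[where P = "\<lambda>z. P (- z)" and y = "- y" and B = "- B", OF 1 2 3] by auto
  show ?thesis
  proof (intro exI[of _ "- s"] conjI allI impI)
    show "- s \<le> y" if "P y" for y
      using s(1)[rule_format, of "- y"] that by simp
    show "b \<le> - s" if b: "\<forall>y. P y \<longrightarrow> b \<le> y" for b
    proof -
      have "\<forall>y. P (- y) \<longrightarrow> y \<le> - b"
      proof (intro allI impI)
        fix y assume "P (- y)"
        with b have "b \<le> - y" by blast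
        then show "y \<le> - b" by simp
      qed
      then have "s \<le> - b" using s(2) by blast
      then show ?thesis by simp
    qed
  qed
qed

lemma uniform_discrete:
  assumes "dpred M P"
  shows "\<exists>k. \<forall>e. \<not> thick (\<lambda>y. P (case_nat y e)) \<longrightarrow>
    (\<exists>\<D>. finite \<D> \<and> card \<D> \<le> k \<and> (\<forall>D\<in>\<D>. discrete D) \<and> {y. P (case_nat y e)} = \<Union>\<D>)"
proof -
  obtain N where N: "\<And>e e'. (\<And>i. i < N \<Longrightarrow> e i = e' i) \<Longrightarrow> P e = P e'"
    using dpred_finite_support[OF assms] by blast
  \<comment> \<open>d-minimality takes the fibre in the last coordinate, whereas the varying value
    has de Bruijn index \<open>0\<close>. It is therefore stored at coordinate \<open>N\<close> and
    pushed in front again.\<close>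
  let ?A = "{z \<in> Fpow (N + 1). P (case_nat (z N) z)}"
  have "definable M (N + 1) ?A"
    unfolding definable_iff_dpred
  proof
    have "dfun M (\<lambda>e. case_nat (e N) e i)" for i by (intro dintros)
    from dpred_subst[OF assms, of "\<lambda>e. case_nat (e N) e", OF this]
    have "dpred M (\<lambda>e. P (case_nat (e N) e))" .
    moreover have "P (case_nat (e N) (restrict e {..<N + 1})) = P (case_nat (e N) e)" for e
      by (rule N) (auto split: nat.split)
    ultimately show "dpred M (\<lambda>e. restrict e {..<N + 1} \<in> ?A)" by simp
  qed auto
  from d_minimal[unfolded d_minimal_def, THEN conjunct2, rule_format, OF this]
  obtain k where k: "\<forall>x\<in>Fpow N. \<exists>U \<D>. open U \<and> finite \<D> \<and> card \<D> \<le> k \<and> (\<forall>D\<in>\<D>. discrete D) \<and>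
      {y. x(N := y) \<in> ?A} = U \<union> \<Union>\<D>"
    by (rule exE)
  show ?thesis
  proof (intro exI[of _ k] allI impI)
    fix e assume nt: "\<not> thick (\<lambda>y. P (case_nat y e))"
    let ?x = "restrict e {..<N}"
    have "?x(N := y) \<in> ?A \<longleftrightarrow> P (case_nat y e)" for y
    proof -
      have "?x(N := y) \<in> Fpow (N + 1)" by (auto simp: PiE_def extensional_def)
      moreover have "P (case_nat y (?x(N := y))) = P (case_nat y e)"
        by (rule N) (auto split: nat.split)
      ultimately show ?thesis by simp
    qed
    then have eq: "{y. ?x(N := y) \<in> ?A} = {y. P (case_nat y e)}" by blast
    have "?x \<in> Fpow N" by simp
    from bspec[OF k this, unfolded eq]
    obtain U \<D> where U: "open U" "finite \<D>" "card \<D> \<le> k" "\<forall>D\<in>\<D>. discrete D"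
      "{y. P (case_nat y e)} = U \<union> \<Union>\<D>"
      by (elim exE conjE)
    have "U = {}"
    proof (rule ccontr)
      assume "U \<noteq> {}"
      then obtain x where "x \<in> U" by blast
      then obtain \<delta> where \<delta>: "\<delta> > 0" "\<And>y. \<bar>y - x\<bar> < \<delta> \<Longrightarrow> y \<in> U"
        using open_abs_ball[OF U(1)] by blast
      have "thick (\<lambda>y. P (case_nat y e))"
      proof (rule thickI)
        show "x - \<delta> < x + \<delta>" using \<delta> by simp
        show "P (case_nat y e)" if "x - \<delta> < y" "y < x + \<delta>" for y
          using that \<delta>(2)[of y] U(5) by (auto simp: abs_less_iff)
      qed
      then show False using nt by blast
    qed
    then show "\<exists>\<D>. finite \<D> \<and> card \<D> \<le> k \<and> (\<forall>D\<in>\<D>. discrete D) \<and> {y. P (case_nat y e)} = \<Union>\<D>"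
      using U by auto
  qed
qed

text \<open>The number of discrete sets bounds the rank. Independence of \<open>e\<close> is what
  permits induction on the rank for a whole family at once.\<close>

lemma uniform_accum:
  assumes "dpred M P"
  shows "\<exists>k. \<forall>e. \<not> thick (\<lambda>y. P (case_nat y e)) \<longrightarrow> (\<forall>x. \<not> (accum ^^ k) (\<lambda>y. P (case_nat y e)) x)"
proof -
  obtain k where k: "\<forall>e. \<not> thick (\<lambda>y. P (case_nat y e)) \<longrightarrow>
    (\<exists>\<D>. finite \<D> \<and> card \<D> \<le> k \<and> (\<forall>D\<in>\<D>. discrete D) \<and> {y. P (case_nat y e)} = \<Union>\<D>)"
    using uniform_discrete[OF assms] by (rule exE)
  show ?thesis
  proof (intro exI[of _ k] allI impI)
    fix e x assume "\<not> thick (\<lambda>y. P (case_nat y e))"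
    from k[rule_format, OF this] obtain \<D> where \<D>: "finite \<D>" "card \<D> \<le> k" "\<forall>D\<in>\<D>. discrete D"
      "{y. P (case_nat y e)} = \<Union>\<D>"
      by (elim exE conjE)
    show "\<not> (accum ^^ k) (\<lambda>y. P (case_nat y e)) x"
    proof (rule accum_finite_discrete[OF \<D>(1,2)])
      show "discrete D" if "D \<in> \<D>" for D using \<D>(3) that by (rule bspec)
      show "y \<in> \<Union>\<D>" if "P (case_nat y e)" for y unfolding \<D>(4)[symmetric] using that by (rule CollectI)
    qed
  qed
qed

text \<open>The complement of an interval in a thin set need not be treated in one go: discrete sets
  are removed one after another, each time keeping a smaller interval.\<close>

lemma thick_minus:
  assumes "dpred M (\<lambda>e. P (e 0))" "\<not> thick P" "thick T"
  shows "thick (\<lambda>t. T t \<and> \<not> P t)"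
proof -
  have *: "thick (\<lambda>t. T t \<and> t \<notin> \<Union>\<D>)" if "finite \<D>" "\<forall>D\<in>\<D>. discrete D" for \<D>
    using that
  proof (induction \<D> rule: finite_induct)
    case empty
    then show ?case using assms(3) by simp
  next
    case (insert D \<D>)
    then have "thick (\<lambda>t. (T t \<and> t \<notin> \<Union>\<D>) \<and> t \<notin> D)"
      by (intro thick_minus_discrete[of D "\<lambda>t. T t \<and> t \<notin> \<Union>\<D>"]) auto
    then show ?case by (rule thick_mono) auto
  qed
  from uniform_discrete[OF assms(1)]
  obtain k where k: "\<forall>e. \<not> thick (\<lambda>y. P (case_nat y e 0)) \<longrightarrow>
    (\<exists>\<D>. finite \<D> \<and> card \<D> \<le> k \<and> (\<forall>D\<in>\<D>. discrete D) \<and> {y. P (case_nat y e 0)} = \<Union>\<D>)"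
    by (rule exE)
  have "\<not> thick (\<lambda>y. P (case_nat y (\<lambda>_. 0) 0))" using assms(2) by simp
  from k[rule_format, OF this] obtain \<D> where \<D>: "finite \<D>" "\<forall>D\<in>\<D>. discrete D" "{y. P y} = \<Union>\<D>"
    by auto
  from *[OF \<D>(1,2)] show ?thesis
    unfolding \<D>(3)[symmetric] by simp
qed

lemma thick_disj:
  assumes "dpred M (\<lambda>e. P (e 0))" "thick (\<lambda>t. P t \<or> Q t)"
  shows "thick P \<or> thick Q"
  using thick_minus[OF assms(1) _ assms(2)] by (blast intro: thick_mono)

section \<open>Definable compactness\<close>

text \<open>The limit inferior as \<open>d\<close> tends to \<open>0\<close> works: \<open>c\<close>
  is the supremum of the eventual lower bounds of \<open>W\<close>. This stands in for choosing a
  convergent subsequence.\<close>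

lemma cluster_point_line:
  assumes W: "dpred M (\<lambda>e. W (e 0) (e (Suc 0)))"
    and ne: "\<And>d. 0 < d \<Longrightarrow> \<exists>y. W d y"
    and mono: "\<And>d d' y. 0 < d \<Longrightarrow> d \<le> d' \<Longrightarrow> W d y \<Longrightarrow> W d' y"
    and bounded: "\<And>d y. 0 < d \<Longrightarrow> W d y \<Longrightarrow> a \<le> y \<and> y \<le> b"
  shows "\<exists>c. \<forall>d>0. \<exists>y. W d y \<and> \<bar>y - c\<bar> < d"
proof -
  let ?S = "\<lambda>z. \<exists>d>0. \<forall>y. W d y \<longrightarrow> z \<le> y"
  have "dpred M (\<lambda>e. ?S (e 0))"
    by (intro dintros dpred_subst2[OF W])
  moreover have "?S a" using bounded zero_less_one by blast
  moreover have "z \<le> b" if z: "?S z" for z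
  proof -
    obtain d where "d > 0" "\<forall>y. W d y \<longrightarrow> z \<le> y" using z by blast
    then show ?thesis using ne[of d] bounded[of d] order_trans[of z _ b] by blast
  qed
  ultimately have "\<exists>c. (\<forall>z. ?S z \<longrightarrow> z \<le> c) \<and> (\<forall>b. (\<forall>z. ?S z \<longrightarrow> z \<le> b) \<longrightarrow> c \<le> b)"
    by (rule definable_sup[where P = ?S])
  then obtain c where c: "\<forall>z. ?S z \<longrightarrow> z \<le> c" "\<forall>b. (\<forall>z. ?S z \<longrightarrow> z \<le> b) \<longrightarrow> c \<le> b"
    by blast
  have "\<exists>y. W d y \<and> \<bar>y - c\<bar> < d" if d: "0 < d" for d
  proof -
    have "\<not> c \<le> c - d / 2" using d by simp
    then obtain z where z: "?S z" "c - d / 2 < z"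
      using c(2)[rule_format, of "c - d / 2"] not_le by blast
    then obtain d0 where d0: "0 < d0" "\<And>y. W d0 y \<Longrightarrow> z \<le> y" by blast
    \<comment> \<open>Two bounds must hold at once: values at scales up to \<open>d0\<close> are at
      least \<open>z\<close>, and as \<open>c + d / 2\<close> is no eventual lower bound, some value
      at scale \<open>min d d0\<close> lies below it.\<close>
    have "\<not> c + d / 2 \<le> c" using d by simp
    then have "\<not> ?S (c + d / 2)" using c(1) by blast
    moreover have "0 < min d d0" using d d0(1) by simp
    ultimately obtain y where y: "W (min d d0) y" "y < c + d / 2"
      using not_le by blast
    then have "W d y" "W d0 y" using mono[of "min d d0"] d d0(1) by auto
    moreover have "c - d / 2 < y" using z(2) d0(2)[OF \<open>W d0 y\<close>] by simp
    ultimately show ?thesis using y(2) by (intro exI[of _ y]) (auto simp: abs_less_iff)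
  qed
  then show ?thesis by blast
qed

text \<open>The limit is built coordinate by coordinate. The family for coordinate \<open>j\<close>
  keeps only points already within \<open>d\<close> of the earlier limits; it stays nonempty and
  monotone, so the one-dimensional case applies again.\<close>

lemma cluster_point:
  assumes L: "dpred M (\<lambda>e. restrict (\<lambda>i. e (Suc i)) {..<n} \<in> L (e 0))"
    and sub: "\<And>d. L d \<subseteq> Fpow n"
    and ne: "\<And>d. 0 < d \<Longrightarrow> L d \<noteq> {}"
    and mono: "\<And>d d'. 0 < d \<Longrightarrow> d \<le> d' \<Longrightarrow> L d \<subseteq> L d'"
    and bounded: "\<And>d x i. 0 < d \<Longrightarrow> x \<in> L d \<Longrightarrow> i < n \<Longrightarrow> a \<le> x i \<and> x i \<le> b"
  obtains c where "c \<in> Fpow n" "\<And>d. 0 < d \<Longrightarrow> \<exists>x\<in>L d. \<forall>i<n. \<bar>x i - c i\<bar> < d"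
proof -
  have "\<exists>c. \<forall>d>0. \<exists>x\<in>L d. \<forall>i<j. \<bar>x i - c i\<bar> < d" if "j \<le> n" for j
    using that
  proof (induction j)
    case 0
    then show ?case using ne by blast
  next
    case (Suc j)
    then obtain c where c: "\<And>d. d > 0 \<Longrightarrow> \<exists>x\<in>L d. \<forall>i<j. \<bar>x i - c i\<bar> < d" by auto
    let ?W = "\<lambda>d y. \<exists>x\<in>Fpow n. x \<in> L d \<and> (\<forall>i<j. \<bar>x i - c i\<bar> < d) \<and> x j = y"
    have "\<exists>c'. \<forall>d>0. \<exists>y. ?W d y \<and> \<bar>y - c'\<bar> < d"
    proof (rule cluster_point_line)
      have "dpred M (\<lambda>e. restrict e {..<n} \<in> L (e n))"
      proof -
        have "dfun M (\<lambda>e. case_nat (e n) e i)" for i by (intro dintros)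
        from dpred_subst[OF L, of "\<lambda>e. case_nat (e n) e", OF this]
        show ?thesis by simp
      qed
      then show "dpred M (\<lambda>e. ?W (e 0) (e (Suc 0)))"
        using Suc.prems by (intro dintros) (auto intro!: dintros)
      show "\<exists>y. ?W d y" if "0 < d" for d
        using c[OF that] sub by blast
      show "?W d' y" if "0 < d" "d \<le> d'" "?W d y" for d d' y
        using that mono[OF that(1,2)] by (meson less_le_trans subsetD)
      show "a \<le> y \<and> y \<le> b" if d: "0 < d" and W: "?W d y" for d y
      proof -
        obtain x where "x \<in> L d" "x j = y" using W by blast
        then show ?thesis using bounded[OF d, of x j] Suc.prems by auto
      qed
    qed
    then obtain c' where c': "\<And>d. d > 0 \<Longrightarrow> \<exists>y. ?W d y \<and> \<bar>y - c'\<bar> < d" by blast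
    show ?case
    proof (intro exI[of _ "c(j := c')"] allI impI)
      fix d :: 'a assume "0 < d"
      then obtain x where "x \<in> L d" "\<forall>i<j. \<bar>x i - c i\<bar> < d" "\<bar>x j - c'\<bar> < d"
        using c' by blast
      then show "\<exists>x\<in>L d. \<forall>i<Suc j. \<bar>x i - (c(j := c')) i\<bar> < d"
        by (intro bexI[of _ x]) (auto simp: less_Suc_eq)
    qed
  qed
  then obtain c where c: "\<And>d. d > 0 \<Longrightarrow> \<exists>x\<in>L d. \<forall>i<n. \<bar>x i - c i\<bar> < d" by blast
  show ?thesis
    by (rule that[of "restrict c {..<n}"]) (use c in auto)
qed

section \<open>A Baire category theorem\<close>

text \<open>
  Uncountability of intervals: if each point \<open>y\<close> has a scale \<open>r\<close> and points are separated by the smaller of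
  their scales, then a point at distance at least \<open>r\<^sup>2\<close> from all such \<open>y\<close> exists, which is absurd. An interval of
  length \<open>\<epsilon> / 8\<close> avoiding all scales \<open>\<ge> \<epsilon>\<close> contains one of length \<open>\<epsilon> / 32\<close> avoiding all scales \<open>\<ge> \<epsilon> / 4\<close>. Since
  the field need not be archimedean, this step is not iterated: the infimum of the good \<open>\<epsilon>\<close> must be \<open>0\<close>.
\<close>

lemma no_separated_scale:
  assumes R: "dpred M (\<lambda>e. R (e 0) (e (Suc 0)))"
    and "a < b"
    and ex: "\<And>x. a \<le> x \<Longrightarrow> x \<le> b \<Longrightarrow> \<exists>r>0. R x r"
    and down: "\<And>x r s. R x r \<Longrightarrow> 0 < s \<Longrightarrow> s \<le> r \<Longrightarrow> R x s"
    and sep: "\<And>x y r s. R x r \<Longrightarrow> R y s \<Longrightarrow> x \<noteq> y \<Longrightarrow> min r s \<le> \<bar>x - y\<bar>"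
  shows False
proof -
  \<comment> \<open>For \<open>r < \<epsilon>\<close> a scale below \<open>1 / 64\<close> has
    \<open>r * r\<close> at most \<open>\<epsilon> / 64\<close>; the bound by \<open>b - a\<close>
    leaves room for the starting interval at \<open>a\<close>.\<close>
  define \<kappa> where "\<kappa> = min (b - a) (1 / 64)"
  have "0 < \<kappa>" using \<open>a < b\<close> by (simp add: \<kappa>_def)
  moreover have "\<kappa> \<le> 1 / 64" unfolding \<kappa>_def by (rule min.cobounded2)
  moreover have "\<kappa> \<le> b - a" unfolding \<kappa>_def by (rule min.cobounded1)
  ultimately have \<kappa>: "0 < \<kappa>" "\<kappa> \<le> 1 / 64" "\<kappa> \<le> b - a" by blast+
  define C where "C \<epsilon> x \<longleftrightarrow> a \<le> x \<and> x \<le> b \<and> (\<forall>y r. R y r \<and> \<epsilon> \<le> r \<and> r < \<kappa> \<longrightarrow> r * r \<le> \<bar>x - y\<bar>)" for \<epsilon> x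
  define I where "I \<epsilon> \<longleftrightarrow> 0 < \<epsilon> \<and> \<epsilon> \<le> \<kappa> \<and> (\<exists>p. \<forall>x. p \<le> x \<and> x \<le> p + \<epsilon> / 8 \<longrightarrow> C \<epsilon> x)" for \<epsilon>
  have dC: "dpred M (\<lambda>e. C (e 0) (e (Suc 0)))"
    unfolding C_def by (intro dintros dpred_subst2[where P = R, OF R])
  have dI: "dpred M (\<lambda>e. I (e 0))"
    unfolding I_def by (intro dintros dpred_subst2[where P = C, OF dC])
  \<comment> \<open>At \<open>\<epsilon> = \<kappa>\<close> no scale satisfies both
    \<open>\<epsilon> \<le> r\<close> and \<open>r < \<kappa>\<close>, so only
    \<open>a \<le> x\<close> and \<open>x \<le> b\<close> have to be checked.\<close>
  have "I \<kappa>"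
    unfolding I_def
  proof (intro conjI exI[of _ a] allI impI)
    fix x assume "a \<le> x \<and> x \<le> a + \<kappa> / 8"
    then show "C \<kappa> x" using \<kappa> by (auto simp: C_def)
  qed (use \<kappa> in auto)
  have step: "I (\<epsilon> / 4)" if "I \<epsilon>" for \<epsilon>
  proof -
    obtain p where \<epsilon>: "0 < \<epsilon>" "\<epsilon> \<le> \<kappa>" and p: "\<And>x. p \<le> x \<Longrightarrow> x \<le> p + \<epsilon> / 8 \<Longrightarrow> C \<epsilon> x"
      using \<open>I \<epsilon>\<close> unfolding I_def by blast
    have bad: "\<exists>y r. R y r \<and> \<epsilon> / 4 \<le> r \<and> \<bar>x - y\<bar> < \<epsilon> / 64"
      if Cx: "C \<epsilon> x" "\<not> C (\<epsilon> / 4) x" for x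
    proof -
      obtain y r where yr: "R y r" "\<epsilon> / 4 \<le> r" "r < \<kappa>" "\<bar>x - y\<bar> < r * r"
        using Cx unfolding C_def not_le[symmetric] by blast
      have "r < \<epsilon>" using Cx(1) yr unfolding C_def not_le[symmetric] by blast
      then have "r * r \<le> \<epsilon> * (1 / 64)"
        using \<epsilon> \<kappa> yr(2) by (intro mult_mono) auto
      then show ?thesis using yr by (intro exI[of _ y] exI[of _ r]) auto
    qed
    \<comment> \<open>The two end pieces are \<open>\<epsilon> / 16\<close> apart. If both contained
      bad points, the responsible centres would be distinct and less than
      \<open>\<epsilon> / 4\<close> apart, with scales at least
      \<open>\<epsilon> / 4\<close>.\<close>
    have "(\<forall>x. p \<le> x \<and> x \<le> p + (\<epsilon> / 4) / 8 \<longrightarrow> C (\<epsilon> / 4) x)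
        \<or> (\<forall>x. p + 3 * \<epsilon> / 32 \<le> x \<and> x \<le> p + 3 * \<epsilon> / 32 + (\<epsilon> / 4) / 8 \<longrightarrow> C (\<epsilon> / 4) x)"
    proof (rule ccontr)
      assume "\<not> ?thesis"
      then obtain x1 x2 where x1: "p \<le> x1" "x1 \<le> p + (\<epsilon> / 4) / 8" "\<not> C (\<epsilon> / 4) x1"
        and x2: "p + 3 * \<epsilon> / 32 \<le> x2" "x2 \<le> p + 3 * \<epsilon> / 32 + (\<epsilon> / 4) / 8" "\<not> C (\<epsilon> / 4) x2"
        by blast
      have "C \<epsilon> x1" using x1 \<epsilon> by (intro p) auto
      then obtain y1 r1 where y1: "R y1 r1" "\<epsilon> / 4 \<le> r1" "\<bar>x1 - y1\<bar> < \<epsilon> / 64"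
        using bad x1(3) by blast
      have "C \<epsilon> x2" using x2 \<epsilon> by (intro p) auto
      then obtain y2 r2 where y2: "R y2 r2" "\<epsilon> / 4 \<le> r2" "\<bar>x2 - y2\<bar> < \<epsilon> / 64"
        using bad x2(3) by blast
      have near: "x1 - \<epsilon> / 64 < y1" "y1 < x1 + \<epsilon> / 64" "x2 - \<epsilon> / 64 < y2" "y2 < x2 + \<epsilon> / 64"
        using y1(3) y2(3) unfolding abs_less_iff by linarith+
      have "y1 < y2" using x1(2) x2(1) near \<epsilon> by linarith
      moreover have "y2 - y1 < \<epsilon> / 4" using x1(1) x2(2) near \<epsilon> by linarith
      moreover have "\<epsilon> / 4 \<le> min r1 r2" using y1 y2 by simp
      ultimately show False using sep[OF y1(1) y2(1)] by auto
    qed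
    then have "\<exists>p. \<forall>x. p \<le> x \<and> x \<le> p + \<epsilon> / 4 / 8 \<longrightarrow> C (\<epsilon> / 4) x" by blast
    then show ?thesis
      using \<epsilon> unfolding I_def by simp
  qed
  have small: "\<exists>\<epsilon>\<le>\<delta>. I \<epsilon>" if "0 < \<delta>" for \<delta>
  proof (rule ccontr)
    assume "\<not> ?thesis"
    then have *: "\<And>\<epsilon>. I \<epsilon> \<Longrightarrow> \<delta> \<le> \<epsilon>" by (meson linear)
    obtain t where t: "\<forall>\<epsilon>. I \<epsilon> \<longrightarrow> t \<le> \<epsilon>" "\<forall>b. (\<forall>\<epsilon>. I \<epsilon> \<longrightarrow> b \<le> \<epsilon>) \<longrightarrow> b \<le> t"
      using definable_inf[where P = I, OF dI \<open>I \<kappa>\<close> *] by blast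
    have "\<delta> \<le> t" using t(2) * by blast
    \<comment> \<open>A positive infimum \<open>t\<close> is impossible: some good
      \<open>\<epsilon>\<close> is below \<open>2 * t\<close>, and then
      \<open>\<epsilon> / 4\<close> is good and below \<open>t\<close>.\<close>
    then have "\<not> 2 * t \<le> t" using that by simp
    then obtain \<epsilon> where "I \<epsilon>" "\<epsilon> < 2 * t" using t(2) not_le by blast
    then have "t \<le> \<epsilon> / 4" using t(1) step by blast
    then show False using \<open>\<epsilon> < 2 * t\<close> \<open>\<delta> \<le> t\<close> that by simp
  qed
  have mono: "C d' x" if "0 < d" "d \<le> d'" "C d x" for d d' x
    using that unfolding C_def by (meson order_trans)
  have "\<exists>c. \<forall>d>0. \<exists>x. C d x \<and> \<bar>x - c\<bar> < d"
  proof (rule cluster_point_line[where W = C, OF dC])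
    show "\<exists>x. C d x" if d: "0 < d" for d
    proof -
      obtain \<epsilon> p where \<epsilon>: "\<epsilon> \<le> d" "0 < \<epsilon>" "\<And>x. p \<le> x \<Longrightarrow> x \<le> p + \<epsilon> / 8 \<Longrightarrow> C \<epsilon> x"
        using small[OF d] unfolding I_def by blast
      have "C \<epsilon> p" using \<epsilon>(2) by (intro \<epsilon>(3)) auto
      then show ?thesis using mono \<epsilon>(1,2) by blast
    qed
    show "a \<le> x \<and> x \<le> b" if "0 < d" "C d x" for d x
      using that by (simp add: C_def)
  qed (rule mono)
  then obtain c where c: "\<And>d. d > 0 \<Longrightarrow> \<exists>x. C d x \<and> \<bar>x - c\<bar> < d" by blast
  have "a \<le> c"
  proof (rule ccontr)
    assume "\<not> ?thesis"
    then show False using c[of "a - c"] by (auto simp: C_def abs_if split: if_splits)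
  qed
  moreover have "c \<le> b"
  proof (rule ccontr)
    assume "\<not> ?thesis"
    then show False using c[of "c - b"] by (auto simp: C_def abs_if split: if_splits)
  qed
  ultimately obtain r0 where "0 < r0" "R c r0" using ex by blast
  define r where "r = min r0 (\<kappa> / 2)"
  have r: "0 < r" "r < \<kappa>" "R c r"
    using \<open>0 < r0\<close> \<kappa> down[OF \<open>R c r0\<close>, of r] by (auto simp: r_def)
  \<comment> \<open>The scale \<open>r\<close> of \<open>c\<close> counts at level
    \<open>min r (r * r)\<close>, so \<open>x\<close> must stay \<open>r * r\<close> away from
    \<open>c\<close>; yet it is chosen closer.\<close>
  then obtain x where "C (min r (r * r)) x" "\<bar>x - c\<bar> < min r (r * r)"
    using c[of "min r (r * r)"] by auto
  then show False using r unfolding C_def by (meson leD min.cobounded1 min_less_iff_conj)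
qed

text \<open>
  Induction on the Cantor--Bendixson rank \<open>k\<close>. Where the union of the derived sets is thin, every point is
  isolated in some \<open>J s\<close>, and the radius of isolation is a separated scale.
\<close>

lemma Baire_increasing:
  assumes J: "dpred M (\<lambda>e. J (e 0) (e (Suc 0)))"
    and mono: "\<And>s s' y. 0 < s \<Longrightarrow> s \<le> s' \<Longrightarrow> J s' y \<Longrightarrow> J s y"
    and thin: "\<And>s. 0 < s \<Longrightarrow> \<not> thick (J s)"
  shows "\<not> thick (\<lambda>y. \<exists>s>0. J s y)"
proof -
  have *: "\<not> thick (\<lambda>y. \<exists>s>0. J s y)"
    if "dpred M (\<lambda>e. J (e 0) (e (Suc 0)))"
      "\<And>s s' y. 0 < s \<Longrightarrow> s \<le> s' \<Longrightarrow> J s' y \<Longrightarrow> J s y"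
      "\<And>s. 0 < s \<Longrightarrow> \<not> thick (J s)"
      "\<And>s y. 0 < s \<Longrightarrow> \<not> (accum ^^ k) (J s) y" for J k
    using that
  proof (induction k arbitrary: J)
    case 0
    then show ?case by (auto dest: thick_nonempty)
  next
    case (Suc k)
    note J = Suc.prems(1) and mono = Suc.prems(2)
    let ?J' = "\<lambda>s. accum (J s)"
    let ?U = "\<lambda>y. \<exists>s>0. ?J' s y"
    have dJ': "dpred M (\<lambda>e. ?J' (e 0) (e (Suc 0)))"
      by (intro dintros dpred_subst2[where P = J, OF J])
    have dU: "dpred M (\<lambda>e. ?U (e 0))"
      by (intro dintros dpred_subst2[where P = ?J', OF dJ'])
    have "\<not> thick ?U"
    proof (rule Suc.IH[OF dJ'])
      show "accum (J s) y" if "0 < s" "s \<le> s'" "accum (J s') y" for s s' y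
        by (rule accum_cong_local[OF that(3) zero_less_one]) (rule mono[OF that(1,2)])
      show "\<not> thick (accum (J s))" if "0 < s" for s
        using Suc.prems(3)[OF that] thick_mono[of "accum (J s)" "J s"] by (auto simp: accum_def)
      show "\<not> (accum ^^ k) (accum (J s)) y" if "0 < s" for s y
        using Suc.prems(4)[OF that, of y] by (simp add: funpow_swap1)
    qed
    show ?case
    proof
      assume "thick (\<lambda>y. \<exists>s>0. J s y)"
      from thick_minus[OF dU \<open>\<not> thick ?U\<close> this]
      obtain a0 b0 where ab0: "a0 < b0"
        "\<And>y. a0 < y \<Longrightarrow> y < b0 \<Longrightarrow> (\<exists>s>0. J s y) \<and> (\<forall>s>0. \<not> accum (J s) y)"
        unfolding thick_def by blast
      obtain a where a: "a0 < a" "a < b0" using dense[OF ab0(1)] by blast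
      obtain b where b: "a < b" "b < b0" using dense[OF a(2)] by blast
      let ?R = "\<lambda>x r. 0 < r \<and> (\<exists>s>0. J s x \<and> (\<forall>z. J s z \<and> z \<noteq> x \<longrightarrow> r \<le> \<bar>z - x\<bar>))"
      show False
      proof (rule no_separated_scale[where R = ?R])
        show "dpred M (\<lambda>e. ?R (e 0) (e (Suc 0)))"
          by (intro dintros dpred_subst2[where P = J, OF J])
        show "a < b" by (rule b)
        show "\<exists>r>0. ?R x r" if x: "a \<le> x" "x \<le> b" for x
        proof -
          obtain s where s: "s > 0" "J s x" "\<not> accum (J s) x"
            using ab0(2)[of x] x a b by auto
          then obtain r where "r > 0" "\<forall>z. J s z \<and> z \<noteq> x \<longrightarrow> r \<le> \<bar>z - x\<bar>"
            unfolding accum_def by (meson not_le)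
          then show ?thesis using s by blast
        qed
        show "?R x s" if "?R x r" "0 < s" "s \<le> r" for x r s
          using that order_trans by meson
        show "min r r' \<le> \<bar>x - y\<bar>" if x: "?R x r" and y: "?R y r'" and "x \<noteq> y" for x y r r'
        proof -
          obtain s where s: "s > 0" "J s x" "\<And>z. J s z \<Longrightarrow> z \<noteq> x \<Longrightarrow> r \<le> \<bar>z - x\<bar>" using x by blast
          obtain t where t: "t > 0" "J t y" "\<And>z. J t z \<Longrightarrow> z \<noteq> y \<Longrightarrow> r' \<le> \<bar>z - y\<bar>" using y by blast
          \<comment> \<open>The sets \<open>J s\<close> are nested: the one with the smaller index
            contains both points, and its radius of isolation separates them.\<close>
          show ?thesis
          proof (cases "s \<le> t")
            case True
            then have "J s y" using mono s(1) t(2) by blast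
            then have "r \<le> \<bar>y - x\<bar>" using s(3) \<open>x \<noteq> y\<close> by blast
            then show ?thesis by (simp add: abs_minus_commute min_le_iff_disj)
          next
            case False
            then have "J t x" using mono[of t s x] s(2) t(1) by auto
            then have "r' \<le> \<bar>x - y\<bar>" using t(3) \<open>x \<noteq> y\<close> by blast
            then show ?thesis by (simp add: min_le_iff_disj)
          qed
        qed
      qed
    qed
  qed
  have "dpred M (\<lambda>e. J (e (Suc 0)) (e 0))"
    by (intro dintros dpred_subst2[where P = J, OF J])
  from uniform_accum[OF this] obtain k where
    k: "\<forall>e. \<not> thick (\<lambda>y. J (case_nat y e (Suc 0)) (case_nat y e 0)) \<longrightarrow>
      (\<forall>x. \<not> (accum ^^ k) (\<lambda>y. J (case_nat y e (Suc 0)) (case_nat y e 0)) x)"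
    by (rule exE)
  show ?thesis
  proof (rule *[of J k, OF J])
    show "J s y" if "0 < s" "s \<le> s'" "J s' y" for s s' y
      using mono[OF that] .
    show "\<not> thick (J s)" if "0 < s" for s
      using thin[OF that] .
    show "\<not> (accum ^^ k) (J s) y" if "0 < s" for s y
      using k[rule_format, of "\<lambda>_. s" y] thin[OF that] by simp
  qed
qed

text \<open>A pigeonhole principle for bounded many-valued maps on an interval. Take
  \<open>c\<close> as the supremum of the levels below which only thinly many \<open>t\<close> have
  values. Then values below \<open>c + \<epsilon> / 2\<close> occur for thickly many
  \<open>t\<close>, values below \<open>c - \<epsilon> / 2\<close> only for thinly many, and the
  difference is thick.\<close>

lemma thick_localize:
  assumes W: "dpred M (\<lambda>e. W (e 0) (e (Suc 0)))"
    and T: "thick T" "\<And>t. T t \<Longrightarrow> \<exists>y. W t y"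
    and bounded: "\<And>t y. W t y \<Longrightarrow> \<bar>y\<bar> \<le> B" and \<epsilon>: "0 < \<epsilon>"
  shows "\<exists>c. thick (\<lambda>t. T t \<and> (\<exists>y. W t y \<and> \<bar>y - c\<bar> < \<epsilon>))"
proof -
  obtain a b where ab: "a < b" "\<And>t. a < t \<Longrightarrow> t < b \<Longrightarrow> T t"
    using T(1) unfolding thick_def by blast
  let ?L = "\<lambda>y t. a < t \<and> t < b \<and> (\<exists>z. W t z \<and> z < y)"
  let ?S = "\<lambda>y. \<not> thick (?L y)"
  have dL: "dpred M (\<lambda>e. ?L (e 0) (e (Suc 0)))"
    by (intro dintros dpred_subst2[where P = W, OF W])
  have dS: "dpred M (\<lambda>e. ?S (e 0))"
    by (intro dintros dpred_subst2[where P = W, OF W])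
  have L_mono: "?S y" if "?S z" "y \<le> z" for y z
  proof
    assume "thick (?L y)"
    then have "thick (?L z)" by (rule thick_mono) (use that(2) in \<open>auto intro: less_le_trans\<close>)
    with that(1) show False by blast
  qed
  have S0: "?S (- B)"
  proof
    assume "thick (?L (- B))"
    then obtain t where "?L (- B) t" using thick_nonempty by blast
    then obtain z where "W t z" "z < - B" by blast
    then show False using bounded[of t z] by (simp add: abs_le_iff)
  qed
  have S1: "y \<le> B + 1" if "?S y" for y
  proof (rule ccontr)
    assume "\<not> y \<le> B + 1"
    then have "?S (B + 1)" using L_mono[OF that] by simp
    moreover have "thick (?L (B + 1))"
    proof (rule thickI[OF ab(1)])
      fix t assume t: "a < t" "t < b"
      then obtain z where "W t z" using T(2) ab(2) by blast
      then show "?L (B + 1) t" using t bounded[of t z] by (intro conjI exI[of _ z]) (auto simp: abs_le_iff)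
    qed
    ultimately show False by blast
  qed
  obtain c where c: "\<forall>y. ?S y \<longrightarrow> y \<le> c" "\<forall>b. (\<forall>y. ?S y \<longrightarrow> y \<le> b) \<longrightarrow> c \<le> b"
    using definable_sup[where P = ?S, OF dS S0 S1] by blast
  have up: "thick (?L (c + \<epsilon> / 2))"
  proof (rule ccontr)
    assume "?S (c + \<epsilon> / 2)"
    then have "c + \<epsilon> / 2 \<le> c" using c(1) by blast
    then show False using \<epsilon> by simp
  qed
  have lo: "?S (c - \<epsilon> / 2)"
  proof -
    have "\<not> c \<le> c - \<epsilon> / 2" using \<epsilon> by simp
    then obtain z where "?S z" "c - \<epsilon> / 2 < z" using c(2) not_le by blast
    then show ?thesis using L_mono by simp
  qed
  have "dpred M (\<lambda>e. ?L (c - \<epsilon> / 2) (e 0))"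
    by (intro dintros dpred_subst2[where P = W, OF W])
  from thick_minus[where P = "?L (c - \<epsilon> / 2)", OF this lo up]
  have "thick (\<lambda>t. T t \<and> (\<exists>y. W t y \<and> \<bar>y - c\<bar> < \<epsilon>))"
  proof (rule thick_mono)
    fix t assume t: "?L (c + \<epsilon> / 2) t \<and> \<not> ?L (c - \<epsilon> / 2) t"
    then obtain z where z: "W t z" "z < c + \<epsilon> / 2" by blast
    then have "\<not> z < c - \<epsilon> / 2" using t by blast
    then have "\<bar>z - c\<bar> < \<epsilon>" using z(2) \<epsilon> by (auto simp: abs_less_iff field_simps)
    then show "T t \<and> (\<exists>y. W t y \<and> \<bar>y - c\<bar> < \<epsilon>)" using t z ab(2) by blast
  qed
  then show ?thesis by blast
qed

section \<open>Kuratowski--Ulam theorems\<close>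

text \<open>The Kuratowski--Ulam direction from slices to the whole space. By
  \<open>Baire_increasing\<close> one size \<open>s\<close> serves thickly many \<open>t\<close>;
  then \<open>thick_localize\<close>, once per coordinate, confines the centres to within
  \<open>s / 2\<close> of a common point, around which all these boxes overlap.\<close>

lemma thick_boxes:
  fixes z :: "nat \<Rightarrow> 'a"
  assumes B: "dpred M B"
    and T: "thick T" "\<And>t. T t \<Longrightarrow> \<exists>c. \<exists>\<delta>>0. \<forall>a. (\<forall>i<q. \<bar>a i - c i\<bar> < \<delta>) \<longrightarrow> B (app q a (case_nat t z))"
  shows "\<exists>c. \<exists>\<delta>>0. \<forall>a. (\<forall>i<Suc q. \<bar>a i - c i\<bar> < \<delta>) \<longrightarrow> B (app (Suc q) a z)"
proof -
  \<comment> \<open>One number \<open>s\<close> controls both the size of the box and, through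
    \<open>1 / s\<close>, the position of its centre. This makes the family monotone in
    \<open>s\<close> and gives \<open>thick_localize\<close> its bound.\<close>
  let ?C = "\<lambda>s t c. (\<forall>i<q. \<bar>c i\<bar> \<le> 1 / s) \<and>
    (\<forall>a. (\<forall>i<q. \<bar>a i - c i\<bar> < s) \<longrightarrow> B (app q a (case_nat t z)))"
  let ?J = "\<lambda>s t. \<exists>c. ?C s t c"
  have cong: "((\<forall>i<q. \<bar>a i - c i\<bar> < s) \<longrightarrow> B (app q a e)) = ((\<forall>i<q. \<bar>b i - c i\<bar> < s) \<longrightarrow> B (app q b e))"
    if "\<And>i. i < q \<Longrightarrow> a i = b i" for a b c s e
    using app_cong[of q a b, OF that] that by simp
  have dJ: "dpred M (\<lambda>e. ?J (e 0) (e (Suc 0)))"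
    by (intro dpred_ex_fun[where n = q] dintros dpred_all_fun[where n = q] dpred_subst[OF B] cong) simp_all
  have J_mono: "?J s y" if s: "0 < s" "s \<le> s'" "?J s' y" for s s' y
  proof -
    obtain c where c: "?C s' y c" using s(3) by blast
    have "1 / s' \<le> 1 / s" using s(1,2) by (simp add: frac_le)
    then have "?C s y c" using c s(2) by (meson less_le_trans order_trans)
    then show ?thesis by blast
  qed
  have "thick (\<lambda>t. \<exists>s>0. ?J s t)"
  proof (rule thick_mono[OF T(1)])
    fix t assume "T t"
    then obtain c \<delta> where c: "\<delta> > 0" "\<And>a. (\<forall>i<q. \<bar>a i - c i\<bar> < \<delta>) \<Longrightarrow> B (app q a (case_nat t z))"
      using T(2) by blast
    define b where "b = Max (insert 1 ((\<lambda>i. \<bar>c i\<bar>) ` {..<q}))"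
    have b: "1 \<le> b" "\<And>i. i < q \<Longrightarrow> \<bar>c i\<bar> \<le> b" by (auto simp: b_def)
    define s where "s = min \<delta> (1 / b)"
    have s: "0 < s" "s \<le> \<delta>" using c(1) b(1) by (auto simp: s_def)
    have "s \<le> 1 / b" by (simp add: s_def)
    then have "b \<le> 1 / s" using s(1) b(1) by (simp add: field_simps)
    then have "?C s t c" using b(2) c(2) s(2) by (meson less_le_trans order_trans)
    then show "\<exists>s>0. ?J s t" using s(1) by blast
  qed
  moreover have "\<not> thick (\<lambda>t. \<exists>s>0. ?J s t)" if thin: "\<And>s. 0 < s \<Longrightarrow> \<not> thick (?J s)"
    by (rule Baire_increasing[where J = ?J, OF dJ]) (rule J_mono, assumption+, rule thin)
  ultimately obtain s where s: "0 < s" "thick (?J s)" by blast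
  have "\<exists>c. thick (\<lambda>t. \<exists>d. ?C s t d \<and> (\<forall>i<j. \<bar>d i - c i\<bar> < s / 2))" if "j \<le> q" for j
    using that
  proof (induction j)
    case 0
    then show ?case using s(2) by simp
  next
    case (Suc j)
    then obtain c where c: "thick (\<lambda>t. \<exists>d. ?C s t d \<and> (\<forall>i<j. \<bar>d i - c i\<bar> < s / 2))" by auto
    let ?W = "\<lambda>t y. \<exists>d. ?C s t d \<and> (\<forall>i<j. \<bar>d i - c i\<bar> < s / 2) \<and> d j = y"
    have j: "j < q" "\<And>i. i < j \<Longrightarrow> i < q" using Suc.prems by auto
    have "dpred M (\<lambda>e. ?W (e 0) (e (Suc 0)))"
      by (intro dpred_ex_fun[where n = q] dintros dpred_all_fun[where n = q] dpred_subst[OF B] cong)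
        (simp_all add: j)
    then have "\<exists>c'. thick (\<lambda>t. (\<exists>d. ?C s t d \<and> (\<forall>i<j. \<bar>d i - c i\<bar> < s / 2)) \<and> (\<exists>y. ?W t y \<and> \<bar>y - c'\<bar> < s / 2))"
    proof (rule thick_localize[where W = ?W and B = "1 / s"])
      show "0 < s / 2" using s(1) by simp
    qed (use c j in auto)
    then obtain c' where c': "thick (\<lambda>t. (\<exists>d. ?C s t d \<and> (\<forall>i<j. \<bar>d i - c i\<bar> < s / 2)) \<and> (\<exists>y. ?W t y \<and> \<bar>y - c'\<bar> < s / 2))"
      by blast
    have "thick (\<lambda>t. \<exists>d. ?C s t d \<and> (\<forall>i<Suc j. \<bar>d i - (c(j := c')) i\<bar> < s / 2))"
    proof (rule thick_mono[OF c'])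
      fix t assume "(\<exists>d. ?C s t d \<and> (\<forall>i<j. \<bar>d i - c i\<bar> < s / 2)) \<and> (\<exists>y. ?W t y \<and> \<bar>y - c'\<bar> < s / 2)"
      then obtain d where d: "?C s t d" "\<forall>i<j. \<bar>d i - c i\<bar> < s / 2" "\<bar>d j - c'\<bar> < s / 2" by blast
      then have "\<forall>i<Suc j. \<bar>d i - (c(j := c')) i\<bar> < s / 2" by (auto simp: less_Suc_eq)
      then show "\<exists>d. ?C s t d \<and> (\<forall>i<Suc j. \<bar>d i - (c(j := c')) i\<bar> < s / 2)" using d(1) by blast
    qed
    then show ?case by blast
  qed
  then obtain c where "thick (\<lambda>t. \<exists>d. ?C s t d \<and> (\<forall>i<q. \<bar>d i - c i\<bar> < s / 2))" by blast
  then obtain l h where lh: "l < h" "\<And>t. l < t \<Longrightarrow> t < h \<Longrightarrow> \<exists>d. ?C s t d \<and> (\<forall>i<q. \<bar>d i - c i\<bar> < s / 2)"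
    unfolding thick_def by blast
  \<comment> \<open>The parameter becomes coordinate \<open>q\<close>. A point within
    \<open>s / 2\<close> of \<open>c\<close> is within \<open>s\<close> of the centre
    \<open>d\<close> belonging to its last coordinate.\<close>
  show ?thesis
  proof (intro exI[of _ "c(q := (l + h) / 2)"] exI[of _ "min (s / 2) ((h - l) / 2)"] conjI allI impI)
    show "0 < min (s / 2) ((h - l) / 2)" using s(1) lh(1) by simp
    fix a assume a: "\<forall>i<Suc q. \<bar>a i - (c(q := (l + h) / 2)) i\<bar> < min (s / 2) ((h - l) / 2)"
    have "\<bar>a q - (l + h) / 2\<bar> < (h - l) / 2" using a by auto
    then have "l < a q" "a q < h" by (auto simp: abs_less_iff field_simps)
    then obtain d where d: "?C s (a q) d" "\<forall>i<q. \<bar>d i - c i\<bar> < s / 2" using lh(2) by blast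
    have "\<bar>a i - d i\<bar> < s" if "i < q" for i
    proof -
      have "\<bar>a i - c i\<bar> < s / 2" using a[rule_format, of i] that by auto
      moreover have "\<bar>d i - c i\<bar> < s / 2" using d(2) that by blast
      ultimately show ?thesis unfolding abs_less_iff by linarith
    qed
    then show "B (app (Suc q) a z)" using d(1) by (simp add: app_Suc)
  qed
qed

text \<open>The case of one coordinate in \<open>thick_boxes\<close>: the set contains a rectangle,
  and the height of its centre is a suitable \<open>y\<close>.\<close>

lemma thick_fibre_swap:
  assumes A: "dpred M (\<lambda>e. A (e 0) (e (Suc 0)))"
    and T: "thick (\<lambda>t. thick (A t))"
  shows "\<exists>y. thick (\<lambda>t. A t y)"
proof -
  have B: "dpred M (\<lambda>e. A (e (Suc 0)) (e 0))"
    by (intro dintros dpred_subst2[where P = A, OF A])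
  have "\<exists>c. \<exists>\<delta>>0. \<forall>a. (\<forall>i<Suc 0. \<bar>a i - c i\<bar> < \<delta>) \<longrightarrow> A (app 1 a (case_nat t (\<lambda>_. 0)) (Suc 0)) (app 1 a (case_nat t (\<lambda>_. 0)) 0)"
    if At: "thick (A t)" for t
  proof -
    obtain l h where lh: "l < h" "\<And>y. l < y \<Longrightarrow> y < h \<Longrightarrow> A t y" using At unfolding thick_def by blast
    have "\<forall>a. (\<forall>i<Suc 0. \<bar>a i - (l + h) / 2\<bar> < (h - l) / 2) \<longrightarrow> A t (a 0)"
    proof (intro allI impI)
      fix a :: "nat \<Rightarrow> 'a" assume "\<forall>i<Suc 0. \<bar>a i - (l + h) / 2\<bar> < (h - l) / 2"
      then have "\<bar>a 0 - (l + h) / 2\<bar> < (h - l) / 2" by blast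
      then have "l < a 0" "a 0 < h" by (auto simp: abs_less_iff field_simps)
      then show "A t (a 0)" by (rule lh(2))
    qed
    then show ?thesis using lh(1)
      by (intro exI[of _ "\<lambda>_. (l + h) / 2"] exI[of _ "(h - l) / 2"]) (simp add: app_def)
  qed
  from thick_boxes[OF B T, of 1 "\<lambda>_. 0"] this
  obtain c \<delta> where c: "\<delta> > 0" "\<And>a. (\<forall>i<Suc 1. \<bar>a i - c i\<bar> < \<delta>) \<Longrightarrow> A (app (Suc 1) a (\<lambda>_. 0) (Suc 0)) (app (Suc 1) a (\<lambda>_. 0) 0)"
    by auto
  have "thick (\<lambda>t. A t (c 0))"
  proof (rule thickI)
    show "c 1 - \<delta> < c 1 + \<delta>" using c(1) by simp
    fix t assume "c 1 - \<delta> < t" "t < c 1 + \<delta>"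
    then have "\<bar>t - c 1\<bar> < \<delta>" by (simp add: abs_less_iff)
    then show "A t (c 0)"
      using c(2)[of "c(1 := t)"] c(1) by (auto simp: app_def less_Suc_eq)
  qed
  then show ?thesis by blast
qed

text \<open>Induction on the Cantor--Bendixson rank of the index set. Non-isolated indices have
  smaller rank. Isolated ones are split by a scale \<open>s\<close>: at a fixed scale they are
  bounded and \<open>s\<close>-separated, so localizing the index leaves a single thin set
  \<open>A y\<close>. The Baire property handles the union over \<open>s\<close>.\<close>

lemma not_thick_Union:
  assumes "dpred M (\<lambda>e. Y (e 0))" "\<not> thick Y"
    and A: "dpred M (\<lambda>e. A (e 0) (e (Suc 0)))" "\<And>y. Y y \<Longrightarrow> \<not> thick (A y)"
  shows "\<not> thick (\<lambda>t. \<exists>y. Y y \<and> A y t)"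
proof -
  have *: "\<not> thick (\<lambda>t. \<exists>y. Y y \<and> A y t)"
    if "dpred M (\<lambda>e. Y (e 0))" "\<And>y. \<not> (accum ^^ k) Y y" "\<And>y. Y y \<Longrightarrow> \<not> thick (A y)" for Y k
    using that
  proof (induction k arbitrary: Y)
    case 0
    then show ?case by (auto dest: thick_nonempty)
  next
    case (Suc k)
    note Y = Suc.prems(1) and thin = Suc.prems(3)
    have dY': "dpred M (\<lambda>e. accum Y (e 0))"
      by (intro dintros dpred_subst1[where P = Y, OF Y])
    have N1: "\<not> thick (\<lambda>t. \<exists>y. accum Y y \<and> A y t)"
    proof (rule Suc.IH[OF dY'])
      show "\<not> (accum ^^ k) (accum Y) y" for y using Suc.prems(2)[of y] by (simp add: funpow_swap1)
      show "\<not> thick (A y)" if "accum Y y" for y using thin that by (simp add: accum_def)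
    qed
    let ?J = "\<lambda>s t. \<exists>y. Y y \<and> \<bar>y\<bar> \<le> 1 / s \<and> (\<forall>y'. Y y' \<and> y' \<noteq> y \<longrightarrow> s \<le> \<bar>y' - y\<bar>) \<and> A y t"
    have dJ: "dpred M (\<lambda>e. ?J (e 0) (e (Suc 0)))"
      by (intro dintros dpred_subst1[where P = Y, OF Y] dpred_subst2[where P = A, OF A(1)])
    have N2: "\<not> thick (\<lambda>t. \<exists>s>0. ?J s t)"
    proof (rule Baire_increasing[where J = ?J, OF dJ])
      show "?J s t" if s: "0 < s" "s \<le> s'" "?J s' t" for s s' t
      proof -
        obtain y where y: "Y y" "\<bar>y\<bar> \<le> 1 / s'" "\<And>y'. Y y' \<Longrightarrow> y' \<noteq> y \<Longrightarrow> s' \<le> \<bar>y' - y\<bar>" "A y t"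
          using s(3) by blast
        have "1 / s' \<le> 1 / s" using s(1,2) by (simp add: frac_le)
        then have "\<bar>y\<bar> \<le> 1 / s" using y(2) by (rule order_trans[rotated])
        moreover have "s \<le> \<bar>y' - y\<bar>" if "Y y'" "y' \<noteq> y" for y'
          using y(3)[OF that] s(2) by (rule order_trans[rotated])
        ultimately show ?thesis using y(1,4) by blast
      qed
      fix s :: 'a assume s: "0 < s"
      show "\<not> thick (?J s)"
      proof
        assume T: "thick (?J s)"
        let ?W = "\<lambda>t y. Y y \<and> \<bar>y\<bar> \<le> 1 / s \<and> (\<forall>y'. Y y' \<and> y' \<noteq> y \<longrightarrow> s \<le> \<bar>y' - y\<bar>) \<and> A y t"
        have dW: "dpred M (\<lambda>e. ?W (e 0) (e (Suc 0)))"
          by (intro dintros dpred_subst1[where P = Y, OF Y] dpred_subst2[where P = A, OF A(1)])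
        have "\<exists>c. thick (\<lambda>t. ?J s t \<and> (\<exists>y. ?W t y \<and> \<bar>y - c\<bar> < s / 2))"
          by (rule thick_localize[where W = ?W and B = "1 / s", OF dW T]) (use s in auto)
        then obtain c where c: "thick (\<lambda>t. ?J s t \<and> (\<exists>y. ?W t y \<and> \<bar>y - c\<bar> < s / 2))" by blast
        \<comment> \<open>Every index within \<open>s / 2\<close> of \<open>c\<close> equals
          \<open>y0\<close>, since distinct indices at this scale are at least \<open>s\<close>
          apart.\<close>
        then obtain t0 y0 where y0: "?W t0 y0" "\<bar>y0 - c\<bar> < s / 2"
          using thick_nonempty by blast
        have "thick (A y0)"
        proof (rule thick_mono[OF c])
          fix t assume "?J s t \<and> (\<exists>y. ?W t y \<and> \<bar>y - c\<bar> < s / 2)"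
          then obtain y where y: "?W t y" "\<bar>y - c\<bar> < s / 2" by blast
          have "\<bar>y0 - y\<bar> < s" using y(2) y0(2) unfolding abs_less_iff by linarith
          then have "y = y0" using y(1) y0(1) not_le by blast
          then show "A y0 t" using y(1) by blast
        qed
        then show False using thin y0(1) by blast
      qed
    qed
    have dU: "dpred M (\<lambda>e. \<exists>y. accum Y y \<and> A y (e 0))"
      by (intro dintros dpred_subst1[where P = Y, OF Y] dpred_subst2[where P = A, OF A(1)])
    have cover: "(\<exists>y. accum Y y \<and> A y t) \<or> (\<exists>s>0. ?J s t)" if t: "\<exists>y. Y y \<and> A y t" for t
    proof -
      obtain y where y: "Y y" "A y t" using t by blast
      show ?thesis
      proof (cases "accum Y y")
        case True
        then show ?thesis using y by blast
      next
        case False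
        then obtain \<epsilon> where \<epsilon>: "\<epsilon> > 0" "\<And>y'. Y y' \<Longrightarrow> y' \<noteq> y \<Longrightarrow> \<epsilon> \<le> \<bar>y' - y\<bar>"
          using y(1) unfolding accum_def not_le[symmetric] by blast
        \<comment> \<open>\<open>\<epsilon>\<close> isolates \<open>y\<close>; the second bound
          yields \<open>\<bar>y\<bar> \<le> 1 / s\<close>, with \<open>+ 1\<close> avoiding a
          division by zero at \<open>y = 0\<close>.\<close>
        define s where "s = min \<epsilon> (1 / (\<bar>y\<bar> + 1))"
        have pos: "0 < \<bar>y\<bar> + 1" by (simp add: add_nonneg_pos)
        then have s: "0 < s" using \<epsilon>(1) by (simp add: s_def)
        have "s \<le> 1 / (\<bar>y\<bar> + 1)" by (simp add: s_def)
        then have "s * (\<bar>y\<bar> + 1) \<le> 1" using pos by (simp add: pos_le_divide_eq)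
        then have "s * \<bar>y\<bar> \<le> 1" using s by (simp add: distrib_left)
        then have "\<bar>y\<bar> \<le> 1 / s" using s by (simp add: pos_le_divide_eq mult.commute)
        moreover have "s \<le> \<bar>y' - y\<bar>" if "Y y'" "y' \<noteq> y" for y'
          using \<epsilon>(2)[OF that] by (simp add: s_def min_le_iff_disj)
        ultimately show ?thesis using y s by blast
      qed
    qed
    show ?case
    proof
      assume "thick (\<lambda>t. \<exists>y. Y y \<and> A y t)"
      then have "thick (\<lambda>t. (\<exists>y. accum Y y \<and> A y t) \<or> (\<exists>s>0. ?J s t))"
        by (rule thick_mono) (rule cover)
      from thick_disj[where P = "\<lambda>t. \<exists>y. accum Y y \<and> A y t", OF dU this]
      show False
        by (elim disjE) (rule notE[OF N1], assumption, rule notE[OF N2], assumption)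
    qed
  qed
  obtain k where k: "\<forall>e. \<not> thick (\<lambda>y. Y (case_nat y e 0)) \<longrightarrow> (\<forall>x. \<not> (accum ^^ k) (\<lambda>y. Y (case_nat y e 0)) x)"
    using uniform_accum[OF assms(1)] by (rule exE)
  have "\<not> (accum ^^ k) Y y" for y
    using k[rule_format, of "\<lambda>_. y" y] assms(2) by simp
  from *[OF assms(1) this A(2)] show ?thesis .
qed

section \<open>Finite sets escaping all members of a thin family\<close>

text \<open>
  Induction on the number of parameters: if one more parameter \<open>y\<close> is added, a first finite set makes
  the set of the remaining bad \<open>y\<close> thin for all values of the other parameters, and then \<open>y\<close> can be
  projected away.
\<close>

lemma finite_escape_aux:
  assumes "dpred M S"
    and "\<And>e e'. (\<And>i. i \<le> p \<Longrightarrow> e i = e' i) \<Longrightarrow> S e = S e'"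
    and "\<And>e. \<not> thick (\<lambda>t. S (case_nat t e))"
  shows "\<exists>T. finite T \<and> (\<forall>e. \<exists>t\<in>T. \<not> S (case_nat t e))"
  using assms
proof (induction p arbitrary: S)
  case 0
  obtain t where t: "\<not> S (case_nat t (\<lambda>_. 0))"
    using "0.prems"(3)[of "\<lambda>_. 0"] unfolding thick_def by (meson zero_less_one)
  have "\<not> S (case_nat t e)" for e
    using t "0.prems"(2)[of "case_nat t e" "case_nat t (\<lambda>_. 0)"] by auto
  then show ?case by (intro exI[of _ "{t}"]) auto
next
  case (Suc p)
  note S = Suc.prems(1) and supp = Suc.prems(2) and thin = Suc.prems(3)
  have dS: "dpred M (\<lambda>e. S (case_nat (f e) (case_nat (g e) (h e))))"
    if "dfun M f" "dfun M g" "\<And>i. dfun M (\<lambda>e. h e i)" for f g h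
    by (rule dpred_subst[OF S, of "\<lambda>e. case_nat (f e) (case_nat (g e) (h e))"]) (intro dintros that)
  have S_cong: "S (case_nat t (case_nat y e)) = S (case_nat t (case_nat y e'))"
    if "\<And>i. i < p \<Longrightarrow> e i = e' i" for t y e e'
    by (rule supp) (use that in \<open>auto split: nat.splits\<close>)
  \<comment> \<open>Index \<open>0\<close> is the test point, the later indices are parameters.
    \<open>?S1\<close> drops the parameter \<open>y\<close> by keeping only the \<open>t\<close>
    that are bad for thickly many \<open>y\<close>; by \<open>thick_fibre_swap\<close> these
    \<open>t\<close> form a thin set.\<close>
  let ?S1 = "\<lambda>e. thick (\<lambda>y. S (case_nat (e 0) (case_nat y (\<lambda>i. e (Suc i)))))"
  have "\<exists>T. finite T \<and> (\<forall>e. \<exists>t\<in>T. \<not> ?S1 (case_nat t e))"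
  proof (rule Suc.IH)
    show "dpred M ?S1" by (intro dpred_thick dS dintros)
    show "?S1 e = ?S1 e'" if "\<And>i. i \<le> p \<Longrightarrow> e i = e' i" for e e'
    proof -
      have "S (case_nat (e 0) (case_nat y (\<lambda>i. e (Suc i)))) = S (case_nat (e' 0) (case_nat y (\<lambda>i. e' (Suc i))))" for y
        using S_cong[of "\<lambda>i. e (Suc i)" "\<lambda>i. e' (Suc i)" "e' 0" y] that by simp
      then show ?thesis by simp
    qed
    show "\<not> thick (\<lambda>t. ?S1 (case_nat t e))" for e
    proof
      assume th: "thick (\<lambda>t. ?S1 (case_nat t e))"
      have d: "dpred M (\<lambda>e'. S (case_nat (e' 0) (case_nat (e' (Suc 0)) e)))"
        by (intro dS dintros)
      from thick_fibre_swap[where A = "\<lambda>t y. S (case_nat t (case_nat y e))", OF d] th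
      obtain y where "thick (\<lambda>t. S (case_nat t (case_nat y e)))" by auto
      with thin show False by blast
    qed
  qed
  then obtain T1 where T1: "finite T1" "\<And>e. \<exists>t\<in>T1. \<not> ?S1 (case_nat t e)" by blast
  \<comment> \<open>The values of \<open>y\<close> for which all of \<open>T1\<close> is bad. They
    form a thin set for any choice of the other parameters, so by \<open>not_thick_Union\<close> the
    projection \<open>?S2\<close> still has thin fibres.\<close>
  let ?Y = "\<lambda>e y. \<forall>t\<in>T1. S (case_nat t (case_nat y e))"
  let ?S2 = "\<lambda>e. \<exists>y. ?Y (\<lambda>i. e (Suc i)) y \<and> S (case_nat (e 0) (case_nat y (\<lambda>i. e (Suc i))))"
  have "\<exists>T. finite T \<and> (\<forall>e. \<exists>t\<in>T. \<not> ?S2 (case_nat t e))"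
  proof (rule Suc.IH)
    show "dpred M ?S2"
      by (intro dpred_ex dpred_conj dpred_ball_finite[OF T1(1)] dS dintros)
    show "?S2 e = ?S2 e'" if "\<And>i. i \<le> p \<Longrightarrow> e i = e' i" for e e'
    proof -
      have "S (case_nat t (case_nat y (\<lambda>i. e (Suc i)))) = S (case_nat t (case_nat y (\<lambda>i. e' (Suc i))))" for t y
        by (rule S_cong) (use that in simp)
      then show ?thesis using that[of 0] by simp
    qed
    show "\<not> thick (\<lambda>t. ?S2 (case_nat t e))" for e
    proof -
      have Y: "dpred M (\<lambda>e'. ?Y e (e' 0))"
        by (intro dpred_ball_finite[OF T1(1)] dS dintros)
      have A: "dpred M (\<lambda>e'. S (case_nat (e' (Suc 0)) (case_nat (e' 0) e)))"
        by (intro dS dintros)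
      obtain t where t: "t \<in> T1" "\<not> thick (\<lambda>y. S (case_nat t (case_nat y e)))"
        using T1(2)[of e] by auto
      have "\<not> thick (?Y e)"
      proof
        assume "thick (?Y e)"
        then have "thick (\<lambda>y. S (case_nat t (case_nat y e)))"
          by (rule thick_mono) (use t(1) in blast)
        with t(2) show False by blast
      qed
      from not_thick_Union[where Y = "?Y e" and A = "\<lambda>y t. S (case_nat t (case_nat y e))", OF Y this A thin]
      show ?thesis by simp
    qed
  qed
  then obtain T2 where T2: "finite T2" "\<And>e. \<exists>t\<in>T2. \<not> ?S2 (case_nat t e)" by blast
  \<comment> \<open>If all of \<open>T1\<close> is bad for \<open>e\<close>, then \<open>e 0\<close>
    satisfies \<open>?Y\<close>, and a point of \<open>T2\<close> escapes.\<close>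
  have "\<exists>t\<in>T1 \<union> T2. \<not> S (case_nat t e)" for e
  proof (cases "\<forall>t\<in>T1. S (case_nat t e)")
    case True
    let ?e = "\<lambda>i. e (Suc i)"
    obtain t where t: "t \<in> T2" "\<not> ?S2 (case_nat t ?e)" using T2(2) by blast
    have "\<not> S (case_nat t e)"
    proof
      assume "S (case_nat t e)"
      then have "?S2 (case_nat t ?e)" using True by (intro exI[of _ "e 0"]) simp
      with t(2) show False by blast
    qed
    then show ?thesis using t(1) by blast
  qed auto
  then show ?case using T1(1) T2(1) by (intro exI[of _ "T1 \<union> T2"]) auto
qed

lemma finite_escape:
  assumes "dpred M S"
  shows "\<exists>T. finite T \<and> (\<forall>e. \<not> thick (\<lambda>t. S (case_nat t e)) \<longrightarrow> (\<exists>t\<in>T. \<not> S (case_nat t e)))"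
proof -
  let ?N = "\<lambda>e. thick (\<lambda>t. S (case_nat t e))"
  \<comment> \<open>Thick fibres are replaced by empty ones, so that the hypothesis of
    \<open>finite_escape_aux\<close> holds for all parameters.\<close>
  let ?S = "\<lambda>e. S e \<and> \<not> ?N (\<lambda>i. e (Suc i))"
  have dS: "dpred M ?S"
  proof (intro dintros assms)
    show "dpred M (\<lambda>e. S (case_nat (e 0) (\<lambda>i. e (Suc (Suc i)))))"
      by (rule dpred_subst[OF assms, of "\<lambda>e. case_nat (e 0) (\<lambda>i. e (Suc (Suc i)))"]) (intro dintros)
  qed
  obtain N where N: "\<And>e e'. (\<And>i. i < N \<Longrightarrow> e i = e' i) \<Longrightarrow> ?S e = ?S e'"
    by (rule dpred_finite_support[OF dS]) blast
  have "\<exists>T. finite T \<and> (\<forall>e. \<exists>t\<in>T. \<not> ?S (case_nat t e))"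
  proof (rule finite_escape_aux[OF dS])
    show "?S e = ?S e'" if "\<And>i. i \<le> N \<Longrightarrow> e i = e' i" for e e'
      by (rule N) (rule that, simp)
    show "\<not> thick (\<lambda>t. ?S (case_nat t e))" for e
    proof
      assume *: "thick (\<lambda>t. ?S (case_nat t e))"
      then have "thick (\<lambda>t. S (case_nat t e))" by (rule thick_mono) simp
      moreover obtain t where "?S (case_nat t e)" using thick_nonempty[OF *] by blast
      ultimately show False by simp
    qed
  qed
  then obtain T where T: "finite T" "\<And>e. \<exists>t\<in>T. \<not> ?S (case_nat t e)" by blast
  show ?thesis
  proof (intro exI[of _ T] conjI allI impI T(1))
    fix e assume "\<not> thick (\<lambda>t. S (case_nat t e))"
    then show "\<exists>t\<in>T. \<not> S (case_nat t e)" using T(2)[of e] by auto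
  qed
qed

text \<open>Kuratowski--Ulam thinness in dimension \<open>q\<close>: except for a thin set of last
  coordinates, all slices are small. Unlike empty interior, this notion is recursive, as the
  induction on \<open>q\<close> requires.\<close>

fun small :: "nat \<Rightarrow> ((nat \<Rightarrow> 'a) \<Rightarrow> bool) \<Rightarrow> (nat \<Rightarrow> 'a) \<Rightarrow> bool" where
  "small 0 S e \<longleftrightarrow> \<not> S e"
| "small (Suc q) S e \<longleftrightarrow> \<not> thick (\<lambda>t. \<not> small q S (case_nat t e))"

lemma dpred_small: "dpred M S \<Longrightarrow> dpred M (small q S)"
proof (induction q)
  case 0
  have "dpred M (\<lambda>e. \<not> S e)" by (intro dintros 0)
  then show ?case by simp
next
  case (Suc q)
  have "dpred M (\<lambda>e. \<not> thick (\<lambda>t. \<not> small q S (case_nat t e)))"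
  proof (intro dintros)
    show "dpred M (\<lambda>e. small q S (case_nat (e 0) (\<lambda>i. e (Suc i))))"
      using Suc by simp
  qed
  then show ?case by simp
qed

text \<open>\<open>finite_escape\<close>, applied to non-smallness of slices, gives finitely many
  last coordinates, one of which has a small slice; the induction hypothesis escapes inside that
  slice. Both finite sets are independent of \<open>e\<close>.\<close>

lemma finite_escape_small:
  assumes S: "dpred M S"
  shows "\<exists>T. finite T \<and> (\<forall>e. small q S e \<longrightarrow> (\<exists>a\<in>T. \<not> S (app q a e)))"
proof (induction q)
  case 0
  show ?case by (rule exI[of _ "{undefined}"]) simp
next
  case (Suc q)
  then obtain T where T: "finite T" "\<And>e. small q S e \<Longrightarrow> \<exists>a\<in>T. \<not> S (app q a e)" by blast
  have "dpred M (\<lambda>e. \<not> small q S e)" by (intro dintros dpred_small S)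
  from finite_escape[OF this] obtain T' where T': "finite T'"
    "\<And>e. \<not> thick (\<lambda>t. \<not> small q S (case_nat t e)) \<Longrightarrow> \<exists>t\<in>T'. small q S (case_nat t e)"
    by auto
  show ?case
  proof (intro exI[of _ "(\<lambda>(a, t). a(q := t)) ` (T \<times> T')"] conjI allI impI)
    show "finite ((\<lambda>(a, t). a(q := t)) ` (T \<times> T'))" using T(1) T'(1) by simp
    fix e assume "small (Suc q) S e"
    then obtain t where t: "t \<in> T'" "small q S (case_nat t e)" using T'(2)[of e] by auto
    then obtain a where a: "a \<in> T" "\<not> S (app q a (case_nat t e))" using T(2) by blast
    have "app (Suc q) (a(q := t)) e = app q a (case_nat t e)"
      unfolding app_Suc by (auto intro: app_cong)
    then show "\<exists>a\<in>(\<lambda>(a, t). a(q := t)) ` (T \<times> T'). \<not> S (app (Suc q) a e)"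
      using t(1) a by force
  qed
qed

text \<open>Iterating \<open>thick_boxes\<close> assembles a box from thickly many boxes in slices.
  Contrapositively, empty interior implies the recursive smallness.\<close>

lemma not_small_imp_box:
  assumes S: "dpred M S" and "\<not> small q S e"
  shows "\<exists>c. \<exists>\<delta>>0. \<forall>a. (\<forall>i<q. \<bar>a i - c i\<bar> < \<delta>) \<longrightarrow> S (app q a e)"
  using assms(2)
proof (induction q arbitrary: e)
  case 0
  then show ?case by (auto intro: exI[of _ 1])
next
  case (Suc q)
  then have "thick (\<lambda>t. \<not> small q S (case_nat t e))" by simp
  then show ?case by (rule thick_boxes[OF S]) (rule Suc.IH)
qed

theorem finite_escape_boxes:
  assumes S: "dpred M S"
    and "\<And>e. \<not> (\<exists>c. \<exists>\<delta>>0. \<forall>a. (\<forall>i<q. \<bar>a i - c i\<bar> < \<delta>) \<longrightarrow> S (app q a e))"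
  shows "\<exists>T. finite T \<and> (\<forall>e. \<exists>a\<in>T. \<not> S (app q a e))"
proof -
  have "small q S e" for e
    using not_small_imp_box[OF S, of q e] assms(2)[of e] by (rule_tac ccontr) simp
  then show ?thesis using finite_escape_small[OF S, of q] by auto
qed

end

section \<open>The topology of \<open>F\<^sup>n\<close>\<close>

abbreviation near :: "nat \<Rightarrow> 'a::linordered_field \<Rightarrow> (nat \<Rightarrow> 'a) \<Rightarrow> (nat \<Rightarrow> 'a) \<Rightarrow> bool" where
  "near n \<delta> x y \<equiv> \<forall>i<n. \<bar>x i - y i\<bar> < \<delta>"

lemma near_sym: "near n \<delta> x y \<Longrightarrow> near n \<delta> y x"
  by (simp add: abs_minus_commute)

lemma near_mono: "near n \<delta> x y \<Longrightarrow> \<delta> \<le> \<epsilon> \<Longrightarrow> near n \<epsilon> x y"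
  by (auto intro: less_le_trans)

lemma near_triangle: "near n \<delta> x y \<Longrightarrow> near n \<epsilon> y z \<Longrightarrow> near n (\<delta> + \<epsilon>) x z"
proof (intro allI impI)
  fix i assume "near n \<delta> x y" "near n \<epsilon> y z" "i < n"
  then have "\<bar>x i - y i\<bar> < \<delta>" "\<bar>y i - z i\<bar> < \<epsilon>" by auto
  then show "\<bar>x i - z i\<bar> < \<delta> + \<epsilon>" unfolding abs_less_iff by linarith
qed

lemma finite_choose_delta:
  fixes P :: "nat \<Rightarrow> 'a::linordered_field \<Rightarrow> bool"
  assumes "\<And>i. i < n \<Longrightarrow> \<exists>\<delta>>0. P i \<delta>"
    and "\<And>i \<delta> \<epsilon>. P i \<delta> \<Longrightarrow> 0 < \<epsilon> \<Longrightarrow> \<epsilon> \<le> \<delta> \<Longrightarrow> P i \<epsilon>"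
  shows "\<exists>\<delta>>0. \<forall>i<n. P i \<delta>"
  using assms(1)
proof (induction n)
  case 0
  show ?case by (intro exI[of _ 1]) simp
next
  case (Suc n)
  then obtain \<delta> where \<delta>: "\<delta> > 0" "\<forall>i<n. P i \<delta>" by auto
  obtain \<epsilon> where \<epsilon>: "\<epsilon> > 0" "P n \<epsilon>" using Suc.prems[of n] by auto
  show ?case
  proof (intro exI[of _ "min \<delta> \<epsilon>"] conjI allI impI)
    show pos: "0 < min \<delta> \<epsilon>" using \<delta> \<epsilon> by simp
    fix i assume i: "i < Suc n"
    show "P i (min \<delta> \<epsilon>)"
    proof (cases "i = n")
      case True
      then show ?thesis using assms(2)[OF \<epsilon>(2) pos] by simp
    next
      case False
      then have "P i \<delta>" using \<delta>(2) i by simp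
      then show ?thesis using assms(2)[OF _ pos] by simp
    qed
  qed
qed

lemma near_ball_open:
  fixes x :: "nat \<Rightarrow> 'a::linordered_field"
  assumes "near n \<delta> y x"
  obtains \<epsilon> where "\<epsilon> > 0" "\<And>z. near n \<epsilon> z y \<Longrightarrow> near n \<delta> z x"
proof -
  have "\<exists>\<epsilon>>0. \<forall>i<n. \<bar>y i - x i\<bar> + \<epsilon> \<le> \<delta>"
  proof (rule finite_choose_delta)
    show "\<exists>\<epsilon>>0. \<bar>y i - x i\<bar> + \<epsilon> \<le> \<delta>" if "i < n" for i
      using assms that by (intro exI[of _ "\<delta> - \<bar>y i - x i\<bar>"]) auto
  qed auto
  then obtain \<epsilon> where \<epsilon>: "\<epsilon> > 0" "\<And>i. i < n \<Longrightarrow> \<bar>y i - x i\<bar> + \<epsilon> \<le> \<delta>" by blast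
  have "near n \<delta> z x" if z: "near n \<epsilon> z y" for z
  proof (intro allI impI)
    fix i assume i: "i < n"
    have "\<bar>z i - y i\<bar> < \<epsilon>" using z i by blast
    then show "\<bar>z i - x i\<bar> < \<delta>" using \<epsilon>(2)[OF i] by linarith
  qed
  then show ?thesis using \<epsilon>(1) that by simp
qed

lemma openin_Fpow_iff:
  "openin (Fpow_top n) X \<longleftrightarrow> X \<subseteq> Fpow n \<and> (\<forall>x\<in>X. \<exists>\<delta>>0. \<forall>y\<in>Fpow n. near n \<delta> y x \<longrightarrow> y \<in> X)"
  for X :: "(nat \<Rightarrow> 'a::{linordered_field, linorder_topology}) set"
proof
  assume op: "openin (Fpow_top n) X"
  have "\<exists>\<delta>>0. \<forall>y\<in>Fpow n. near n \<delta> y x \<longrightarrow> y \<in> X" if x: "x \<in> X" for x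
  proof -
    from bspec[OF op[unfolded openin_product_topology_alt] x]
    obtain U where U: "\<forall>i\<in>{..<n}. openin euclidean (U i)" "x \<in> Pi\<^sub>E {..<n} U" "Pi\<^sub>E {..<n} U \<subseteq> X"
      by (elim exE conjE)
    have "\<exists>\<delta>>0. \<forall>i<n. \<forall>y. \<bar>y - x i\<bar> < \<delta> \<longrightarrow> y \<in> U i"
    proof (rule finite_choose_delta)
      show "\<exists>\<delta>>0. \<forall>y. \<bar>y - x i\<bar> < \<delta> \<longrightarrow> y \<in> U i" if i: "i < n" for i
      proof (rule open_abs_ball)
        have "openin euclidean (U i)" using U(1) i by blast
        then show "open (U i)" by simp
        show "x i \<in> U i" using PiE_mem[OF U(2)] i by simp
      qed
    qed auto
    then obtain \<delta> where \<delta>: "\<delta> > 0" "\<And>i y. i < n \<Longrightarrow> \<bar>y - x i\<bar> < \<delta> \<Longrightarrow> y \<in> U i" by blast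
    have "y \<in> X" if "y \<in> Fpow n" "near n \<delta> y x" for y
    proof -
      have "y \<in> Pi\<^sub>E {..<n} U" using that \<delta>(2) by (auto simp: PiE_def)
      then show ?thesis using U(3) by blast
    qed
    then show ?thesis using \<delta>(1) by blast
  qed
  moreover have "X \<subseteq> Fpow n" using openin_subset[OF op] by simp
  ultimately show "X \<subseteq> Fpow n \<and> (\<forall>x\<in>X. \<exists>\<delta>>0. \<forall>y\<in>Fpow n. near n \<delta> y x \<longrightarrow> y \<in> X)" by blast
next
  assume *: "X \<subseteq> Fpow n \<and> (\<forall>x\<in>X. \<exists>\<delta>>0. \<forall>y\<in>Fpow n. near n \<delta> y x \<longrightarrow> y \<in> X)"
  show "openin (Fpow_top n) X"
    unfolding openin_product_topology_alt
  proof
    fix x assume x: "x \<in> X"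
    from bspec[OF conjunct2[OF *] x]
    obtain \<delta> where \<delta>: "\<delta> > 0" "\<forall>y\<in>Fpow n. near n \<delta> y x \<longrightarrow> y \<in> X" by (elim exE conjE)
    let ?U = "\<lambda>i. {x i - \<delta><..<x i + \<delta>}"
    show "\<exists>U. finite {i \<in> {..<n}. U i \<noteq> topspace euclidean} \<and> (\<forall>i\<in>{..<n}. openin euclidean (U i))
        \<and> x \<in> Pi\<^sub>E {..<n} U \<and> Pi\<^sub>E {..<n} U \<subseteq> X"
    proof (intro exI[of _ ?U] conjI ballI)
      show "x \<in> Pi\<^sub>E {..<n} ?U" using x * \<delta>(1) by (auto simp: PiE_def)
      show "Pi\<^sub>E {..<n} ?U \<subseteq> X"
      proof
        fix y assume y: "y \<in> Pi\<^sub>E {..<n} ?U"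
        show "y \<in> X"
        proof (rule \<delta>(2)[THEN bspec, THEN mp])
          show "y \<in> Fpow n" using y by (auto simp: PiE_def)
          show "near n \<delta> y x"
          proof (intro allI impI)
            fix i assume "i < n"
            then have "y i \<in> ?U i" using y by (auto simp: PiE_def Pi_def)
            then show "\<bar>y i - x i\<bar> < \<delta>" by (auto simp: abs_less_iff)
          qed
        qed
      qed
      show "finite {i \<in> {..<n}. ?U i \<noteq> topspace euclidean}" by simp
      show "openin euclidean (?U i)" for i by simp
    qed
  qed
qed

lemma openin_sub_Fpow_iff:
  fixes X :: "(nat \<Rightarrow> 'a::{linordered_field, linorder_topology}) set"
  assumes "X \<subseteq> Fpow n"
  shows "openin (subtopology (Fpow_top n) X) U \<longleftrightarrow>
    U \<subseteq> X \<and> (\<forall>x\<in>U. \<exists>\<delta>>0. \<forall>y\<in>X. near n \<delta> y x \<longrightarrow> y \<in> U)"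
proof
  assume "openin (subtopology (Fpow_top n) X) U"
  then obtain V where V: "openin (Fpow_top n) V" "U = V \<inter> X" by (auto simp: openin_subtopology)
  show "U \<subseteq> X \<and> (\<forall>x\<in>U. \<exists>\<delta>>0. \<forall>y\<in>X. near n \<delta> y x \<longrightarrow> y \<in> U)"
  proof (intro conjI ballI)
    show "U \<subseteq> X" using V by auto
    fix x assume "x \<in> U"
    then obtain \<delta> where "\<delta> > 0" "\<forall>y\<in>Fpow n. near n \<delta> y x \<longrightarrow> y \<in> V"
      using V unfolding openin_Fpow_iff by blast
    then show "\<exists>\<delta>>0. \<forall>y\<in>X. near n \<delta> y x \<longrightarrow> y \<in> U" using V(2) assms by blast
  qed
next
  assume *: "U \<subseteq> X \<and> (\<forall>x\<in>U. \<exists>\<delta>>0. \<forall>y\<in>X. near n \<delta> y x \<longrightarrow> y \<in> U)"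
  \<comment> \<open>The union of all balls about points of \<open>U\<close> whose trace on
    \<open>X\<close> stays in \<open>U\<close>.\<close>
  let ?V = "{y \<in> Fpow n. \<exists>x\<in>U. \<exists>\<delta>. near n \<delta> y x \<and> (\<forall>y\<in>X. near n \<delta> y x \<longrightarrow> y \<in> U)}"
  have "openin (Fpow_top n) ?V"
    unfolding openin_Fpow_iff
  proof (intro conjI ballI)
    fix y assume "y \<in> ?V"
    then obtain x \<delta> where x: "x \<in> U" "near n \<delta> y x" "\<forall>y\<in>X. near n \<delta> y x \<longrightarrow> y \<in> U" by blast
    obtain \<epsilon> where \<epsilon>: "\<epsilon> > 0" "\<And>z. near n \<epsilon> z y \<Longrightarrow> near n \<delta> z x"
      by (rule near_ball_open[OF x(2)]) (rule that)
    then show "\<exists>\<epsilon>>0. \<forall>z\<in>Fpow n. near n \<epsilon> z y \<longrightarrow> z \<in> ?V" using \<epsilon> x by blast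
  qed auto
  moreover have "U = ?V \<inter> X"
  proof
    show "U \<subseteq> ?V \<inter> X"
    proof
      fix x assume x: "x \<in> U"
      then obtain \<delta> where "\<delta> > 0" "\<forall>y\<in>X. near n \<delta> y x \<longrightarrow> y \<in> U" using * by blast
      moreover have "near n \<delta> x x" using \<open>\<delta> > 0\<close> by simp
      ultimately show "x \<in> ?V \<inter> X" using x * assms by blast
    qed
  qed blast
  ultimately show "openin (subtopology (Fpow_top n) X) U"
    unfolding openin_subtopology by blast
qed

lemma closedin_sub_Fpow_iff:
  fixes X :: "(nat \<Rightarrow> 'a::{linordered_field, linorder_topology}) set"
  assumes "X \<subseteq> Fpow n"
  shows "closedin (subtopology (Fpow_top n) X) C \<longleftrightarrow>
    C \<subseteq> X \<and> (\<forall>x\<in>X. (\<forall>\<delta>>0. \<exists>y\<in>C. near n \<delta> y x) \<longrightarrow> x \<in> C)"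
proof -
  have "topspace (subtopology (Fpow_top n) X) = X" using assms by auto
  then have "closedin (subtopology (Fpow_top n) X) C \<longleftrightarrow> C \<subseteq> X \<and> openin (subtopology (Fpow_top n) X) (X - C)"
    by (simp add: closedin_def)
  also have "\<dots> \<longleftrightarrow> C \<subseteq> X \<and> (\<forall>x\<in>X. (\<forall>\<delta>>0. \<exists>y\<in>C. near n \<delta> y x) \<longrightarrow> x \<in> C)"
    unfolding openin_sub_Fpow_iff[OF assms] by blast
  finally show ?thesis .
qed

lemma closedin_Fpow_iff:
  "closedin (Fpow_top n) C \<longleftrightarrow>
    C \<subseteq> Fpow n \<and> (\<forall>x\<in>Fpow n. (\<forall>\<delta>>0. \<exists>y\<in>C. near n \<delta> y x) \<longrightarrow> x \<in> C)"
  for C :: "(nat \<Rightarrow> 'a::{linordered_field, linorder_topology}) set"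
proof -
  have "subtopology (Fpow_top n) (Fpow n) = (Fpow_top n :: (nat \<Rightarrow> 'a) topology)"
    by (rule subtopology_superset) simp
  then show ?thesis using closedin_sub_Fpow_iff[of "Fpow n" n C] by simp
qed

lemma continuous_map_Fpow_iff:
  fixes X Y :: "(nat \<Rightarrow> 'a::{linordered_field, linorder_topology}) set"
  assumes "X \<subseteq> Fpow n" "Y \<subseteq> Fpow m"
  shows "continuous_map (subtopology (Fpow_top n) X) (subtopology (Fpow_top m) Y) f \<longleftrightarrow>
    f \<in> X \<rightarrow> Y \<and> (\<forall>x\<in>X. \<forall>\<epsilon>>0. \<exists>\<delta>>0. \<forall>x'\<in>X. near n \<delta> x' x \<longrightarrow> near m \<epsilon> (f x') (f x))"
proof -
  have top: "topspace (subtopology (Fpow_top n) X) = X" "topspace (subtopology (Fpow_top m) Y) = Y"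
    using assms by auto
  show ?thesis
  proof
    assume cont: "continuous_map (subtopology (Fpow_top n) X) (subtopology (Fpow_top m) Y) f"
    then have f: "f \<in> X \<rightarrow> Y" using continuous_map_funspace top by metis
    have "\<exists>\<delta>>0. \<forall>x'\<in>X. near n \<delta> x' x \<longrightarrow> near m \<epsilon> (f x') (f x)" if x: "x \<in> X" and \<epsilon>: "\<epsilon> > 0" for x \<epsilon>
    proof -
      let ?V = "{y \<in> Y. near m \<epsilon> y (f x)}"
      have "openin (subtopology (Fpow_top m) Y) ?V"
        unfolding openin_sub_Fpow_iff[OF assms(2)]
      proof (intro conjI ballI)
        fix y assume y: "y \<in> ?V"
        then have "near m \<epsilon> y (f x)" by simp
        then obtain \<delta> where "\<delta> > 0" "\<And>z. near m \<delta> z y \<Longrightarrow> near m \<epsilon> z (f x)"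
          by (rule near_ball_open) (rule that)
        then show "\<exists>\<delta>>0. \<forall>z\<in>Y. near m \<delta> z y \<longrightarrow> z \<in> ?V" by blast
      qed auto
      from openin_continuous_map_preimage[OF cont this]
      have "openin (subtopology (Fpow_top n) X) {x' \<in> X. f x' \<in> ?V}" unfolding top .
      moreover have "x \<in> {x' \<in> X. f x' \<in> ?V}" using x f \<epsilon> by auto
      ultimately obtain \<delta> where "\<delta> > 0" "\<forall>x'\<in>X. near n \<delta> x' x \<longrightarrow> x' \<in> {x' \<in> X. f x' \<in> ?V}"
        unfolding openin_sub_Fpow_iff[OF assms(1)] by blast
      then show ?thesis by blast
    qed
    then show "f \<in> X \<rightarrow> Y \<and> (\<forall>x\<in>X. \<forall>\<epsilon>>0. \<exists>\<delta>>0. \<forall>x'\<in>X. near n \<delta> x' x \<longrightarrow> near m \<epsilon> (f x') (f x))"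
      using f by blast
  next
    assume *: "f \<in> X \<rightarrow> Y \<and> (\<forall>x\<in>X. \<forall>\<epsilon>>0. \<exists>\<delta>>0. \<forall>x'\<in>X. near n \<delta> x' x \<longrightarrow> near m \<epsilon> (f x') (f x))"
    show "continuous_map (subtopology (Fpow_top n) X) (subtopology (Fpow_top m) Y) f"
      unfolding continuous_map_def top
    proof (intro conjI allI impI)
      show "f \<in> X \<rightarrow> Y" using * by blast
      fix V assume "openin (subtopology (Fpow_top m) Y) V"
      then have V: "V \<subseteq> Y" "\<forall>y\<in>V. \<exists>\<delta>>0. \<forall>z\<in>Y. near m \<delta> z y \<longrightarrow> z \<in> V"
        unfolding openin_sub_Fpow_iff[OF assms(2)] by blast+
      show "openin (subtopology (Fpow_top n) X) {x \<in> X. f x \<in> V}"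
        unfolding openin_sub_Fpow_iff[OF assms(1)]
      proof (intro conjI ballI)
        fix x assume x: "x \<in> {x \<in> X. f x \<in> V}"
        then have "x \<in> X" "f x \<in> V" by auto
        from bspec[OF V(2) this(2)] obtain \<epsilon> where \<epsilon>: "\<epsilon> > 0" "\<forall>z\<in>Y. near m \<epsilon> z (f x) \<longrightarrow> z \<in> V"
          by (elim exE conjE)
        from bspec[OF conjunct2[OF *] \<open>x \<in> X\<close>, THEN spec, THEN mp, OF \<epsilon>(1)]
        obtain \<delta> where \<delta>: "\<delta> > 0" "\<forall>x'\<in>X. near n \<delta> x' x \<longrightarrow> near m \<epsilon> (f x') (f x)"
          by (elim exE conjE)
        show "\<exists>\<delta>>0. \<forall>x'\<in>X. near n \<delta> x' x \<longrightarrow> x' \<in> {x \<in> X. f x \<in> V}"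
        proof (intro exI[of _ \<delta>] conjI ballI impI CollectI \<delta>(1))
          fix x' assume x': "x' \<in> X" "near n \<delta> x' x"
          then show "x' \<in> X" by blast
          have "f x' \<in> Y" using conjunct1[OF *] x'(1) by (rule funcset_mem)
          then show "f x' \<in> V"
            using \<epsilon>(2)[THEN bspec, THEN mp] \<delta>(2)[THEN bspec, THEN mp, OF x'] by blast
        qed
      qed (rule Collect_restrict)
    qed
  qed
qed

locale locally_closed_set = d_minimal_expansion M
  for M :: "('f, 'r, 'a::{linordered_field, linorder_topology}) expansion" +
  fixes n :: nat and X :: "(nat \<Rightarrow> 'a) set"
  assumes definable_X: "definable M n X" and locally_closed_X: "locally_closed n X"
begin

section \<open>A closed embedding of a locally closed set\<close>

lemma X_Fpow: "x \<in> X \<Longrightarrow> x \<in> Fpow n"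
  using definable_subset[OF definable_X] by blast

text \<open>The closure of \<open>X\<close> minus \<open>X\<close>; local closedness means that no
  point of \<open>X\<close> is a limit of such points.\<close>

definition frontier_pt :: "(nat \<Rightarrow> 'a) \<Rightarrow> bool" where
  "frontier_pt z \<longleftrightarrow> z \<in> Fpow n \<and> z \<notin> X \<and> (\<forall>\<delta>>0. \<exists>x\<in>X. near n \<delta> x z)"

text \<open>The cap \<open>r \<le> 1\<close> keeps the supremum of the clear radii finite when there
  is no frontier.\<close>

definition clear :: "(nat \<Rightarrow> 'a) \<Rightarrow> 'a \<Rightarrow> bool" where
  "clear x r \<longleftrightarrow> 0 < r \<and> r \<le> 1 \<and> (\<forall>z\<in>Fpow n. frontier_pt z \<longrightarrow> \<not> near n r z x)"

text \<open>The supremum is given by its graph, as a formula to which the definability rules apply;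
  the second case makes it total.\<close>

definition rho_spec :: "(nat \<Rightarrow> 'a) \<Rightarrow> 'a \<Rightarrow> bool" where
  "rho_spec x s \<longleftrightarrow> (\<exists>r. clear x r) \<and> (\<forall>r. clear x r \<longrightarrow> r \<le> s) \<and> (\<forall>b. (\<forall>r. clear x r \<longrightarrow> r \<le> b) \<longrightarrow> s \<le> b)
    \<or> \<not> (\<exists>r. clear x r) \<and> s = 0"

text \<open>The sup-norm distance to the frontier, truncated at \<open>1\<close> (and \<open>0\<close> on the frontier itself).\<close>

definition rho :: "(nat \<Rightarrow> 'a) \<Rightarrow> 'a" where
  "rho x = (THE s. rho_spec x s)"

lemma clear_cong: "(\<And>i. i < n \<Longrightarrow> x i = y i) \<Longrightarrow> clear x r = clear y r"
  unfolding clear_def by simp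

lemma dpred_clear:
  assumes "\<And>i. i < n \<Longrightarrow> dfun M (\<lambda>e. f e i)" "dfun M g"
  shows "dpred M (\<lambda>e. clear (f e) (g e))"
proof -
  have "dpred M (\<lambda>e. clear (\<lambda>i. e (Suc i)) (e 0))"
    unfolding clear_def frontier_pt_def
    by (intro dintros dpred_bex_definable[OF definable_X] dpred_mem[OF definable_X]) (simp_all add: dpred_const)
  then have "dpred M (\<lambda>e. clear (\<lambda>i. case_nat (g e) (f e) (Suc i)) (case_nat (g e) (f e) 0))"
  proof (rule dpred_subst_point[where n = "Suc n" and f = "\<lambda>e. case_nat (g e) (f e)"])
    show "clear (\<lambda>i. e (Suc i)) (e 0) = clear (\<lambda>i. e' (Suc i)) (e' 0)" if "\<And>i. i < Suc n \<Longrightarrow> e i = e' i" for e e'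
    proof -
      have "e 0 = e' 0" by (rule that) simp
      moreover have "clear (\<lambda>i. e (Suc i)) (e' 0) = clear (\<lambda>i. e' (Suc i)) (e' 0)"
        by (rule clear_cong) (rule that, simp)
      ultimately show ?thesis by simp
    qed
    show "dfun M (\<lambda>e. case_nat (g e) (f e) i)" if "i < Suc n" for i
      using that assms by (cases i) auto
  qed
  then show ?thesis by simp
qed

lemma rho_spec_iff: "rho_spec x s \<longleftrightarrow> s = rho x"
proof -
  have ex: "\<exists>s. rho_spec x s"
  proof (cases "\<exists>r. clear x r")
    case True
    then obtain r where r: "clear x r" by blast
    have "dpred M (\<lambda>e. clear x (e 0))" by (intro dpred_clear dintros)
    from definable_sup[where P = "clear x", OF this r, of 1]
    obtain s where "\<forall>r. clear x r \<longrightarrow> r \<le> s" "\<forall>b. (\<forall>r. clear x r \<longrightarrow> r \<le> b) \<longrightarrow> s \<le> b"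
      unfolding clear_def by blast
    then show ?thesis unfolding rho_spec_def using True by blast
  next
    case False
    then show ?thesis unfolding rho_spec_def by blast
  qed
  have uniq: "s = t" if "rho_spec x s" "rho_spec x t" for s t
    using that unfolding rho_spec_def by (metis order_antisym)
  have "rho_spec x (rho x)"
    unfolding rho_def using ex uniq by (metis theI)
  then show ?thesis using uniq by blast
qed

lemma rho_cong: "(\<And>i. i < n \<Longrightarrow> x i = y i) \<Longrightarrow> rho x = rho y"
proof -
  assume "\<And>i. i < n \<Longrightarrow> x i = y i"
  then have "clear x = clear y" by (intro ext clear_cong)
  then show ?thesis unfolding rho_def rho_spec_def by simp
qed

lemma dfun_rho [dintros]:
  assumes "\<And>i. i < n \<Longrightarrow> dfun M (\<lambda>e. f e i)"
  shows "dfun M (\<lambda>e. rho (f e))"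
proof -
  have "dpred M (\<lambda>e. rho_spec (\<lambda>i. e (Suc i)) (e 0))"
    unfolding rho_spec_def by (intro dintros dpred_clear)
  then have "dfun M rho"
    unfolding rho_spec_iff by (rule dfunI)
  then show ?thesis
    by (rule dfun_subst_point[where n = n]) (rule rho_cong, assumption, rule assms)
qed

text \<open>Local closedness enters here: frontier points lie in the closed set \<open>C\<close>,
  hence not in the open set \<open>U\<close>, and a ball inside \<open>U\<close> is clear after
  capping its radius.\<close>

lemma clear_ex: "x \<in> X \<Longrightarrow> \<exists>r. clear x r"
proof -
  assume x: "x \<in> X"
  obtain U C where UC: "openin (Fpow_top n) U" "closedin (Fpow_top n) C" "X = U \<inter> C"
    using locally_closed_X unfolding locally_closed_def by blast
  have "x \<in> U" using x UC(3) by blast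
  from bspec[OF conjunct2[OF UC(1)[unfolded openin_Fpow_iff]] this]
  obtain \<delta> where \<delta>: "\<delta> > 0" "\<forall>y\<in>Fpow n. near n \<delta> y x \<longrightarrow> y \<in> U" by (elim exE conjE)
  have "\<not> near n (min \<delta> 1) z x" if z: "z \<in> Fpow n" "frontier_pt z" for z
  proof
    assume "near n (min \<delta> 1) z x"
    then have "near n \<delta> z x" by simp
    then have "z \<in> U" using \<delta>(2) z(1) by blast
    moreover have "\<forall>\<delta>>0. \<exists>y\<in>C. near n \<delta> y z"
      using z(2) UC(3) unfolding frontier_pt_def by blast
    then have "z \<in> C"
      using conjunct2[OF UC(2)[unfolded closedin_Fpow_iff], THEN bspec, OF z(1)] by blast
    ultimately show False using z(2) UC(3) unfolding frontier_pt_def by blast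
  qed
  then have "clear x (min \<delta> 1)" using \<delta>(1) unfolding clear_def by simp
  then show ?thesis by blast
qed

lemma clear_le_rho: "clear x r \<Longrightarrow> r \<le> rho x"
  using rho_spec_iff[of x "rho x"] unfolding rho_spec_def by blast

lemma rho_pos: "x \<in> X \<Longrightarrow> 0 < rho x"
proof -
  assume "x \<in> X"
  then obtain r where r: "clear x r" using clear_ex by blast
  then have "0 < r" unfolding clear_def by blast
  then show ?thesis using clear_le_rho[OF r] by simp
qed

lemma clear_less_rho:
  assumes "x \<in> X" "0 < r" "r < rho x"
  shows "clear x r"
proof -
  have "\<forall>b. (\<forall>r. clear x r \<longrightarrow> r \<le> b) \<longrightarrow> rho x \<le> b"
    using rho_spec_iff[of x "rho x"] clear_ex[OF assms(1)] unfolding rho_spec_def by blast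
  then obtain s where s: "clear x s" "r < s" using assms(3) not_le by blast
  have "r \<le> 1" using s unfolding clear_def by simp
  moreover have "\<not> near n r z x" if "z \<in> Fpow n" "frontier_pt z" for z
  proof
    assume "near n r z x"
    then have "near n s z x" by (rule near_mono) (use s(2) in simp)
    then show False using s(1) that unfolding clear_def by blast
  qed
  ultimately show ?thesis using assms(2) unfolding clear_def by blast
qed

text \<open>The ball of radius \<open>r\<close> about \<open>y\<close> lies in the ball of radius
  \<open>r + \<eta>\<close> about \<open>x\<close>, so a radius clear for \<open>x\<close> loses at
  most \<open>\<eta>\<close>.\<close>

lemma rho_lipschitz:
  assumes "x \<in> X" "y \<in> X" "near n \<eta> x y" "0 < \<eta>"
  shows "rho x - \<eta> \<le> rho y"
proof (rule ccontr)
  assume "\<not> ?thesis"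
  then have *: "rho y < rho x - \<eta>" by simp
  obtain r where r: "rho y < r" "r < rho x - \<eta>" using dense[OF *] by blast
  have "0 < r" using r(1) rho_pos[OF assms(2)] by simp
  have "clear x (r + \<eta>)"
    using r \<open>0 < r\<close> assms by (intro clear_less_rho) auto
  then have cl: "\<not> near n (r + \<eta>) z x" if "z \<in> Fpow n" "frontier_pt z" for z
    using that unfolding clear_def by blast
  have "\<not> near n r z y" if "z \<in> Fpow n" "frontier_pt z" for z
    using near_triangle[where x = z and \<delta> = r, OF _ near_sym[OF assms(3)]] cl[OF that] by blast
  moreover have "r \<le> 1" using \<open>clear x (r + \<eta>)\<close> assms(4) unfolding clear_def by simp
  ultimately have "clear y r" using \<open>0 < r\<close> unfolding clear_def by blast
  then show False using clear_le_rho r(1) by fastforce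
qed

text \<open>The extra coordinate \<open>1 / rho\<close> sends the frontier to infinity, which makes
  the image of \<open>X\<close> closed.\<close>

definition psi :: "(nat \<Rightarrow> 'a) \<Rightarrow> nat \<Rightarrow> 'a" where
  "psi y i = (if i < n then y i else inverse (rho y))"

text \<open>Squaring avoids roots and preserves minimizers. The Euclidean form, unlike the sup norm
  behind \<open>near\<close>, has the strict convexity that \<open>mdist_eq_imp_E\<close>
  exploits.\<close>

definition dist2 :: "(nat \<Rightarrow> 'a) \<Rightarrow> (nat \<Rightarrow> 'a) \<Rightarrow> 'a" where
  "dist2 a y = (\<Sum>i<Suc n. (a i - psi y i)\<^sup>2)"

lemma dfun_dist2 [dintros]:
  assumes "\<And>i. i < Suc n \<Longrightarrow> dfun M (\<lambda>e. a e i)" "\<And>i. i < n \<Longrightarrow> dfun M (\<lambda>e. f e i)"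
  shows "dfun M (\<lambda>e. dist2 (a e) (f e))"
proof -
  have "dfun M (\<lambda>e. psi (f e) i)" for i
    unfolding psi_def by (cases "i < n") (auto intro!: dintros assms(2))
  then show ?thesis
    unfolding dist2_def by (intro dintros assms(1)) auto
qed

lemma dist2_nonneg: "0 \<le> dist2 a y"
  unfolding dist2_def by (simp add: sum_nonneg)

lemma inverse_rho_continuous:
  assumes y: "y \<in> X" and "0 < \<epsilon>"
  shows "\<exists>\<delta>>0. \<forall>z\<in>X. near n \<delta> z y \<longrightarrow> \<bar>inverse (rho z) - inverse (rho y)\<bar> < \<epsilon>"
proof -
  let ?r = "rho y"
  have r: "0 < ?r" by (rule rho_pos[OF y])
  \<comment> \<open>With \<open>\<delta> \<le> ?r / 2\<close> one has
    \<open>rho z \<ge> ?r / 2\<close>, so the reciprocals differ by at most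
    \<open>2 * \<delta> / (?r * ?r)\<close>, hence by at most \<open>\<epsilon> / 2\<close>.\<close>
  define \<delta> where "\<delta> = min (?r / 2) (\<epsilon> * ?r * ?r / 4)"
  have \<delta>: "0 < \<delta>" "\<delta> \<le> ?r / 2" "\<delta> \<le> \<epsilon> * ?r * ?r / 4"
    using r \<open>0 < \<epsilon>\<close> unfolding \<delta>_def by (simp, intro min.cobounded1, intro min.cobounded2)
  have "\<bar>inverse (rho z) - inverse ?r\<bar> < \<epsilon>" if z: "z \<in> X" "near n \<delta> z y" for z
  proof -
    have s: "0 < rho z" by (rule rho_pos[OF z(1)])
    have "rho z - \<delta> \<le> ?r" by (rule rho_lipschitz[OF z(1) y z(2) \<delta>(1)])
    moreover have lo: "?r - \<delta> \<le> rho z" by (rule rho_lipschitz[OF y z(1) near_sym[OF z(2)] \<delta>(1)])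
    ultimately have "\<bar>?r - rho z\<bar> \<le> \<delta>" unfolding abs_le_iff by linarith
    have half: "?r / 2 \<le> rho z" using lo \<delta>(2) by linarith
    have "inverse (rho z) - inverse ?r = (?r - rho z) / (rho z * ?r)"
      using r s by (simp add: field_simps)
    then have "\<bar>inverse (rho z) - inverse ?r\<bar> = \<bar>?r - rho z\<bar> / (rho z * ?r)"
      using r s by (simp add: abs_divide abs_mult)
    also have "\<dots> \<le> \<delta> / (?r / 2 * ?r)"
      using \<open>\<bar>?r - rho z\<bar> \<le> \<delta>\<close> half r by (intro frac_le mult_right_mono) auto
    also have "\<dots> \<le> (\<epsilon> * ?r * ?r / 4) / (?r / 2 * ?r)"
      using \<delta>(3) r by (intro divide_right_mono) auto
    also have "\<dots> = \<epsilon> / 2" using r by (simp add: field_simps)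
    also have "\<dots> < \<epsilon>" using \<open>0 < \<epsilon>\<close> by simp
    finally show ?thesis .
  qed
  then show ?thesis using \<delta>(1) by blast
qed

lemma psi_continuous:
  assumes y: "y \<in> X" and "0 < \<epsilon>"
  shows "\<exists>\<delta>>0. \<forall>z\<in>X. near n \<delta> z y \<longrightarrow> near (Suc n) \<epsilon> (psi z) (psi y)"
proof -
  obtain \<delta> where \<delta>: "\<delta> > 0" "\<forall>z\<in>X. near n \<delta> z y \<longrightarrow> \<bar>inverse (rho z) - inverse (rho y)\<bar> < \<epsilon>"
    using inverse_rho_continuous[OF assms] by blast
  have "near (Suc n) \<epsilon> (psi z) (psi y)" if z: "z \<in> X" "near n (min \<delta> \<epsilon>) z y" for z
  proof -
    have "near n \<delta> z y" "near n \<epsilon> z y" using z(2) by auto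
    then show ?thesis using \<delta>(2) z(1) by (auto simp: psi_def less_Suc_eq)
  qed
  then show ?thesis using \<delta>(1) assms(2) by (intro exI[of _ "min \<delta> \<epsilon>"]) auto
qed

lemma dist2_continuous:
  assumes y: "y \<in> X" and "0 < \<epsilon>"
  shows "\<exists>\<delta>>0. \<forall>z\<in>X. near n \<delta> z y \<longrightarrow> \<bar>dist2 a z - dist2 a y\<bar> < \<epsilon>"
proof -
  \<comment> \<open>A change of at most \<open>\<eta> \<le> 1\<close> in \<open>psi y i\<close>
    changes the square by at most \<open>\<eta> * (2 * \<bar>a i - psi y i\<bar> + 1)\<close>.
    Dividing by \<open>K + 1\<close> instead of \<open>K\<close> below makes the final estimate
    strict.\<close>
  define K where "K = (\<Sum>i<Suc n. 2 * \<bar>a i - psi y i\<bar> + 1)"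
  have K: "0 \<le> K" unfolding K_def by (intro sum_nonneg) auto
  define \<eta> where "\<eta> = min 1 (\<epsilon> / (K + 1))"
  have K1: "0 < K + 1" using K by (simp add: add_nonneg_pos)
  then have "0 < \<epsilon> / (K + 1)" using \<open>0 < \<epsilon>\<close> by (rule divide_pos_pos[rotated])
  then have \<eta>: "0 < \<eta>" "\<eta> \<le> 1" "\<eta> \<le> \<epsilon> / (K + 1)"
    unfolding \<eta>_def by simp_all
  obtain \<delta> where \<delta>: "\<delta> > 0" "\<forall>z\<in>X. near n \<delta> z y \<longrightarrow> near (Suc n) \<eta> (psi z) (psi y)"
    using psi_continuous[OF y \<eta>(1)] by blast
  have "\<bar>dist2 a z - dist2 a y\<bar> < \<epsilon>" if z: "z \<in> X" "near n \<delta> z y" for z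
  proof -
    have "\<bar>(a i - psi z i)\<^sup>2 - (a i - psi y i)\<^sup>2\<bar> \<le> \<eta> * (2 * \<bar>a i - psi y i\<bar> + 1)" if "i < Suc n" for i
    proof -
      have h: "\<bar>psi z i - psi y i\<bar> \<le> \<eta>" using \<delta>(2) z that by (simp add: less_imp_le)
      have "(a i - psi z i)\<^sup>2 - (a i - psi y i)\<^sup>2
          = (psi z i - psi y i) * ((psi z i - psi y i) - 2 * (a i - psi y i))"
        by (simp add: power2_eq_square algebra_simps)
      then have "\<bar>(a i - psi z i)\<^sup>2 - (a i - psi y i)\<^sup>2\<bar>
          = \<bar>psi z i - psi y i\<bar> * \<bar>(psi z i - psi y i) - 2 * (a i - psi y i)\<bar>"
        by (simp add: abs_mult)
      also have "\<dots> \<le> \<eta> * (2 * \<bar>a i - psi y i\<bar> + 1)"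
      proof (intro mult_mono)
        have "\<bar>(psi z i - psi y i) - 2 * (a i - psi y i)\<bar> \<le> \<bar>psi z i - psi y i\<bar> + \<bar>2 * (a i - psi y i)\<bar>"
          by (rule abs_triangle_ineq4)
        also have "\<bar>2 * (a i - psi y i)\<bar> = 2 * \<bar>a i - psi y i\<bar>" by (simp only: abs_mult abs_numeral)
        finally show "\<bar>(psi z i - psi y i) - 2 * (a i - psi y i)\<bar> \<le> 2 * \<bar>a i - psi y i\<bar> + 1"
          using h \<eta>(2) by linarith
      qed (use h \<eta> in auto)
      finally show ?thesis .
    qed
    then have "(\<Sum>i<Suc n. \<bar>(a i - psi z i)\<^sup>2 - (a i - psi y i)\<^sup>2\<bar>) \<le> (\<Sum>i<Suc n. \<eta> * (2 * \<bar>a i - psi y i\<bar> + 1))"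
      by (intro sum_mono) auto
    also have "\<dots> = \<eta> * K" unfolding K_def by (rule sum_distrib_left[symmetric])
    finally have le: "(\<Sum>i<Suc n. \<bar>(a i - psi z i)\<^sup>2 - (a i - psi y i)\<^sup>2\<bar>) \<le> \<eta> * K" .
    have "\<bar>dist2 a z - dist2 a y\<bar> = \<bar>\<Sum>i<Suc n. (a i - psi z i)\<^sup>2 - (a i - psi y i)\<^sup>2\<bar>"
      unfolding dist2_def by (simp only: sum_subtractf)
    also have "\<dots> \<le> (\<Sum>i<Suc n. \<bar>(a i - psi z i)\<^sup>2 - (a i - psi y i)\<^sup>2\<bar>)" by (rule sum_abs)
    also note le
    also have "\<eta> * K < \<eta> * (K + 1)" using \<eta>(1) by simp
    also have "\<dots> \<le> \<epsilon>" using \<eta>(3) unfolding pos_le_divide_eq[OF K1] .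
    finally show ?thesis .
  qed
  then show ?thesis using \<delta>(1) by blast
qed

lemma sublevel_bounded:
  obtains B where "0 < B" "\<And>y. dist2 a y \<le> r \<Longrightarrow> inverse (rho y) \<le> B"
    "\<And>y i. dist2 a y \<le> r \<Longrightarrow> i < n \<Longrightarrow> - B \<le> y i \<and> y i \<le> B"
proof -
  define A where "A = Max ((\<lambda>i. \<bar>a i\<bar>) ` {..<Suc n})"
  have A: "\<bar>a i\<bar> \<le> A" if "i < Suc n" for i unfolding A_def using that by (intro Max_ge) auto
  have psi: "\<bar>psi y i\<bar> \<le> A + \<bar>r\<bar> + 1" if y: "dist2 a y \<le> r" and i: "i < Suc n" for y i
  proof -
    have "(a i - psi y i)\<^sup>2 \<le> dist2 a y"
      unfolding dist2_def using i by (intro member_le_sum) auto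
    then have sq: "(a i - psi y i)\<^sup>2 \<le> \<bar>r\<bar>" using y by simp
    \<comment> \<open>\<open>\<bar>r\<bar> + 1\<close> replaces the square root of
      \<open>\<bar>r\<bar>\<close>, since its square exceeds \<open>\<bar>r\<bar>\<close>.\<close>
    have "\<bar>a i - psi y i\<bar> \<le> \<bar>r\<bar> + 1"
    proof (rule ccontr)
      assume "\<not> ?thesis"
      then have gt: "\<bar>r\<bar> + 1 < \<bar>a i - psi y i\<bar>" by simp
      have "\<bar>r\<bar> < (\<bar>r\<bar> + 1) * (\<bar>r\<bar> + 1)" by (simp add: algebra_simps add_pos_nonneg)
      also have "\<dots> \<le> \<bar>a i - psi y i\<bar> * \<bar>a i - psi y i\<bar>" using gt by (intro mult_mono) auto
      also have "\<dots> = (a i - psi y i)\<^sup>2" by (simp add: power2_eq_square)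
      finally show False using sq by simp
    qed
    moreover have "\<bar>a i\<bar> \<le> A" using A[OF i] .
    ultimately show ?thesis unfolding abs_le_iff by linarith
  qed
  have "0 \<le> A" using A[of 0] by (meson abs_ge_zero order_trans zero_less_Suc)
  show ?thesis
  proof (rule that[of "A + \<bar>r\<bar> + 1"])
    show "0 < A + \<bar>r\<bar> + 1" using \<open>0 \<le> A\<close> by (simp add: add_nonneg_pos)
    show "inverse (rho y) \<le> A + \<bar>r\<bar> + 1" if "dist2 a y \<le> r" for y
      using psi[OF that, of n] unfolding psi_def abs_le_iff by simp
    show "- (A + \<bar>r\<bar> + 1) \<le> y i \<and> y i \<le> A + \<bar>r\<bar> + 1" if "dist2 a y \<le> r" "i < n" for y i
      using psi[OF that(1), of i] that(2) unfolding psi_def abs_le_iff by simp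
  qed
qed

text \<open>This is properness of \<open>psi\<close>: a limit on the frontier is excluded because \<open>1 / rho\<close> is bounded.\<close>

lemma sublevel_cluster_point:
  assumes L: "dpred M (\<lambda>e. restrict (\<lambda>i. e (Suc i)) {..<n} \<in> L (e 0))"
    and sub: "\<And>d. L d \<subseteq> {y \<in> X. dist2 a y \<le> r}"
    and ne: "\<And>d. 0 < d \<Longrightarrow> L d \<noteq> {}"
    and mono: "\<And>d d'. 0 < d \<Longrightarrow> d \<le> d' \<Longrightarrow> L d \<subseteq> L d'"
  obtains c where "c \<in> X" "\<And>d. 0 < d \<Longrightarrow> \<exists>y\<in>L d. near n d y c"
proof -
  obtain B where B: "0 < B" "\<And>y. dist2 a y \<le> r \<Longrightarrow> inverse (rho y) \<le> B"
    "\<And>y i. dist2 a y \<le> r \<Longrightarrow> i < n \<Longrightarrow> - B \<le> y i \<and> y i \<le> B"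
    by (rule sublevel_bounded[of a r]) blast
  have "L d \<subseteq> Fpow n" for d using sub X_Fpow by blast
  then obtain c where c: "c \<in> Fpow n" "\<And>d. 0 < d \<Longrightarrow> \<exists>y\<in>L d. near n d y c"
  proof (rule cluster_point[OF L _ ne mono])
    show "- B \<le> y i \<and> y i \<le> B" if "y \<in> L d" "i < n" for d y i
      using B(3) sub that by blast
  qed blast+
  have "c \<in> X"
  proof (rule ccontr)
    assume "c \<notin> X"
    then have fr: "frontier_pt c"
      unfolding frontier_pt_def using c sub by blast
    \<comment> \<open>Half of \<open>1 / B\<close>, which bounds \<open>rho\<close> from below at
      the points of \<open>X\<close> in the sublevel set; balls of this radius about them contain no
      frontier point.\<close>
    define d where "d = inverse (2 * B)"
    have d: "0 < d" using B(1) by (simp add: d_def)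
    obtain y where y: "y \<in> X" "dist2 a y \<le> r" "near n d y c" using c(2)[OF d] sub by blast
    have "inverse (rho y) < 2 * B" using B(1) B(2)[OF y(2)] by simp
    then have "d < rho y"
      using rho_pos[OF y(1)] B(1) unfolding d_def by (simp add: field_simps)
    then have "clear y d" using clear_less_rho[OF y(1) d] by blast
    then show False using fr c(1) near_sym[OF y(3)] unfolding clear_def by blast
  qed
  then show ?thesis using that c(2) by blast
qed

end

section \<open>Quotients by open equivalence relations with closed graph\<close>

text \<open>\<open>closed_E\<close> says that the graph is closed in \<open>X \<times> X\<close>;
  \<open>open_E\<close> is lower semicontinuity of classes, equivalently that saturations of open
  sets are open.\<close>

locale open_closed_equivalence = locally_closed_set M n X
  for M :: "('f, 'r, 'a::{linordered_field, linorder_topology}) expansion"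
    and n :: nat and X :: "(nat \<Rightarrow> 'a) set" +
  fixes E :: "((nat \<Rightarrow> 'a) \<times> (nat \<Rightarrow> 'a)) set"
  assumes equiv_E: "equiv X E"
    and definable_E: "definable M (n + n) {join n n x y | x y. (x, y) \<in> E}"
    and closed_E: "\<And>x y. x \<in> X \<Longrightarrow> y \<in> X \<Longrightarrow>
      (\<And>\<delta>. 0 < \<delta> \<Longrightarrow> \<exists>x' y'. (x', y') \<in> E \<and> near n \<delta> x' x \<and> near n \<delta> y' y) \<Longrightarrow> (x, y) \<in> E"
    and open_E: "\<And>x y \<epsilon>. (x, y) \<in> E \<Longrightarrow> 0 < \<epsilon> \<Longrightarrow>
      \<exists>\<delta>>0. \<forall>x'\<in>X. near n \<delta> x' x \<longrightarrow> (\<exists>y'. (x', y') \<in> E \<and> near n \<epsilon> y' y)"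
begin

lemma E_subset: "(x, y) \<in> E \<Longrightarrow> x \<in> X \<and> y \<in> X"
  using equiv_type[OF equiv_E] by auto

lemma E_refl: "x \<in> X \<Longrightarrow> (x, x) \<in> E"
  using equivE[OF equiv_E] by (meson refl_onD)

lemma E_sym: "(x, y) \<in> E \<Longrightarrow> (y, x) \<in> E"
  using equivE[OF equiv_E] by (meson symE)

lemma E_trans: "(x, y) \<in> E \<Longrightarrow> (y, z) \<in> E \<Longrightarrow> (x, z) \<in> E"
  using equivE[OF equiv_E] by (meson transE)

lemma dpred_E:
  assumes "\<And>i. i < n \<Longrightarrow> dfun M (\<lambda>e. f e i)" "\<And>i. i < n \<Longrightarrow> dfun M (\<lambda>e. g e i)"
    and Fpow: "\<And>e. f e \<in> Fpow n" "\<And>e. g e \<in> Fpow n"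
  shows "dpred M (\<lambda>e. (f e, g e) \<in> E)"
proof -
  have eq: "(f e, g e) \<in> E \<longleftrightarrow> join n n (f e) (g e) \<in> {join n n x y | x y. (x, y) \<in> E}" for e
  proof
    assume "join n n (f e) (g e) \<in> {join n n x y | x y. (x, y) \<in> E}"
    then obtain x y where xy: "(x, y) \<in> E" "join n n (f e) (g e) = join n n x y" by blast
    from E_subset[OF xy(1)] have "x \<in> X" "y \<in> X" by blast+
    from xy(2) join_eq_iff[OF Fpow(1) X_Fpow[OF this(1)] Fpow(2) X_Fpow[OF this(2)]]
    have "f e = x \<and> g e = y" by (rule iffD1[rotated])
    then show "(f e, g e) \<in> E" using xy(1) by simp
  qed blast
  show ?thesis
    unfolding eq by (intro dpred_mem[OF definable_E] dfun_join assms) (assumption | rule join_in_Fpow)+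
qed

section \<open>The distance from a point to an equivalence class\<close>

definition min_dist :: "(nat \<Rightarrow> 'a) \<Rightarrow> (nat \<Rightarrow> 'a) \<Rightarrow> 'a \<Rightarrow> bool" where
  "min_dist a x d \<longleftrightarrow> (\<exists>y\<in>X. (x, y) \<in> E \<and> dist2 a y = d) \<and> (\<forall>y\<in>X. (x, y) \<in> E \<longrightarrow> d \<le> dist2 a y)"

lemma dist2_cong: "(\<And>i. i < Suc n \<Longrightarrow> a i = b i) \<Longrightarrow> dist2 a y = dist2 b y"
  unfolding dist2_def by simp

lemma min_dist_cong: "(\<And>i. i < Suc n \<Longrightarrow> a i = b i) \<Longrightarrow> min_dist a x d = min_dist b x d"
  unfolding min_dist_def using dist2_cong[of a b] by simp

lemma min_dist_unique: "min_dist a x d \<Longrightarrow> min_dist a x d' \<Longrightarrow> d = d'"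
  unfolding min_dist_def by (metis order_antisym)

lemma dist2_limit_le:
  assumes c: "c \<in> X" and L: "\<And>d. 0 < d \<Longrightarrow> \<exists>y\<in>X. near n d y c \<and> dist2 a y \<le> s + d"
  shows "dist2 a c \<le> s"
proof (rule ccontr)
  assume "\<not> ?thesis"
  then have \<epsilon>: "0 < (dist2 a c - s) / 2" by simp
  obtain \<delta> where \<delta>: "\<delta> > 0" "\<forall>y\<in>X. near n \<delta> y c \<longrightarrow> \<bar>dist2 a y - dist2 a c\<bar> < (dist2 a c - s) / 2"
    using dist2_continuous[OF c \<epsilon>] by blast
  let ?d = "min \<delta> ((dist2 a c - s) / 2)"
  obtain y where y: "y \<in> X" "near n ?d y c" "dist2 a y \<le> s + ?d" using L[of ?d] \<delta>(1) \<epsilon> by auto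
  have "near n \<delta> y c" by (rule near_mono[OF y(2)]) simp
  then have "\<bar>dist2 a y - dist2 a c\<bar> < (dist2 a c - s) / 2" using \<delta>(2) y(1) by blast
  moreover have "dist2 a y \<le> s + (dist2 a c - s) / 2" using y(3) by (meson add_left_mono min.cobounded2 order_trans)
  ultimately show False unfolding abs_less_iff by (simp add: field_simps)
qed

text \<open>Near-minimizers stay in one sublevel set, hence cluster in \<open>X\<close>; the closed
  graph keeps the cluster point in the class, and continuity makes it a minimizer.\<close>

lemma min_dist_ex:
  assumes x: "x \<in> X"
  shows "\<exists>d. min_dist a x d"
proof -
  let ?P = "\<lambda>d. \<exists>y\<in>X. (x, y) \<in> E \<and> dist2 a y = d"
  have x': "x \<in> Fpow n" using x by (rule X_Fpow)
  have dP: "dpred M (\<lambda>e. ?P (e 0))"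
    by (intro dintros dpred_bex_definable[OF definable_X] dpred_mem[OF definable_X] dpred_E)
      (simp_all add: x' del: PiE_iff)
  have P0: "?P (dist2 a x)" using x E_refl by blast
  have lb: "0 \<le> d" if "?P d" for d using that dist2_nonneg by blast
  have "\<exists>s. (\<forall>d. ?P d \<longrightarrow> s \<le> d) \<and> (\<forall>b. (\<forall>d. ?P d \<longrightarrow> b \<le> d) \<longrightarrow> b \<le> s)"
    by (rule definable_inf[where P = ?P, OF dP P0]) (rule lb)
  then obtain s where s: "\<forall>d. ?P d \<longrightarrow> s \<le> d" "\<forall>b. (\<forall>d. ?P d \<longrightarrow> b \<le> d) \<longrightarrow> b \<le> s"
    by (elim exE conjE)
  \<comment> \<open>The bound \<open>s + d\<close> drives the values to the infimum; the bound
    \<open>s + 1\<close> keeps all members in one sublevel set, whatever \<open>d\<close>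
    is.\<close>
  let ?L = "\<lambda>d. {y \<in> X. (x, y) \<in> E \<and> dist2 a y \<le> s + d \<and> dist2 a y \<le> s + 1}"
  obtain c where c: "c \<in> X" "\<And>d. 0 < d \<Longrightarrow> \<exists>y\<in>?L d. near n d y c"
  proof (rule sublevel_cluster_point[where L = ?L and r = "s + 1" and a = a])
    have "dpred M (\<lambda>e. restrict (\<lambda>i. e (Suc i)) {..<n} \<in> X \<and> (x, restrict (\<lambda>i. e (Suc i)) {..<n}) \<in> E \<and>
        dist2 a (restrict (\<lambda>i. e (Suc i)) {..<n}) \<le> s + e 0 \<and> dist2 a (restrict (\<lambda>i. e (Suc i)) {..<n}) \<le> s + 1)"
      by (intro dintros dpred_mem[OF definable_X] dpred_E) (simp_all add: x' del: PiE_iff)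
    then show "dpred M (\<lambda>e. restrict (\<lambda>i. e (Suc i)) {..<n} \<in> ?L (e 0))" by simp
    show "?L d \<noteq> {}" if d: "0 < d" for d
    proof -
      have "\<not> s + min d 1 \<le> s" using d by simp
      then obtain d' where "?P d'" "d' < s + min d 1" using s(2) not_le by blast
      then obtain y where "y \<in> X" "(x, y) \<in> E" "dist2 a y < s + min d 1" by blast
      then have "y \<in> ?L d" by (auto simp: min_def split: if_splits)
      then show ?thesis by blast
    qed
  qed (auto intro: order_trans)
  have "(x, c) \<in> E"
  proof (rule closed_E[OF x c(1)])
    fix \<delta> :: 'a assume "0 < \<delta>"
    then obtain y where "(x, y) \<in> E" "near n \<delta> y c" using c(2) by blast
    then show "\<exists>x' y'. (x', y') \<in> E \<and> near n \<delta> x' x \<and> near n \<delta> y' c"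
      using \<open>0 < \<delta>\<close> by (intro exI[of _ x] exI[of _ y]) simp
  qed
  moreover have "dist2 a c \<le> s"
    by (rule dist2_limit_le[OF c(1)]) (use c(2) in blast)
  ultimately have "min_dist a x (dist2 a c)"
    unfolding min_dist_def using c(1) s(1) order_trans by blast
  then show ?thesis by blast
qed

definition mdist :: "(nat \<Rightarrow> 'a) \<Rightarrow> (nat \<Rightarrow> 'a) \<Rightarrow> 'a" where
  "mdist a x = (THE d. min_dist a x d)"

lemma min_dist_iff: "x \<in> X \<Longrightarrow> min_dist a x d \<longleftrightarrow> d = mdist a x"
proof -
  assume "x \<in> X"
  then obtain d0 where d0: "min_dist a x d0" using min_dist_ex by blast
  have "mdist a x = d0" unfolding mdist_def using d0 min_dist_unique by (metis the_equality)
  then show ?thesis using d0 min_dist_unique by blast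
qed

lemma mdist_attained:
  assumes "x \<in> X"
  obtains y where "y \<in> X" "(x, y) \<in> E" "dist2 a y = mdist a x"
  using min_dist_iff[OF assms, of a "mdist a x"] that unfolding min_dist_def by blast

lemma mdist_le: "(x, y) \<in> E \<Longrightarrow> mdist a x \<le> dist2 a y"
  using min_dist_iff[of x a "mdist a x"] E_subset[of x y] unfolding min_dist_def by blast

lemma mdist_invariant: "(x, y) \<in> E \<Longrightarrow> mdist a x = mdist a y"
proof (rule order_antisym)
  assume xy: "(x, y) \<in> E"
  obtain z where "(y, z) \<in> E" "dist2 a z = mdist a y" using mdist_attained E_subset[OF xy] by blast
  then show "mdist a x \<le> mdist a y" using mdist_le E_trans[OF xy] by metis
  obtain z where "(x, z) \<in> E" "dist2 a z = mdist a x" using mdist_attained E_subset[OF xy] by blast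
  then show "mdist a y \<le> mdist a x" using mdist_le E_trans[OF E_sym[OF xy]] by metis
qed

text \<open>From above, \<open>open_E\<close> carries a nearest point of the class of
  \<open>x\<close> to the neighbouring classes. From below, a failure would make nearest points of
  classes of \<open>x'\<close> tending to \<open>x\<close> cluster, and by \<open>closed_E\<close>
  their cluster point would lie in the class of \<open>x\<close>, too close to
  \<open>a\<close>.\<close>

lemma mdist_continuous:
  assumes x: "x \<in> X" and \<epsilon>: "0 < \<epsilon>"
  shows "\<exists>\<delta>>0. \<forall>x'\<in>X. near n \<delta> x' x \<longrightarrow> \<bar>mdist a x' - mdist a x\<bar> < \<epsilon>"
proof -
  obtain y where y: "y \<in> X" "(x, y) \<in> E" "dist2 a y = mdist a x" using mdist_attained[OF x] by blast
  obtain \<eta> where \<eta>: "\<eta> > 0" "\<forall>z\<in>X. near n \<eta> z y \<longrightarrow> \<bar>dist2 a z - dist2 a y\<bar> < \<epsilon>"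
    using dist2_continuous[OF y(1) \<epsilon>] by blast
  obtain \<delta>1 where \<delta>1: "\<delta>1 > 0" "\<forall>x'\<in>X. near n \<delta>1 x' x \<longrightarrow> (\<exists>y'. (x', y') \<in> E \<and> near n \<eta> y' y)"
    using open_E[OF y(2) \<eta>(1)] by blast
  have upper: "mdist a x' < mdist a x + \<epsilon>" if x': "x' \<in> X" "near n \<delta>1 x' x" for x'
  proof -
    obtain y' where y': "(x', y') \<in> E" "near n \<eta> y' y" using \<delta>1(2) x' by blast
    have "y' \<in> X" using E_subset[OF y'(1)] by blast
    then have "\<bar>dist2 a y' - dist2 a y\<bar> < \<epsilon>" using \<eta>(2) y'(2) by blast
    then show ?thesis using mdist_le[OF y'(1), of a] y(3) unfolding abs_less_iff by linarith
  qed
  have "\<exists>\<delta>>0. \<forall>x'\<in>X. near n \<delta> x' x \<longrightarrow> mdist a x - \<epsilon> < mdist a x'"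
  proof (rule ccontr)
    assume "\<not> ?thesis"
    then have neg: "\<exists>x'\<in>X. near n \<delta> x' x \<and> mdist a x' \<le> mdist a x - \<epsilon>" if "0 < \<delta>" for \<delta>
      using that unfolding not_le[symmetric] by blast
    let ?L = "\<lambda>d. {y \<in> X. dist2 a y \<le> mdist a x - \<epsilon> \<and> (\<exists>x'\<in>X. near n d x' x \<and> (x', y) \<in> E)}"
    obtain c where c: "c \<in> X" "\<And>d. 0 < d \<Longrightarrow> \<exists>y\<in>?L d. near n d y c"
    proof (rule sublevel_cluster_point[where L = ?L and r = "mdist a x - \<epsilon>" and a = a])
      have "dpred M (\<lambda>e. restrict (\<lambda>i. e (Suc i)) {..<n} \<in> X \<and>
          dist2 a (restrict (\<lambda>i. e (Suc i)) {..<n}) \<le> mdist a x - \<epsilon> \<and>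
          (\<exists>x'\<in>X. near n (e 0) x' x \<and> (x', restrict (\<lambda>i. e (Suc i)) {..<n}) \<in> E))"
        by (intro dintros dpred_bex_definable[OF definable_X] dpred_mem[OF definable_X] dpred_E) simp_all
      then show "dpred M (\<lambda>e. restrict (\<lambda>i. e (Suc i)) {..<n} \<in> ?L (e 0))" by simp
      show "?L d \<noteq> {}" if d: "0 < d" for d
      proof -
        obtain x' where x': "x' \<in> X" "near n d x' x" "mdist a x' \<le> mdist a x - \<epsilon>" using neg[OF d] by blast
        obtain z where "z \<in> X" "(x', z) \<in> E" "dist2 a z = mdist a x'" using mdist_attained[OF x'(1)] by blast
        then have "z \<in> ?L d" using x' by auto
        then show ?thesis by blast
      qed
      show "?L d \<subseteq> ?L d'" if "d \<le> d'" for d d'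
        using near_mono[OF _ that, of n] by blast
    qed auto
    have "(x, c) \<in> E"
    proof (rule closed_E[OF x c(1)])
      fix \<delta> :: 'a assume "0 < \<delta>"
      then show "\<exists>x' y'. (x', y') \<in> E \<and> near n \<delta> x' x \<and> near n \<delta> y' c" using c(2) by blast
    qed
    moreover have "dist2 a c \<le> mdist a x - \<epsilon>"
    proof (rule dist2_limit_le[OF c(1)])
      fix d :: 'a assume d: "0 < d"
      then obtain y where "y \<in> X" "near n d y c" "dist2 a y \<le> mdist a x - \<epsilon>" using c(2) by blast
      then show "\<exists>y\<in>X. near n d y c \<and> dist2 a y \<le> mdist a x - \<epsilon> + d" using d by (intro bexI[of _ y]) auto
    qed
    ultimately show False using mdist_le[of x c a] \<epsilon> by simp
  qed
  then obtain \<delta>2 where \<delta>2: "\<delta>2 > 0" "\<forall>x'\<in>X. near n \<delta>2 x' x \<longrightarrow> mdist a x - \<epsilon> < mdist a x'" by blast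
  have "\<bar>mdist a x' - mdist a x\<bar> < \<epsilon>" if x': "x' \<in> X" "near n (min \<delta>1 \<delta>2) x' x" for x'
  proof -
    have "near n \<delta>1 x' x" "near n \<delta>2 x' x" using x'(2) by auto
    then have "mdist a x' < mdist a x + \<epsilon>" "mdist a x - \<epsilon> < mdist a x'" using upper \<delta>2(2) x'(1) by blast+
    then show ?thesis unfolding abs_less_iff by linarith
  qed
  then show ?thesis using \<delta>1(1) \<delta>2(1) by (intro exI[of _ "min \<delta>1 \<delta>2"]) auto
qed

text \<open>
  If the distances to two closed sets agree on a neighbourhood of \<open>c\<close>, then, moving from \<open>c\<close> towards a
  nearest point of the first set, strict convexity of the ball forces that point into the second set.
\<close>

lemma mdist_eq_imp_E:
  assumes x: "x \<in> X" and x': "x' \<in> X" and "0 < \<delta>"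
    and eq: "\<And>a. near (Suc n) \<delta> a c \<Longrightarrow> mdist a x = mdist a x'"
  shows "(x, x') \<in> E"
proof -
  obtain y where y: "y \<in> X" "(x, y) \<in> E" "dist2 c y = mdist c x" using mdist_attained[OF x] by blast
  have "\<exists>t>0. \<forall>i<Suc n. t * \<bar>psi y i - c i\<bar> < \<delta>"
  proof (rule finite_choose_delta)
    show "\<exists>t>0. t * \<bar>psi y i - c i\<bar> < \<delta>" for i
    proof (intro exI[of _ "\<delta> / (\<bar>psi y i - c i\<bar> + 1)"] conjI)
      have pos: "0 < \<bar>psi y i - c i\<bar> + 1" by (simp add: add_nonneg_pos)
      show "0 < \<delta> / (\<bar>psi y i - c i\<bar> + 1)" using pos \<open>0 < \<delta>\<close> by simp
      have "\<delta> * \<bar>psi y i - c i\<bar> < \<delta> * (\<bar>psi y i - c i\<bar> + 1)" using \<open>0 < \<delta>\<close> by simp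
      then show "\<delta> / (\<bar>psi y i - c i\<bar> + 1) * \<bar>psi y i - c i\<bar> < \<delta>"
        using pos by (simp add: pos_divide_less_eq)
    qed
    show "s * \<bar>psi y i - c i\<bar> < \<delta>" if "t * \<bar>psi y i - c i\<bar> < \<delta>" "0 < s" "s \<le> t" for i t s
      using mult_right_mono[OF that(3), of "\<bar>psi y i - c i\<bar>"] that(1) by simp
  qed
  then obtain t0 where t0: "t0 > 0" "\<forall>i<Suc n. t0 * \<bar>psi y i - c i\<bar> < \<delta>" by blast
  \<comment> \<open>\<open>t0\<close> keeps \<open>a\<close> within \<open>\<delta>\<close> of
    \<open>c\<close>; the bound \<open>1 / 2\<close> keeps \<open>1 - t\<close> positive.\<close>
  define t where "t = min t0 (1 / 2)"
  have t: "0 < t" "t < 1" using t0(1) by (auto simp: t_def min_def)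
  define a where "a i = c i + t * (psi y i - c i)" for i
  have "near (Suc n) \<delta> a c"
  proof (intro allI impI)
    fix i assume i: "i < Suc n"
    have "\<bar>a i - c i\<bar> = t * \<bar>psi y i - c i\<bar>" using t(1) by (simp add: a_def abs_mult)
    also have "\<dots> \<le> t0 * \<bar>psi y i - c i\<bar>" by (intro mult_right_mono) (auto simp: t_def)
    also have "\<dots> < \<delta>" using t0(2) i by blast
    finally show "\<bar>a i - c i\<bar> < \<delta>" .
  qed
  then have eq_a: "mdist a x = mdist a x'" by (rule eq)
  have eq_c: "mdist c x = mdist c x'" by (rule eq) (use \<open>0 < \<delta>\<close> in simp)
  obtain z where z: "z \<in> X" "(x', z) \<in> E" "dist2 a z = mdist a x'" using mdist_attained[OF x'] by blast
  define S where "S = (\<Sum>i<Suc n. (psi y i - psi z i)\<^sup>2)"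
  \<comment> \<open>Stewart's identity for the point \<open>a\<close> on the segment from
    \<open>c\<close> to \<open>psi y\<close>. Combined with the minimality of \<open>y\<close> and
    \<open>z\<close> it forces \<open>t * S \<le> 0\<close>, where \<open>S\<close> is the squared
    distance between \<open>psi y\<close> and \<open>psi z\<close>.\<close>
  have "(a i - psi z i)\<^sup>2 = (1 - t) * (c i - psi z i)\<^sup>2 + t * (psi y i - psi z i)\<^sup>2 - t * (1 - t) * (c i - psi y i)\<^sup>2" for i
    unfolding a_def power2_eq_square by (simp add: algebra_simps)
  then have z_eq: "dist2 a z = (1 - t) * dist2 c z + t * S - t * (1 - t) * dist2 c y"
    unfolding dist2_def S_def by (simp only: sum.distrib sum_subtractf sum_distrib_left)
  have "(a i - psi y i)\<^sup>2 = (1 - t)\<^sup>2 * (c i - psi y i)\<^sup>2" for i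
    unfolding a_def power2_eq_square by (simp add: algebra_simps)
  then have y_eq: "dist2 a y = (1 - t)\<^sup>2 * dist2 c y"
    unfolding dist2_def by (simp only: sum_distrib_left)
  have "dist2 a z \<le> dist2 a y" using mdist_le[OF y(2), of a] z(3) eq_a by simp
  moreover have "dist2 c y \<le> dist2 c z" using mdist_le[OF z(2), of c] y(3) eq_c by simp
  then have "(1 - t) * dist2 c y \<le> (1 - t) * dist2 c z" using t by (intro mult_left_mono) auto
  ultimately have "(1 - t) * dist2 c y + t * S - t * (1 - t) * dist2 c y \<le> (1 - t)\<^sup>2 * dist2 c y"
    unfolding z_eq y_eq by linarith
  moreover have "(1 - t) * dist2 c y - t * (1 - t) * dist2 c y = (1 - t)\<^sup>2 * dist2 c y"
    by (simp add: power2_eq_square algebra_simps)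
  ultimately have "t * S \<le> 0" by linarith
  then have "S \<le> 0" using t(1) by (simp add: mult_le_0_iff)
  moreover have "0 \<le> S" unfolding S_def by (simp add: sum_nonneg)
  ultimately have "S = 0" by simp
  then have "\<forall>i\<in>{..<Suc n}. (psi y i - psi z i)\<^sup>2 = 0"
    unfolding S_def by (subst (asm) sum_nonneg_eq_0_iff) auto
  then have "psi y i = psi z i" if "i < n" for i using that by simp
  then have "y i = z i" if "i < n" for i using that unfolding psi_def by (metis (full_types))
  then have "y = z" using X_Fpow[OF y(1)] X_Fpow[OF z(1)] by (metis PiE_ext lessThan_iff)
  then show ?thesis using E_trans[OF y(2) E_sym] z(2) by blast
qed

section \<open>Separation of classes by finitely many distance functions\<close>

lemma finite_separating:
  "\<exists>T. finite T \<and> (\<forall>x\<in>X. \<forall>x'\<in>X. (\<forall>a\<in>T. mdist a x = mdist a x') \<longrightarrow> (x, x') \<in> E)"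
proof -
  \<comment> \<open>Layout of environments: \<open>n + 1\<close> values for the test point, then
    \<open>n\<close> for \<open>x\<close> and \<open>n\<close> for \<open>x'\<close>.\<close>
  let ?x = "\<lambda>e. restrict (\<lambda>i. e (i + Suc n)) {..<n}"
  let ?x' = "\<lambda>e. restrict (\<lambda>i. e (i + n + Suc n)) {..<n}"
  \<comment> \<open>Equivalent pairs are excluded, so that by \<open>mdist_eq_imp_E\<close> no
    member of the family contains a box.\<close>
  let ?S = "\<lambda>e. ?x e \<in> X \<and> ?x' e \<in> X \<and> (?x e, ?x' e) \<notin> E \<and> (\<exists>d. min_dist e (?x e) d \<and> min_dist e (?x' e) d)"
  have S: "dpred M ?S"
    unfolding min_dist_def
    by (intro dintros dpred_bex_definable[OF definable_X] dpred_ball_definable[OF definable_X]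
        dpred_mem[OF definable_X] dpred_E) simp_all
  have app_x: "?x (app (Suc n) a e) = restrict e {..<n}" "?x' (app (Suc n) a e) = restrict (\<lambda>i. e (i + n)) {..<n}" for a e
    by (auto simp: app_def)
  have S_app: "?S (app (Suc n) a e) \<longleftrightarrow> restrict e {..<n} \<in> X \<and> restrict (\<lambda>i. e (i + n)) {..<n} \<in> X \<and>
      (restrict e {..<n}, restrict (\<lambda>i. e (i + n)) {..<n}) \<notin> E \<and>
      mdist a (restrict e {..<n}) = mdist a (restrict (\<lambda>i. e (i + n)) {..<n})" for a e
  proof -
    have "min_dist (app (Suc n) a e) y d = min_dist a y d" for y d
      by (rule min_dist_cong) simp
    then show ?thesis unfolding app_x using min_dist_iff by metis
  qed
  have "\<not> (\<exists>c. \<exists>\<delta>>0. \<forall>a. near (Suc n) \<delta> a c \<longrightarrow> ?S (app (Suc n) a e))" for e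
  proof
    assume "\<exists>c. \<exists>\<delta>>0. \<forall>a. near (Suc n) \<delta> a c \<longrightarrow> ?S (app (Suc n) a e)"
    then obtain c \<delta> where c: "\<delta> > 0" "\<And>a. near (Suc n) \<delta> a c \<Longrightarrow> ?S (app (Suc n) a e)" by blast
    have "near (Suc n) \<delta> c c" using c(1) by simp
    note c0 = c(2)[OF this, unfolded S_app]
    have "(restrict e {..<n}, restrict (\<lambda>i. e (i + n)) {..<n}) \<in> E"
      by (rule mdist_eq_imp_E[OF _ _ c(1), of _ _ c]) (use c0 c(2)[unfolded S_app] in blast)+
    then show False using c0 by blast
  qed
  from finite_escape_boxes[OF S this]
  obtain T where T: "finite T" "\<And>e. \<exists>a\<in>T. \<not> ?S (app (Suc n) a e)" by blast
  have "(x, x') \<in> E" if x: "x \<in> X" "x' \<in> X" "\<forall>a\<in>T. mdist a x = mdist a x'" for x x'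
  proof -
    let ?e = "app n x x'"
    have "restrict ?e {..<n} = restrict x {..<n}" "restrict (\<lambda>i. ?e (i + n)) {..<n} = restrict x' {..<n}"
      by (auto simp: app_def)
    moreover have "restrict x {..<n} = x" "restrict x' {..<n} = x'"
      using PiE_restrict[OF X_Fpow[OF x(1)]] PiE_restrict[OF X_Fpow[OF x(2)]] by blast+
    ultimately have e: "restrict ?e {..<n} = x" "restrict (\<lambda>i. ?e (i + n)) {..<n} = x'" by simp_all
    obtain a where "a \<in> T" "\<not> ?S (app (Suc n) a ?e)" using T(2) by blast
    then show ?thesis using x unfolding S_app e by blast
  qed
  then show ?thesis using T(1) by blast
qed

text \<open>One coordinate already gives properness modulo \<open>E\<close>: if points of
  \<open>K\<close> tend to \<open>q x0\<close>, representatives nearest to \<open>as ! 0\<close> lie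
  in one sublevel set and cluster in \<open>X\<close>. The cluster point belongs to the closed
  preimage of \<open>K\<close> and is mapped to \<open>q x0\<close>.\<close>

lemma quotient_identifying:
  assumes as: "as \<noteq> []"
    and q: "q = (\<lambda>x. \<lambda>j\<in>{..<length as}. mdist (as ! j) x)"
  shows "definably_identifying M n (length as) X (q ` X) q"
proof -
  let ?N = "length as"
  have q_nth: "q x j = mdist (as ! j) x" if "j < ?N" for x j
    using that by (simp add: q)
  have q_Fpow: "q x \<in> Fpow ?N" for x
    by (auto simp: q)
  have q_eq: "z = q x \<longleftrightarrow> (\<forall>j<?N. min_dist (as ! j) x (z j))" if "x \<in> X" "z \<in> Fpow ?N" for x z
  proof
    assume "\<forall>j<?N. min_dist (as ! j) x (z j)"
    then have "\<And>j. j \<in> {..<?N} \<Longrightarrow> z j = q x j" using min_dist_iff[OF that(1)] q_nth by simp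
    then show "z = q x" using that(2) q_Fpow[of x] by (rule PiE_ext[rotated 2])
  qed (use min_dist_iff[OF that(1)] q_nth in simp)
  have Y_sub: "q ` X \<subseteq> Fpow ?N" using q_Fpow by blast
  have defY: "definable M ?N (q ` X)"
    unfolding definable_iff_dpred
  proof
    show "q ` X \<subseteq> Fpow ?N" by (rule Y_sub)
    have eq: "restrict e {..<?N} \<in> q ` X \<longleftrightarrow> (\<exists>x\<in>X. \<forall>j<?N. min_dist (as ! j) x (e j))" for e
    proof -
      have "restrict e {..<?N} = q x \<longleftrightarrow> (\<forall>j<?N. min_dist (as ! j) x (e j))" if "x \<in> X" for x
        using q_eq[OF that, of "restrict e {..<?N}"] by simp
      then show ?thesis by (simp add: image_iff)
    qed
    show "dpred M (\<lambda>e. restrict e {..<?N} \<in> q ` X)"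
      unfolding eq min_dist_def
      by (intro dintros dpred_bex_definable[OF definable_X] dpred_ball_definable[OF definable_X]
        dpred_mem[OF definable_X] dpred_E) simp_all
  qed
  have graph: "definable M (n + ?N) {join n ?N x (q x) | x. x \<in> X}"
    unfolding definable_iff_dpred
  proof
    show "{join n ?N x (q x) | x. x \<in> X} \<subseteq> Fpow (n + ?N)" by clarify (rule join_in_Fpow)
    have eq: "restrict e {..<n + ?N} \<in> {join n ?N x (q x) | x. x \<in> X} \<longleftrightarrow>
        (\<exists>x\<in>X. (\<forall>i<n. e i = x i) \<and> (\<forall>j<?N. min_dist (as ! j) x (e (n + j))))" for e
    proof -
      have "restrict e {..<n + ?N} = join n ?N x (q x) \<longleftrightarrow>
          (\<forall>i<n. e i = x i) \<and> (\<forall>j<?N. min_dist (as ! j) x (e (n + j)))" (is "?L \<longleftrightarrow> ?R") if "x \<in> X" for x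
      proof
        assume L: ?L
        have "e i = x i" if "i < n" for i
          using fun_cong[OF L, of i] that by (simp add: join_def)
        moreover have "e (n + j) = q x j" if "j < ?N" for j
          using fun_cong[OF L, of "n + j"] that by (simp add: join_def)
        ultimately show ?R using q_nth min_dist_iff[OF \<open>x \<in> X\<close>] by simp
      next
        assume R: ?R
        show ?L
        proof
          fix i
          show "restrict e {..<n + ?N} i = join n ?N x (q x) i"
          proof (cases "i < n + ?N")
            case True
            show ?thesis
            proof (cases "i < n")
              case True
              then show ?thesis using R by (simp add: join_def)
            next
              case False
              then obtain j where j: "i = n + j" by (metis le_iff_add not_less)
              then have "j < ?N" using True by simp
              then have "e (n + j) = q x j"
                using R q_nth min_dist_iff[OF \<open>x \<in> X\<close>] by simp
              then show ?thesis using j \<open>j < ?N\<close> by (simp add: join_def)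
            qed
          qed (simp add: join_def)
        qed
      qed
      then show ?thesis by blast
    qed
    show "dpred M (\<lambda>e. restrict e {..<n + ?N} \<in> {join n ?N x (q x) | x. x \<in> X})"
      unfolding eq min_dist_def
      by (intro dintros dpred_bex_definable[OF definable_X] dpred_ball_definable[OF definable_X]
        dpred_mem[OF definable_X] dpred_E) simp_all
  qed
  have cont: "\<exists>\<delta>>0. \<forall>x'\<in>X. near n \<delta> x' x \<longrightarrow> near ?N \<epsilon> (q x') (q x)" if x: "x \<in> X" and \<epsilon>: "0 < \<epsilon>" for x \<epsilon>
  proof -
    have "\<exists>\<delta>>0. \<forall>j<?N. \<forall>x'\<in>X. near n \<delta> x' x \<longrightarrow> \<bar>mdist (as ! j) x' - mdist (as ! j) x\<bar> < \<epsilon>"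
    proof (rule finite_choose_delta)
      show "\<exists>\<delta>>0. \<forall>x'\<in>X. near n \<delta> x' x \<longrightarrow> \<bar>mdist (as ! j) x' - mdist (as ! j) x\<bar> < \<epsilon>" for j
        by (rule mdist_continuous[OF x \<epsilon>])
      show "\<forall>x'\<in>X. near n \<delta>' x' x \<longrightarrow> \<bar>mdist (as ! j) x' - mdist (as ! j) x\<bar> < \<epsilon>"
        if "\<forall>x'\<in>X. near n \<delta> x' x \<longrightarrow> \<bar>mdist (as ! j) x' - mdist (as ! j) x\<bar> < \<epsilon>" "\<delta>' \<le> \<delta>" for j \<delta> \<delta>'
        using that near_mono[OF _ that(2), of n] by blast
    qed
    then obtain \<delta> where "0 < \<delta>"
      "\<forall>j<?N. \<forall>x'\<in>X. near n \<delta> x' x \<longrightarrow> \<bar>mdist (as ! j) x' - mdist (as ! j) x\<bar> < \<epsilon>"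
      by blast
    then show ?thesis using q_nth by (intro exI[of _ \<delta>]) simp
  qed
  have q_funcset: "q \<in> X \<rightarrow> q ` X" by blast
  have "definable_continuous_map M n ?N X (q ` X) q"
    unfolding definable_continuous_map_def definable_map_def
      continuous_map_Fpow_iff[OF definable_subset[OF definable_X] Y_sub]
    using definable_X defY graph cont q_funcset by blast
  moreover have "closedin (subtopology (Fpow_top ?N) (q ` X)) K"
    if K: "K \<subseteq> q ` X" "definable M ?N K" "closedin (subtopology (Fpow_top n) X) {x \<in> X. q x \<in> K}" for K
    unfolding closedin_sub_Fpow_iff[OF Y_sub]
  proof (intro conjI ballI impI K(1))
    fix z assume "z \<in> q ` X" and lim: "\<forall>\<delta>>0. \<exists>y\<in>K. near ?N \<delta> y z"
    then obtain x0 where x0: "x0 \<in> X" "z = q x0" by blast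
    \<comment> \<open>Points of \<open>K\<close> within \<open>1\<close> of \<open>z\<close> have
      first coordinate at most \<open>?r\<close>, which bounds their nearest representatives. In
      \<open>?L\<close> the map \<open>q\<close> is spelled out through \<open>min_dist\<close> for
      definability; \<open>L_iff\<close> translates back.\<close>
    let ?a = "as ! 0" and ?r = "mdist (as ! 0) x0 + 1"
    let ?L = "\<lambda>d. {y \<in> X. dist2 ?a y \<le> ?r \<and> (\<exists>z'\<in>K. (\<forall>j<?N. min_dist (as ! j) y (z' j)) \<and> near ?N d z' z)}"
    have K_eq: "(\<forall>j<?N. min_dist (as ! j) y (z' j)) \<longleftrightarrow> z' = q y" if y: "y \<in> X" and z': "z' \<in> K" for y z'
      using q_eq[OF y subsetD[OF Y_sub subsetD[OF K(1) z']]] by blast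
    have L_iff: "y \<in> ?L d \<longleftrightarrow> y \<in> X \<and> dist2 ?a y \<le> ?r \<and> q y \<in> K \<and> near ?N d (q y) z" for y d
    proof (cases "y \<in> X")
      case True
      have "(\<exists>z'\<in>K. (\<forall>j<?N. min_dist (as ! j) y (z' j)) \<and> near ?N d z' z) \<longleftrightarrow> (\<exists>z'\<in>K. z' = q y \<and> near ?N d z' z)"
        using K_eq[OF True] by blast
      then show ?thesis using True by blast
    qed simp
    have "\<exists>c\<in>X. \<forall>d>0. \<exists>y\<in>?L d. near n d y c"
    proof (rule sublevel_cluster_point[where L = ?L and r = ?r and a = ?a])
      have "dpred M (\<lambda>e. restrict (\<lambda>i. e (Suc i)) {..<n} \<in> X \<and>
          dist2 ?a (restrict (\<lambda>i. e (Suc i)) {..<n}) \<le> ?r \<and>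
          (\<exists>z'\<in>K. (\<forall>j<?N. min_dist (as ! j) (restrict (\<lambda>i. e (Suc i)) {..<n}) (z' j)) \<and> near ?N (e 0) z' z))"
        unfolding min_dist_def
        by (intro dintros dpred_bex_definable[OF definable_X] dpred_bex_definable[OF K(2)]
            dpred_ball_definable[OF definable_X] dpred_mem[OF definable_X] dpred_mem[OF K(2)] dpred_E) simp_all
      then show "dpred M (\<lambda>e. restrict (\<lambda>i. e (Suc i)) {..<n} \<in> ?L (e 0))" by simp
      show "?L d \<subseteq> {y \<in> X. dist2 ?a y \<le> ?r}" for d by blast
      show "?L d \<noteq> {}" if d: "0 < d" for d
      proof -
        have "0 < min d 1" using d by simp
        then obtain z' where z': "z' \<in> K" "near ?N (min d 1) z' z" using lim by blast
        then obtain x' where x': "x' \<in> X" "z' = q x'" using K(1) by blast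
        obtain y where y: "y \<in> X" "(x', y) \<in> E" "dist2 ?a y = mdist ?a x'" using mdist_attained[OF x'(1)] by blast
        have "q y = z'" unfolding x'(2) q using mdist_invariant[OF y(2)] by simp
        moreover have "\<bar>z' 0 - z 0\<bar> < min d 1" using z'(2) as by simp
        then have "dist2 ?a y \<le> ?r"
          using y(3) as unfolding x'(2) x0(2) by (simp add: q_nth abs_less_iff)
        moreover have "near ?N d z' z" using z'(2) by simp
        ultimately have "y \<in> ?L d" unfolding L_iff using y(1) z'(1) by simp
        then show ?thesis by blast
      qed
      show "?L d \<subseteq> ?L d'" if "d \<le> d'" for d d'
        using near_mono[OF _ that, of ?N] unfolding subset_iff L_iff by blast
    qed blast
    then obtain c where c: "c \<in> X" "\<And>d. 0 < d \<Longrightarrow> \<exists>y\<in>?L d. near n d y c" by blast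
    have "c \<in> {x \<in> X. q x \<in> K}"
    proof -
      have "\<forall>\<delta>>0. \<exists>y\<in>{x \<in> X. q x \<in> K}. near n \<delta> y c"
      proof (intro allI impI)
        fix \<delta> :: 'a assume "0 < \<delta>"
        from c(2)[OF this] obtain y where y: "y \<in> ?L \<delta>" "near n \<delta> y c" by (elim bexE)
        have "y \<in> {x \<in> X. q x \<in> K}" using y(1)[unfolded L_iff] by simp
        with y(2) show "\<exists>y\<in>{x \<in> X. q x \<in> K}. near n \<delta> y c" by (rule bexI)
      qed
      from conjunct2[OF K(3)[unfolded closedin_sub_Fpow_iff[OF definable_subset[OF definable_X]]], THEN bspec, OF c(1), THEN mp, OF this]
      show ?thesis .
    qed
    moreover have "q c = z"
    proof -
      have "q c j = z j" if j: "j < ?N" for j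
      proof (rule ccontr)
        assume "q c j \<noteq> z j"
        then have \<epsilon>: "0 < \<bar>q c j - z j\<bar> / 2" by simp
        obtain \<delta> where \<delta>: "\<delta> > 0" "\<forall>x'\<in>X. near n \<delta> x' c \<longrightarrow> near ?N (\<bar>q c j - z j\<bar> / 2) (q x') (q c)"
          using cont[OF c(1) \<epsilon>] by blast
        let ?d = "min \<delta> (\<bar>q c j - z j\<bar> / 2)"
        have "0 < ?d" using \<delta>(1) \<epsilon> by simp
        from c(2)[OF this] obtain y where "y \<in> ?L ?d" "near n ?d y c" by (elim bexE)
        then have y: "y \<in> X" "near ?N ?d (q y) z" "near n \<delta> y c" unfolding L_iff by simp_all
        have "\<bar>q y j - q c j\<bar> < \<bar>q c j - z j\<bar> / 2" using \<delta>(2) y(1,3) j by blast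
        moreover have "\<bar>q y j - z j\<bar> < \<bar>q c j - z j\<bar> / 2" using y(2) j by simp
        ultimately show False by (auto simp: abs_if split: if_splits)
      qed
      then show ?thesis using q_Fpow[of c] q_Fpow[of x0] unfolding x0(2) by (intro PiE_ext) auto
    qed
    ultimately show "z \<in> K" by blast
  qed
  ultimately show ?thesis
    unfolding definably_identifying_def by blast
qed

theorem definable_quotient_exists: "\<exists>m Y q. definable_quotient M n X E m Y q"
proof -
  obtain T where T: "finite T" "\<forall>x\<in>X. \<forall>x'\<in>X. (\<forall>a\<in>T. mdist a x = mdist a x') \<longrightarrow> (x, x') \<in> E"
    using finite_separating by blast
  obtain as0 where as0: "set as0 = T" using finite_list[OF T(1)] by blast
  \<comment> \<open>The additional point keeps the list nonempty even if \<open>T\<close> is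
    empty.\<close>
  define as where "as = (\<lambda>_. 0) # as0"
  define q where "q = (\<lambda>x. \<lambda>j\<in>{..<length as}. mdist (as ! j) x)"
  have "definably_identifying M n (length as) X (q ` X) q"
    by (rule quotient_identifying) (simp_all add: as_def q_def)
  moreover have "q x = q x' \<longleftrightarrow> (x, x') \<in> E" if x: "x \<in> X" "x' \<in> X" for x x'
  proof
    assume "(x, x') \<in> E"
    then show "q x = q x'" unfolding q_def using mdist_invariant by simp
  next
    assume eq: "q x = q x'"
    have "mdist a x = mdist a x'" if "a \<in> T" for a
    proof -
      have "a \<in> set as" using that as0 by (simp add: as_def)
      then obtain j where "j < length as" "a = as ! j" by (metis in_set_conv_nth)
      then show ?thesis using fun_cong[OF eq, of j] by (simp add: q_def)
    qed
    then show "(x, x') \<in> E" using T(2) x by blast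
  qed
  moreover have "definable_equivalence M n X E"
    unfolding definable_equivalence_def using definable_X equiv_E definable_E by blast
  ultimately have "definable_quotient M n X E (length as) (q ` X) q"
    unfolding definable_quotient_def by blast
  then show ?thesis by blast
qed

end

section \<open>Proper group actions\<close>

lemma eq_if_near:
  fixes x y :: "nat \<Rightarrow> 'a::linordered_field"
  assumes "x \<in> Fpow n" "y \<in> Fpow n" "\<And>\<epsilon>. 0 < \<epsilon> \<Longrightarrow> \<exists>w. near n \<epsilon> w x \<and> near n \<epsilon> w y"
  shows "x = y"
proof (rule PiE_ext[OF assms(1,2)])
  fix i assume "i \<in> {..<n}"
  then have i: "i < n" by simp
  show "x i = y i"
  proof (rule ccontr)
    assume "x i \<noteq> y i"
    then have "0 < \<bar>x i - y i\<bar> / 2" by simp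
    from assms(3)[OF this] obtain w where w: "near n (\<bar>x i - y i\<bar> / 2) w x" "near n (\<bar>x i - y i\<bar> / 2) w y"
      by (elim exE conjE)
    have "\<bar>w i - x i\<bar> < \<bar>x i - y i\<bar> / 2" "\<bar>w i - y i\<bar> < \<bar>x i - y i\<bar> / 2"
      using w i by blast+
    then show False by (auto simp: abs_if split: if_splits)
  qed
qed

section \<open>Products of definable and of definably compact sets\<close>

lemma restrict_eq_join:
  "restrict e {..<n + m} = join n m (restrict e {..<n}) (restrict (\<lambda>i. e (i + n)) {..<m})"
  by (auto simp: join_def fun_eq_iff)

lemma lpart_in_Fpow [simp]: "lpart n z \<in> Fpow n"
  by (simp add: lpart_def)

lemma rpart_in_Fpow [simp]: "rpart n m z \<in> Fpow m"
  by (simp add: rpart_def)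

lemma set_join_iff:
  assumes "A \<subseteq> Fpow n" "B \<subseteq> Fpow m" "z \<in> Fpow (n + m)"
  shows "z \<in> set_join n m A B \<longleftrightarrow> lpart n z \<in> A \<and> rpart n m z \<in> B"
proof
  assume "z \<in> set_join n m A B"
  then obtain x y where z: "z = join n m x y" "x \<in> A" "y \<in> B" unfolding set_join_def by blast
  have "lpart n z = x" "rpart n m z = y"
    using lpart_join[OF subsetD[OF assms(1) z(2)]] rpart_join[OF subsetD[OF assms(2) z(3)]] z(1) by simp_all
  then show "lpart n z \<in> A \<and> rpart n m z \<in> B" using z by simp
next
  assume *: "lpart n z \<in> A \<and> rpart n m z \<in> B"
  show "z \<in> set_join n m A B"
    unfolding set_join_def using * join_parts[OF assms(3)] by force
qed

lemma set_join_subset: "set_join n m A B \<subseteq> Fpow (n + m)"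
  unfolding set_join_def by (clarify, rule join_in_Fpow)

lemma near_join:
  "near n \<delta> x x' \<Longrightarrow> near m \<delta> y y' \<Longrightarrow> near (n + m) \<delta> (join n m x y) (join n m x' y')"
  by (simp add: join_def)

lemma near_lpart: "near (n + m) \<delta> z z' \<Longrightarrow> near n \<delta> (lpart n z) (lpart n z')"
  by (simp add: lpart_def)

lemma near_rpart: "near (n + m) \<delta> z z' \<Longrightarrow> near m \<delta> (rpart n m z) (rpart n m z')"
  by (simp add: rpart_def)

lemma definable_set_join:
  assumes A: "definable M n A" and B: "definable M m B"
  shows "definable M (n + m) (set_join n m A B)"
  unfolding definable_iff_dpred
proof
  show "set_join n m A B \<subseteq> Fpow (n + m)" by (rule set_join_subset)
  have eq: "restrict e {..<n + m} \<in> set_join n m A B \<longleftrightarrow>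
      restrict e {..<n} \<in> A \<and> restrict (\<lambda>i. e (i + n)) {..<m} \<in> B" for e
  proof -
    have "lpart n (restrict e {..<n + m}) = restrict e {..<n}"
      "rpart n m (restrict e {..<n + m}) = restrict (\<lambda>i. e (i + n)) {..<m}"
      by (auto simp: lpart_def rpart_def fun_eq_iff add.commute)
    moreover have "restrict e {..<n + m} \<in> Fpow (n + m)" by simp
    ultimately show ?thesis
      using set_join_iff[OF definable_subset[OF A] definable_subset[OF B]] by simp
  qed
  show "dpred M (\<lambda>e. restrict e {..<n + m} \<in> set_join n m A B)"
    unfolding eq by (intro dintros dpred_mem[OF A] dpred_mem[OF B]) simp_all
qed

lemma definably_compact_closed:
  fixes M :: "('f, 'r, 'a::{linordered_field, linorder_topology}) expansion"
  assumes K: "definably_compact M n K" and x: "x \<in> Fpow n"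
    and lim: "\<And>\<delta>. 0 < \<delta> \<Longrightarrow> \<exists>y\<in>K. near n \<delta> y x"
  shows "x \<in> K"
proof -
  have "closedin (Fpow_top n) K" using K unfolding definably_compact_def by (elim conjE)
  from conjunct2[OF this[unfolded closedin_Fpow_iff], THEN bspec, OF x, THEN mp] lim
  show ?thesis by simp
qed

lemma definably_compact_join:
  fixes M :: "('f, 'r, 'a::{linordered_field, linorder_topology}) expansion"
  assumes A: "definably_compact M n A" and B: "definably_compact M m B"
  shows "definably_compact M (n + m) (set_join n m A B)"
  unfolding definably_compact_def
proof (intro conjI)
  have sub: "A \<subseteq> Fpow n" "B \<subseteq> Fpow m"
    using A B definable_subset unfolding definably_compact_def by blast+
  show "definable M (n + m) (set_join n m A B)"
    using A B definable_set_join unfolding definably_compact_def by blast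
  show "closedin (Fpow_top (n + m)) (set_join n m A B)"
    unfolding closedin_Fpow_iff
  proof (intro conjI ballI impI set_join_subset)
    fix z assume z: "z \<in> Fpow (n + m)" and lim: "\<forall>\<delta>>0. \<exists>w\<in>set_join n m A B. near (n + m) \<delta> w z"
    have near: "\<exists>w. lpart n w \<in> A \<and> rpart n m w \<in> B \<and> near (n + m) \<delta> w z" if "0 < \<delta>" for \<delta>
    proof -
      from lim[rule_format, OF that] obtain w where w: "w \<in> set_join n m A B" "near (n + m) \<delta> w z"
        by (elim bexE)
      have "w \<in> Fpow (n + m)" using w(1) set_join_subset by (rule subsetD[rotated])
      from w(1)[unfolded set_join_iff[OF sub this]] w(2) show ?thesis by (intro exI[of _ w]) simp
    qed
    have "lpart n z \<in> A"
    proof (rule definably_compact_closed[OF A])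
      fix \<delta> :: 'a assume "0 < \<delta>"
      from near[OF this] obtain w where w: "lpart n w \<in> A" "near (n + m) \<delta> w z" by (elim exE conjE)
      show "\<exists>y\<in>A. near n \<delta> y (lpart n z)"
        by (rule bexI[where x = "lpart n w"], rule near_lpart[OF w(2)], rule w(1))
    qed (rule lpart_in_Fpow)
    moreover have "rpart n m z \<in> B"
    proof (rule definably_compact_closed[OF B])
      fix \<delta> :: 'a assume "0 < \<delta>"
      from near[OF this] obtain w where w: "rpart n m w \<in> B" "near (n + m) \<delta> w z" by (elim exE conjE)
      show "\<exists>y\<in>B. near m \<delta> y (rpart n m z)"
        by (rule bexI[where x = "rpart n m w"], rule near_rpart[OF w(2)], rule w(1))
    qed (rule rpart_in_Fpow)
    ultimately show "z \<in> set_join n m A B" using set_join_iff[OF sub z] by simp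
  qed
  obtain a b where ab: "\<And>x i. x \<in> A \<Longrightarrow> i < n \<Longrightarrow> a \<le> x i \<and> x i \<le> b"
    using A unfolding definably_compact_def bounded_in_Fpow_def by blast
  obtain c d where cd: "\<And>x i. x \<in> B \<Longrightarrow> i < m \<Longrightarrow> c \<le> x i \<and> x i \<le> d"
    using B unfolding definably_compact_def bounded_in_Fpow_def by blast
  show "bounded_in_Fpow (n + m) (set_join n m A B)"
    unfolding bounded_in_Fpow_def
  proof (rule exI[where x = "min a c"], rule exI[where x = "max b d"], intro ballI allI impI)
    fix z i assume "z \<in> set_join n m A B" and i: "i < n + m"
    then obtain x y where z: "z = join n m x y" "x \<in> A" "y \<in> B" unfolding set_join_def by blast
    show "min a c \<le> z i \<and> z i \<le> max b d"
      using ab[OF z(2), of i] cd[OF z(3), of "i - n"] i unfolding z(1) join_def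
      by (auto simp: min_le_iff_disj le_max_iff_disj)
  qed
qed

text \<open>A limit of points of \<open>X\<close> in the closed ball of half a clear radius is not a
  frontier point, so it remains in \<open>X\<close>; halving provides the strict inequality in
  \<open>clear\<close>.\<close>

lemma (in locally_closed_set) compact_neighbourhood:
  assumes x: "x \<in> X"
  shows "\<exists>r>0. definably_compact M n {v \<in> X. \<forall>i<n. \<bar>v i - x i\<bar> \<le> r}"
proof -
  obtain s where s: "clear x s" using clear_ex[OF x] by blast
  then have "0 < s" unfolding clear_def by blast
  let ?V = "{v \<in> X. \<forall>i<n. \<bar>v i - x i\<bar> \<le> s / 2}"
  have "definable M n ?V"
    unfolding definable_iff_dpred
  proof
    show "?V \<subseteq> Fpow n" using X_Fpow by blast
    have "dpred M (\<lambda>e. restrict e {..<n} \<in> X \<and> (\<forall>i<n. \<bar>restrict e {..<n} i - x i\<bar> \<le> s / 2))"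
      by (intro dintros dpred_mem[OF definable_X]) simp_all
    then show "dpred M (\<lambda>e. restrict e {..<n} \<in> ?V)" by simp
  qed
  moreover have "closedin (Fpow_top n) ?V"
    unfolding closedin_Fpow_iff
  proof (intro conjI ballI impI)
    show "?V \<subseteq> Fpow n" using X_Fpow by blast
    fix z assume z: "z \<in> Fpow n" and lim: "\<forall>\<delta>>0. \<exists>v\<in>?V. near n \<delta> v z"
    have le: "\<bar>z i - x i\<bar> \<le> s / 2" if i: "i < n" for i
    proof (rule ccontr)
      assume "\<not> ?thesis"
      then have "0 < \<bar>z i - x i\<bar> - s / 2" by simp
      from lim[rule_format, OF this]
      obtain v where v: "v \<in> ?V" "near n (\<bar>z i - x i\<bar> - s / 2) v z" by (elim bexE)
      have "\<bar>v i - z i\<bar> < \<bar>z i - x i\<bar> - s / 2" "\<bar>v i - x i\<bar> \<le> s / 2" using v i by blast+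
      then show False by linarith
    qed
    have "z \<in> X"
    proof (rule ccontr)
      assume "z \<notin> X"
      moreover have "\<exists>v\<in>X. near n \<delta> v z" if "0 < \<delta>" for \<delta>
      proof -
        from lim[rule_format, OF that] obtain v where "v \<in> ?V" "near n \<delta> v z" by (elim bexE)
        then show ?thesis by (intro bexI[of _ v]) simp_all
      qed
      ultimately have "frontier_pt z" unfolding frontier_pt_def using z by blast
      moreover have "\<bar>z i - x i\<bar> < s" if "i < n" for i
        by (rule le_less_trans[OF le[OF that]]) (use \<open>0 < s\<close> in simp)
      ultimately show False using s z unfolding clear_def by blast
    qed
    then show "z \<in> ?V" using le by simp
  qed
  moreover have "bounded_in_Fpow n ?V"
  proof -
    define b where "b = Max (insert 0 ((\<lambda>i. \<bar>x i\<bar>) ` {..<n}))"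
    have b: "\<bar>x i\<bar> \<le> b" if "i < n" for i unfolding b_def using that by (intro Max_ge) auto
    show ?thesis
      unfolding bounded_in_Fpow_def
    proof (rule exI[where x = "- (b + s / 2)"], rule exI[where x = "b + s / 2"], intro ballI allI impI)
      fix v i assume v: "v \<in> ?V" and i: "i < n"
      have "\<bar>v i - x i\<bar> \<le> s / 2" using v i by blast
      then show "- (b + s / 2) \<le> v i \<and> v i \<le> b + s / 2"
        using b[OF i] unfolding abs_le_iff by linarith
    qed
  qed
  ultimately have "definably_compact M n ?V" unfolding definably_compact_def by blast
  then show ?thesis using \<open>0 < s\<close> by (intro exI[of _ "s / 2"]) simp
qed

section \<open>The orbit relation of a proper action\<close>

locale proper_action = locally_closed_set M n X
  for M :: "('f, 'r, 'a::{linordered_field, linorder_topology}) expansion"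
    and n :: nat and X :: "(nat \<Rightarrow> 'a) set" +
  fixes k :: nat and G :: "(nat \<Rightarrow> 'a) monoid"
    and act :: "(nat \<Rightarrow> 'a) \<Rightarrow> (nat \<Rightarrow> 'a) \<Rightarrow> nat \<Rightarrow> 'a"
  assumes definable_G: "definable M k (carrier G)"
    and G_set: "definable_G_set M k G n X act"
    and proper: "definably_proper_action M k G n X act"
begin

abbreviation "C \<equiv> carrier G"

abbreviation "orbit_rel \<equiv> {(x, act g x) | g x. g \<in> C \<and> x \<in> X}"

abbreviation "act_graph \<equiv>
  {join (k + n) n z (act (lpart k z) (rpart k n z)) | z. z \<in> set_join k n C X}"

lemma action: "group_action G X act"
  using G_set unfolding definable_G_set_def by blast

lemma C_Fpow: "g \<in> C \<Longrightarrow> g \<in> Fpow k"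
  using definable_subset[OF definable_G] by blast

lemma act_in_X: "g \<in> C \<Longrightarrow> x \<in> X \<Longrightarrow> act g x \<in> X"
  using group_action.element_image[OF action] by blast

lemma join_CX: "g \<in> C \<Longrightarrow> x \<in> X \<Longrightarrow> join k n g x \<in> set_join k n C X"
  unfolding set_join_def by blast

lemma parts_CX:
  shows "g \<in> C \<Longrightarrow> lpart k (join k n g x) = g"
    and "x \<in> X \<Longrightarrow> rpart k n (join k n g x) = x"
  by (rule lpart_join[OF C_Fpow], assumption, rule rpart_join[OF X_Fpow], assumption)

lemma definable_graph: "definable M (k + n + n) act_graph"
  using G_set unfolding definable_G_set_def definable_continuous_map_def definable_map_def by blast

lemma mem_act_graph:
  assumes "z \<in> set_join k n C X" "y \<in> Fpow n"
  shows "join (k + n) n z y \<in> act_graph \<longleftrightarrow> y = act (lpart k z) (rpart k n z)"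
proof
  assume "join (k + n) n z y \<in> act_graph"
  then obtain z' where z': "z' \<in> set_join k n C X"
    "join (k + n) n z y = join (k + n) n z' (act (lpart k z') (rpart k n z'))" by blast
  have z'_in: "z' \<in> Fpow (k + n)" "z \<in> Fpow (k + n)"
    by (rule subsetD[OF set_join_subset z'(1)], rule subsetD[OF set_join_subset assms(1)])
  have "lpart k z' \<in> C \<and> rpart k n z' \<in> X"
    using z'(1) set_join_iff[OF definable_subset[OF definable_G] definable_subset[OF definable_X] z'_in(1)] by simp
  then have "act (lpart k z') (rpart k n z') \<in> Fpow n" using act_in_X X_Fpow by simp
  from z'(2) join_eq_iff[OF z'_in(2) z'_in(1) assms(2) this]
  show "y = act (lpart k z) (rpart k n z)" by simp
next
  assume "y = act (lpart k z) (rpart k n z)"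
  then show "join (k + n) n z y \<in> act_graph" using assms(1) by blast
qed

lemma act_continuous:
  assumes "g \<in> C" "x \<in> X" "0 < \<epsilon>"
  shows "\<exists>\<delta>>0. \<forall>g'\<in>C. \<forall>x'\<in>X. near k \<delta> g' g \<longrightarrow> near n \<delta> x' x \<longrightarrow> near n \<epsilon> (act g' x') (act g x)"
proof -
  have "\<forall>z\<in>set_join k n C X. \<forall>\<epsilon>>0. \<exists>\<delta>>0. \<forall>z'\<in>set_join k n C X. near (k + n) \<delta> z' z \<longrightarrow>
      near n \<epsilon> (act (lpart k z') (rpart k n z')) (act (lpart k z) (rpart k n z))"
    using G_set
    unfolding definable_G_set_def definable_continuous_map_def
      continuous_map_Fpow_iff[OF set_join_subset definable_subset[OF definable_X]]
    by (elim conjE)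
  from this[THEN bspec, OF join_CX[OF assms(1,2)], rule_format, OF assms(3)]
  obtain \<delta> where \<delta>: "\<delta> > 0" "\<And>z'. z' \<in> set_join k n C X \<Longrightarrow> near (k + n) \<delta> z' (join k n g x) \<Longrightarrow>
      near n \<epsilon> (act (lpart k z') (rpart k n z')) (act (lpart k (join k n g x)) (rpart k n (join k n g x)))"
    by (elim exE conjE) blast
  have "near n \<epsilon> (act g' x') (act g x)" if g': "g' \<in> C" "x' \<in> X" "near k \<delta> g' g" "near n \<delta> x' x" for g' x'
    using \<delta>(2)[OF join_CX[OF g'(1,2)] near_join[OF g'(3,4)]]
    by (simp only: parts_CX assms(1,2) g'(1,2))
  then show ?thesis using \<delta>(1) by blast
qed

lemma orbit_rel_iff: "(x, y) \<in> orbit_rel \<longleftrightarrow> x \<in> X \<and> (\<exists>g\<in>C. y = act g x)"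
  by auto

text \<open>Properness turns compact neighbourhoods of \<open>x\<close> and \<open>y\<close> into a
  compact set \<open>?P\<close> of pairs \<open>(g, x')\<close>. Pairs whose images approach
  \<open>(x, y)\<close> cluster in \<open>?P\<close>, and continuity identifies the cluster point as
  some \<open>(g, x)\<close> with \<open>act g x = y\<close>.\<close>

lemma orbit_rel_closed:
  assumes x: "x \<in> X" and y: "y \<in> X"
    and lim: "\<And>\<delta>. 0 < \<delta> \<Longrightarrow> \<exists>x' y'. (x', y') \<in> orbit_rel \<and> near n \<delta> x' x \<and> near n \<delta> y' y"
  shows "(x, y) \<in> orbit_rel"
proof -
  obtain r where r: "r > 0" "definably_compact M n {v \<in> X. \<forall>i<n. \<bar>v i - x i\<bar> \<le> r}" (is "definably_compact M n ?V")
    using compact_neighbourhood[OF x] by blast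
  obtain s where s: "s > 0" "definably_compact M n {v \<in> X. \<forall>i<n. \<bar>v i - y i\<bar> \<le> s}" (is "definably_compact M n ?W")
    using compact_neighbourhood[OF y] by blast
  let ?K = "set_join n n ?V ?W"
  let ?F = "\<lambda>z. join n n (rpart k n z) (act (lpart k z) (rpart k n z))"
  let ?P = "{z \<in> set_join k n C X. ?F z \<in> ?K}"
  have "?K \<subseteq> set_join n n X X" unfolding set_join_def by blast
  then have P: "definably_compact M (k + n) ?P"
    using proper definably_compact_join[OF r(2) s(2)]
    unfolding definably_proper_action_def definably_proper_def by blast
  then have dP: "definable M (k + n) ?P"
    unfolding definably_compact_def by blast
  obtain a b where ab: "\<And>z i. z \<in> ?P \<Longrightarrow> i < k + n \<Longrightarrow> a \<le> z i \<and> z i \<le> b"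
    using P unfolding definably_compact_def bounded_in_Fpow_def by blast
  \<comment> \<open>The image of \<open>z\<close> is named by a witness \<open>w\<close> of
    \<open>act_graph\<close>, which expresses its closeness to \<open>y\<close> definably.\<close>
  let ?L = "\<lambda>d. {z \<in> ?P. near n d (rpart k n z) x \<and> (\<exists>w\<in>X. join (k + n) n z w \<in> act_graph \<and> near n d w y)}"
  have L: "z \<in> ?P \<and> near n d (rpart k n z) x \<and> near n d (act (lpart k z) (rpart k n z)) y" if z: "z \<in> ?L d" for z d
  proof -
    obtain w where w: "w \<in> X" "join (k + n) n z w \<in> act_graph" "near n d w y" using z by blast
    have "w = act (lpart k z) (rpart k n z)"
      using mem_act_graph[OF _ X_Fpow[OF w(1)], of z] z w(2) by blast
    then show ?thesis using z w(3) by blast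
  qed
  have "\<exists>c\<in>Fpow (k + n). \<forall>d>0. \<exists>z\<in>?L d. near (k + n) d z c"
  proof (rule cluster_point[where L = ?L])
    let ?z = "\<lambda>e :: nat \<Rightarrow> 'a. restrict (\<lambda>i. e (Suc i)) {..<k + n}"
    have "dpred M (\<lambda>e. ?z e \<in> ?P \<and> near n (e 0) (\<lambda>i. e (Suc (k + i))) x \<and>
        (\<exists>w\<in>X. join (k + n) n (?z e) w \<in> act_graph \<and> near n (e 0) w y))"
      by (intro dintros dpred_mem[OF dP] dpred_bex_definable[OF definable_X] dpred_mem[OF definable_X]
          dpred_mem[OF definable_graph] dfun_join) (assumption | rule join_in_Fpow | simp)+
    moreover have "rpart k n (?z e) i = e (Suc (k + i))" if "i < n" for e i
      using that by (simp add: rpart_def)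
    ultimately show "dpred M (\<lambda>e. ?z e \<in> ?L (e 0))" by simp
    show "?L d \<subseteq> Fpow (k + n)" for d using definable_subset[OF dP] by blast
    show "?L d \<noteq> {}" if d: "0 < d" for d
    proof -
      \<comment> \<open>Including \<open>r\<close> and \<open>s\<close> places the nearby pair in
        \<open>?V\<close> and \<open>?W\<close>.\<close>
      let ?d = "min d (min r s)"
      have "0 < ?d" using d r(1) s(1) by simp
      from lim[OF this] obtain x' y' where xy: "(x', y') \<in> orbit_rel" "near n ?d x' x" "near n ?d y' y"
        by (elim exE conjE)
      then obtain g where g: "g \<in> C" "x' \<in> X" "y' = act g x'" unfolding orbit_rel_iff by blast
      have y': "y' \<in> X" using g act_in_X by simp
      have near_d: "near n d x' x" "near n d y' y" using xy(2,3) by simp_all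
      have "x' \<in> ?V" using g(2) xy(2) by (auto intro: less_imp_le)
      moreover have "y' \<in> ?W" using y' xy(3) by (auto intro: less_imp_le)
      ultimately have "join n n x' y' \<in> ?K" unfolding set_join_def by blast
      then have "join k n g x' \<in> ?P"
        using join_CX[OF g(1,2)] parts_CX(1)[OF g(1)] parts_CX(2)[OF g(2)] g(3) by simp
      moreover have "join (k + n) n (join k n g x') y' \<in> act_graph"
        using mem_act_graph[OF join_CX[OF g(1,2)] X_Fpow[OF y']] parts_CX(1)[OF g(1)] parts_CX(2)[OF g(2)] g(3)
        by simp
      ultimately have "join k n g x' \<in> ?L d"
        using near_d y' parts_CX(2)[OF g(2)] by auto
      then show ?thesis by blast
    qed
    show "?L d \<subseteq> ?L d'" if "d \<le> d'" for d d'
      using near_mono[OF _ that, of n] by blast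
    show "a \<le> z i \<and> z i \<le> b" if "z \<in> ?L d" "i < k + n" for d z i
      using ab that by blast
  qed blast
  then obtain c where c: "c \<in> Fpow (k + n)" "\<And>d. 0 < d \<Longrightarrow> \<exists>z\<in>?L d. near (k + n) d z c" by blast
  have lim_c: "\<exists>z\<in>?P. near (k + n) d z c \<and> near n d (rpart k n z) x \<and> near n d (act (lpart k z) (rpart k n z)) y"
    if d: "0 < d" for d
  proof -
    from c(2)[OF d] obtain z where z: "z \<in> ?L d" "near (k + n) d z c" by (elim bexE)
    from L[OF z(1)] z(2) show ?thesis by blast
  qed
  have "c \<in> ?P"
  proof (rule definably_compact_closed[OF P c(1)])
    show "\<exists>z\<in>?P. near (k + n) \<delta> z c" if "0 < \<delta>" for \<delta>
      using lim_c[OF that] by (elim bexE conjE) (rule bexI)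
  qed
  then have cC: "c \<in> set_join k n C X" by blast
  then have parts: "lpart k c \<in> C" "rpart k n c \<in> X"
    using set_join_iff[OF definable_subset[OF definable_G] definable_subset[OF definable_X] c(1)] by simp_all
  have "rpart k n c = x"
  proof (rule eq_if_near[OF _ X_Fpow[OF x]])
    fix \<epsilon> :: 'a assume "0 < \<epsilon>"
    from lim_c[OF this] obtain z where "near (k + n) \<epsilon> z c" "near n \<epsilon> (rpart k n z) x" by (elim bexE conjE)
    then show "\<exists>w. near n \<epsilon> w (rpart k n c) \<and> near n \<epsilon> w x"
      by (intro exI[of _ "rpart k n z"] conjI near_rpart)
  qed (rule rpart_in_Fpow)
  moreover have "act (lpart k c) (rpart k n c) = y"
  proof (rule eq_if_near[OF X_Fpow[OF act_in_X[OF parts]] X_Fpow[OF y]])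
    fix \<epsilon> :: 'a assume \<epsilon>: "0 < \<epsilon>"
    from act_continuous[OF parts \<epsilon>] obtain \<delta> where \<delta>: "\<delta> > 0"
      "\<forall>g'\<in>C. \<forall>x'\<in>X. near k \<delta> g' (lpart k c) \<longrightarrow> near n \<delta> x' (rpart k n c) \<longrightarrow>
        near n \<epsilon> (act g' x') (act (lpart k c) (rpart k n c))"
      by (elim exE conjE)
    have "0 < min \<delta> \<epsilon>" using \<delta>(1) \<epsilon> by simp
    from lim_c[OF this] obtain z where z: "z \<in> ?P" "near (k + n) (min \<delta> \<epsilon>) z c"
      "near n (min \<delta> \<epsilon>) (act (lpart k z) (rpart k n z)) y" by (elim bexE conjE)
    have "z \<in> Fpow (k + n)" using z(1) definable_subset[OF dP] by blast
    then have zp: "lpart k z \<in> C" "rpart k n z \<in> X"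
      using z(1) set_join_iff[OF definable_subset[OF definable_G] definable_subset[OF definable_X]] by blast+
    have "near (k + n) \<delta> z c" by (rule near_mono[OF z(2)]) simp
    then have "near n \<epsilon> (act (lpart k z) (rpart k n z)) (act (lpart k c) (rpart k n c))"
      using \<delta>(2)[THEN bspec, OF zp(1), THEN bspec, OF zp(2), THEN mp, OF near_lpart, THEN mp, OF _ near_rpart] by blast
    moreover have "near n \<epsilon> (act (lpart k z) (rpart k n z)) y" by (rule near_mono[OF z(3)]) simp
    ultimately show "\<exists>w. near n \<epsilon> w (act (lpart k c) (rpart k n c)) \<and> near n \<epsilon> w y"
      by (intro exI[of _ "act (lpart k z) (rpart k n z)"] conjI)
  qed
  ultimately show ?thesis unfolding orbit_rel_iff using x parts(1) by blast
qed

lemma orbit_rel_equiv: "equiv X orbit_rel"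
proof (rule equivI)
  interpret group_action G X act by (rule action)
  have G: "group G" using group_hom group_hom.axioms(1) by blast
  show "orbit_rel \<subseteq> X \<times> X" using act_in_X by auto
  show "refl_on X orbit_rel"
  proof (rule refl_onI)
    fix x assume "x \<in> X"
    moreover have "act \<one>\<^bsub>G\<^esub> x = x" using id_eq_one \<open>x \<in> X\<close> by (metis restrict_apply')
    moreover have "\<one>\<^bsub>G\<^esub> \<in> C" using G by (simp add: group.is_monoid monoid.one_closed)
    ultimately show "(x, x) \<in> orbit_rel" unfolding orbit_rel_iff by metis
  qed
  show "sym orbit_rel"
  proof (rule symI)
    fix x y assume "(x, y) \<in> orbit_rel"
    then obtain g where g: "g \<in> C" "x \<in> X" "y = act g x" unfolding orbit_rel_iff by blast
    have "act (inv\<^bsub>G\<^esub> g) y = x" using orbit_sym_aux[OF g(1,2)] g(3) by simp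
    moreover have "inv\<^bsub>G\<^esub> g \<in> C" using G g(1) by (simp add: group.inv_closed)
    moreover have "y \<in> X" using g act_in_X by simp
    ultimately show "(y, x) \<in> orbit_rel" unfolding orbit_rel_iff by metis
  qed
  show "trans orbit_rel"
  proof (rule transI)
    fix x y z assume "(x, y) \<in> orbit_rel" "(y, z) \<in> orbit_rel"
    then obtain g h where g: "g \<in> C" "x \<in> X" "y = act g x" and h: "h \<in> C" "z = act h y"
      unfolding orbit_rel_iff by blast
    have "z = act (h \<otimes>\<^bsub>G\<^esub> g) x" using composition_rule[OF g(2) h(1) g(1)] g(3) h(2) by simp
    moreover have "h \<otimes>\<^bsub>G\<^esub> g \<in> C" using G g(1) h(1) by (simp add: group.is_monoid monoid.m_closed)
    ultimately show "(x, z) \<in> orbit_rel" unfolding orbit_rel_iff using g(2) by blast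
  qed
qed

lemma definable_orbit_rel: "definable M (n + n) {join n n x y | x y. (x, y) \<in> orbit_rel}"
  unfolding definable_iff_dpred
proof
  show "{join n n x y | x y. (x, y) \<in> orbit_rel} \<subseteq> Fpow (n + n)" by (clarify, rule join_in_Fpow)
  let ?x = "\<lambda>e. restrict e {..<n}" and ?y = "\<lambda>e. restrict (\<lambda>i. e (i + n)) {..<n}"
  have eq: "restrict e {..<n + n} \<in> {join n n x y | x y. (x, y) \<in> orbit_rel} \<longleftrightarrow>
      ?x e \<in> X \<and> (\<exists>g\<in>C. join (k + n) n (join k n g (?x e)) (?y e) \<in> act_graph)" for e :: "nat \<Rightarrow> 'a"
  proof -
    have y: "?y e \<in> Fpow n" and x: "?x e \<in> Fpow n" by simp_all
    have "restrict e {..<n + n} \<in> {join n n x y | x y. (x, y) \<in> orbit_rel} \<longleftrightarrow> (?x e, ?y e) \<in> orbit_rel"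
      unfolding restrict_eq_join[of e n n]
    proof
      assume "join n n (?x e) (?y e) \<in> {join n n x y | x y. (x, y) \<in> orbit_rel}"
      then obtain x' y' where xy: "(x', y') \<in> orbit_rel" "join n n (?x e) (?y e) = join n n x' y'" by blast
      have in_X: "x' \<in> X" "y' \<in> X" using xy(1) act_in_X by auto
      from xy(2) join_eq_iff[OF x X_Fpow[OF in_X(1)] y X_Fpow[OF in_X(2)]]
      have "?x e = x' \<and> ?y e = y'" by (rule iffD1[rotated])
      then show "(?x e, ?y e) \<in> orbit_rel" using xy(1) by metis
    qed blast
    also have "\<dots> \<longleftrightarrow> ?x e \<in> X \<and> (\<exists>g\<in>C. ?y e = act g (?x e))" by (rule orbit_rel_iff)
    also have "\<dots> \<longleftrightarrow> ?x e \<in> X \<and> (\<exists>g\<in>C. join (k + n) n (join k n g (?x e)) (?y e) \<in> act_graph)"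
    proof (rule conj_cong[OF refl])
      assume "?x e \<in> X"
      then have "?y e = act g (?x e) \<longleftrightarrow> join (k + n) n (join k n g (?x e)) (?y e) \<in> act_graph" if "g \<in> C" for g
        using mem_act_graph[OF join_CX[OF that] y] parts_CX(1)[OF that] parts_CX(2) by simp
      then show "(\<exists>g\<in>C. ?y e = act g (?x e)) \<longleftrightarrow> (\<exists>g\<in>C. join (k + n) n (join k n g (?x e)) (?y e) \<in> act_graph)"
        by (rule bex_cong[OF refl])
    qed
    finally show ?thesis .
  qed
  show "dpred M (\<lambda>e. restrict e {..<n + n} \<in> {join n n x y | x y. (x, y) \<in> orbit_rel})"
    unfolding eq
    by (intro dintros dpred_bex_definable[OF definable_G] dpred_mem[OF definable_X] dpred_mem[OF definable_G]
        dpred_mem[OF definable_graph] dfun_join) (assumption | rule join_in_Fpow | simp)+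
qed

text \<open>The same group element \<open>g\<close> moves all nearby points: \<open>act g x'\<close>
  approaches \<open>act g x\<close> as \<open>x'\<close> approaches \<open>x\<close>.\<close>

lemma orbit_rel_open:
  assumes "(x, y) \<in> orbit_rel" "0 < \<epsilon>"
  shows "\<exists>\<delta>>0. \<forall>x'\<in>X. near n \<delta> x' x \<longrightarrow> (\<exists>y'. (x', y') \<in> orbit_rel \<and> near n \<epsilon> y' y)"
proof -
  obtain g where g: "g \<in> C" "x \<in> X" "y = act g x" using assms(1) unfolding orbit_rel_iff by blast
  from act_continuous[OF g(1,2) assms(2)] obtain \<delta> where \<delta>: "\<delta> > 0"
    "\<forall>g'\<in>C. \<forall>x'\<in>X. near k \<delta> g' g \<longrightarrow> near n \<delta> x' x \<longrightarrow> near n \<epsilon> (act g' x') (act g x)"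
    by (elim exE conjE)
  have gg: "near k \<delta> g g" using \<delta>(1) by simp
  show ?thesis
  proof (intro exI[of _ \<delta>] conjI ballI impI \<delta>(1))
    fix x' assume x': "x' \<in> X" "near n \<delta> x' x"
    have "near n \<epsilon> (act g x') y"
      unfolding g(3) by (rule \<delta>(2)[THEN bspec, OF g(1), THEN bspec, OF x'(1), THEN mp, OF gg, THEN mp, OF x'(2)])
    moreover have "(x', act g x') \<in> orbit_rel" using g(1) x'(1) by blast
    ultimately show "\<exists>y'. (x', y') \<in> orbit_rel \<and> near n \<epsilon> y' y"
      by (intro exI[of _ "act g x'"] conjI)
  qed
qed

lemma quotient_by_action: "\<exists>m Y q. definable_quotient M n X orbit_rel m Y q"
proof -
  interpret open_closed_equivalence M n X orbit_rel
  proof unfold_locales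
    show "equiv X orbit_rel" by (rule orbit_rel_equiv)
    show "definable M (n + n) {join n n x y | x y. (x, y) \<in> orbit_rel}" by (rule definable_orbit_rel)
    show "(x, y) \<in> orbit_rel" if "x \<in> X" "y \<in> X"
      "\<And>\<delta>. 0 < \<delta> \<Longrightarrow> \<exists>x' y'. (x', y') \<in> orbit_rel \<and> near n \<delta> x' x \<and> near n \<delta> y' y" for x y
      by (rule orbit_rel_closed[OF that])
    show "\<exists>\<delta>>0. \<forall>x'\<in>X. near n \<delta> x' x \<longrightarrow> (\<exists>y'. (x', y') \<in> orbit_rel \<and> near n \<epsilon> y' y)"
      if "(x, y) \<in> orbit_rel" "0 < \<epsilon>" for x y \<epsilon>
      by (rule orbit_rel_open[OF that])
  qed
  show ?thesis by (rule definable_quotient_exists)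
qed

end

theorem theorem1p2:
  fixes M :: "('f, 'r, 'a::{linordered_field, linorder_topology}) expansion"
    and G :: "(nat \<Rightarrow> 'a) monoid"
    and X :: "(nat \<Rightarrow> 'a) set"
    and act :: "(nat \<Rightarrow> 'a) \<Rightarrow> (nat \<Rightarrow> 'a) \<Rightarrow> nat \<Rightarrow> 'a"
    and k n :: nat
  assumes "d_minimal M"
    and "definable_group M k G"
    and "definable_G_set M k G n X act"
    and "locally_closed n X"
    and "definably_proper_action M k G n X act"
  shows "\<exists>m Y q. definable_quotient M n X {(x, act g x) | g x. g \<in> carrier G \<and> x \<in> X} m Y q"
proof -
  interpret proper_action M n X k G act
  proof unfold_locales
    show "d_minimal M" by fact
    show "definable M n X" using assms(3) unfolding definable_G_set_def by blast
    show "locally_closed n X" by fact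
    show "definable M k (carrier G)" using assms(2) unfolding definable_group_def by blast
    show "definable_G_set M k G n X act" by fact
    show "definably_proper_action M k G n X act" by fact
  qed
  show ?thesis by (rule quotient_by_action)
qed

end
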